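(* Let $\mathsf{TsKer}$ be the symmetric monoidal category of measurable spaces and s-finite transition kernels, and let $\mathsf{TsKer}^{\mathrm{op}}$ be its opposite, with the same monoidal product. Then the exponential functor $(\,\cdot\,)_e$ on $\mathsf{TsKer}^{\mathrm{op}}$, together with the dereliction $\mathsf{d}$, storage $\mathsf{s}$, monoidal maps $\mathsf{m}_{\mathcal X,\mathcal Y}$, $\mathsf{m}_{\mathcal I}$, weakening $\mathsf{w}$ and contraction $\mathsf{c}$ described in the context, forms a linear exponential comonad on $\mathsf{TsKer}^{\mathrm{op}}$.
   Context: Transition kernels. A transition kernel from a measurable space $(X,\mathcal X)$ to $(Y,\mathcal Y)$ is a function $\kappa:X\times\mathcal Y\to[0,\infty]$ such that $\kappa(x,-)$ is a measure on $\mathcal Y$ for every $x\in X$ and $\kappa(-,B)$ is measurable for every $B\in\mathcal Y$. Composition of $\kappa$ from $X$ to $Y$ and $\iota$ from $Y$ to $Z$ is $(\iota\circ\kappa)(x,C)=\int_Y\kappa(x,dy)\,\iota(y,C)$; the identity is the Dirac kernel $\delta(x,A)=1$ if $x\in A$ and $0$ otherwise. A kernel $\kappa$ is finite if $\sup_{x}\kappa(x,Y)<\infty$, and s-finite if $\kappa=\sum_{i\in\mathbb N}\kappa_i$ (pointwise) with each $\kappa_i$ finite. $\mathsf{TsKer}$ has measurable spaces as objects and s-finite kernels as morphisms. Its monoidal product is $(X_1\times X_2,\mathcal X_1\otimes\mathcal X_2)$ (product $\sigma$-field generated by measurable rectangles) on objects, and on kernels the unique kernel with $(\kappa_1\otimes\kappa_2)((x_1,x_2),B_1\times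 B_2)=\kappa_1(x_1,B_1)\kappa_2(x_2,B_2)$; the unit is the one-point space $\mathcal I=(\{*\},\{\emptyset,\{*\}\})$. A morphism $\mathcal X\to\mathcal Y$ in $\mathsf{TsKer}^{\mathrm{op}}$ is an s-finite kernel from $\mathcal Y$ to $\mathcal X$. Exponential spaces. For a set $X$, $X_e$ is the set of finite multisets $x_1\cdots x_n$ over $X$ (the free commutative monoid; the empty multiset is written $0$); $X^{(n)}\subseteq X_e$ are the multisets of cardinality $n$. $X_e^\bullet=\biguplus_{n\ge0}X^n$ is the set of finite ordered sequences, with $\sigma$-field $\mathcal X_e^\bullet=\{\biguplus_n A_n: A_n\in\mathcal X^{\otimes n}\}$, and $F:X_e^\bullet\to X_e$ forgets the order. The $\sigma$-field $\mathcal X_e$ on $X_e$ is the one generated by the sets $A_1\cdots A_n=\{a_1\cdots a_n: a_i\in A_i\}$ with $A_i\in\mathcal X$ (equivalently $\{A\subseteq X_e: F^{-1}(A)\in\mathcal X_e^\bullet\}$). For an s-finite kernel $\kappa$ from $(X,\mathcal X)$ to $(Y,\mathcal Y)$, the kernel $\kappa_e$ from $(X_e,\mathcal X_e)$ to $(Y_e,\mathcal Y_e)$ is $\kappa_e(x_1\cdots x_m,\mathbf B)=\kappa^{\otimes m}((x_1,\dots,x_m),F^{-1}(\mathbf B)\cap Y^m)$ (independent of the ordering). The exponential functor on $\mathsf{TsKer}^{\mathrm{op}}$ sends $\mathcal X$ to $(X_e,\mathcal X_e)$ and a morphism (a kernel from $\mathcal Y$ to $\mathcal X$) to the corresponding $\kappa_e$.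 $X_{ee}=(X_e)_e$ with $\sigma$-field $\mathcal X_{ee}=(\mathcal X_e)_e$, and $|\cdot|:X_{ee}\to X_e$ is the flattening map $\mathbf a_1\cdots\mathbf a_n\mapsto$ the multiset sum of $\mathbf a_1,\dots,\mathbf a_n$. Structure maps, described as kernels in $\mathsf{TsKer}$ (1 if condition holds, else 0): $\mathsf d_{\mathcal X}:\mathcal X_e\to\mathcal X$ in $\mathsf{TsKer}^{\mathrm{op}}$ is the kernel from $X$ to $X_e$ with $\mathsf d(x,\mathbf A)=1$ iff the one-element multiset $x\in\mathbf A$; $\mathsf s_{\mathcal X}:\mathcal X_e\to\mathcal X_{ee}$ is the kernel from $X_{ee}$ to $X_e$ with $\mathsf s(\mathfrak y,\mathbf A)=1$ iff $|\mathfrak y|\in\mathbf A$; $\mathsf m_{\mathcal I}:\mathcal I\to\mathcal I_e$ is the kernel from $I_e$ to $I$ with $\mathsf m_{\mathcal I}( *^n,\{*\})=\min(n,1)$, where $*^n$ is the multiset of $n$ copies of $*$; $\mathsf m_{\mathcal X,\mathcal Y}:\mathcal X_e\otimes\mathcal Y_e\to(\mathcal X\otimes\mathcal Y)_e$ is the kernel from $(X\times Y)_e$ to $X_e\times Y_e$ with $\mathsf m((x_1,y_1)\cdots(x_n,y_n),\mathbf A\times\mathbf B)=\delta(x_1\cdots x_n,\mathbf A)\,\delta(y_1\cdots y_n,\mathbf B)$; $\mathsf w_{\mathcal X}:\mathcal X_e\to\mathcal I$ is the kernel from $I$ to $X_e$ with $\mathsf w( *,\mathbf A)=1$ iff $0\in\mathbf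 A$; $\mathsf c_{\mathcal X}:\mathcal X_e\to\mathcal X_e\otimes\mathcal X_e$ is the kernel from $X_e\times X_e$ to $X_e$ with $\mathsf c((\mathbf x^1,\mathbf x^2),\mathbf A)=1$ iff the multiset sum $\mathbf x^1\mathbf x^2\in\mathbf A$. Linear exponential comonad on a symmetric monoidal category $(\mathcal C,\otimes,I)$: a monoidal comonad $(!,\mathsf s:!\Rightarrow!!,\mathsf d:!\Rightarrow\mathrm{Id},\mathsf m_{X,Y}:!X\otimes!Y\to!(X\otimes Y),\mathsf m_I:I\to!I)$ with monoidal natural transformations $\mathsf c_X:!X\to!X\otimes!X$ and $\mathsf w_X:!X\to I$ such that each $(!X,\mathsf c_X,\mathsf w_X)$ is a commutative comonoid, $\mathsf c_X$ and $\mathsf w_X$ are coalgebra morphisms from $(!X,\mathsf s_X)$ to $(!X\otimes!X,\mathsf m_{!X,!X}\circ(\mathsf s_X\otimes\mathsf s_X))$ and to $(I,\mathsf m_I)$ respectively, and $\mathsf s_X$ is a comonoid morphism from $(!X,\mathsf c_X,\mathsf w_X)$ to $(!!X,\mathsf c_{!X},\mathsf w_{!X})$.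
   Formalization: m_I( *^n,{*}) is taken to be 1 for all n, including n=0 (min(n,1)=0 there contradicts w_I∘m_I=id); tensor and power kernels are iterated-integral products, since rectangle values do not determine s-finite ones; spaces live in an arbitrary universe closed under pairs and multisets. *)

theory Defs
  imports "HOL-Probability.Probability"
begin

section \<open>Symmetric monoidal categories\<close>

record ('o, 'm) category =
  Obj :: "'o set"
  Hom :: "'o \<Rightarrow> 'o \<Rightarrow> 'm set"
  Idn :: "'o \<Rightarrow> 'm"
  Comp :: "'m \<Rightarrow> 'm \<Rightarrow> 'm" (infixl "\<odot>\<index>" 55)

locale category =
  fixes C :: "('o, 'm, 'z) category_scheme" (structure)
  assumes Hom_Obj: "f \<in> Hom C X Y \<Longrightarrow> X \<in> Obj C \<and> Y \<in> Obj C"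
    and Hom_disjoint: "f \<in> Hom C X Y \<Longrightarrow> f \<in> Hom C X' Y' \<Longrightarrow> X = X' \<and> Y = Y'"
    and Idn_Hom: "X \<in> Obj C \<Longrightarrow> Idn C X \<in> Hom C X X"
    and Comp_Hom: "f \<in> Hom C X Y \<Longrightarrow> g \<in> Hom C Y Z \<Longrightarrow> g \<odot> f \<in> Hom C X Z"
    and Comp_Idn_left: "f \<in> Hom C X Y \<Longrightarrow> Idn C Y \<odot> f = f"
    and Comp_Idn_right: "f \<in> Hom C X Y \<Longrightarrow> f \<odot> Idn C X = f"
    and Comp_assoc: "f \<in> Hom C X Y \<Longrightarrow> g \<in> Hom C Y Z \<Longrightarrow> h \<in> Hom C Z W \<Longrightarrow>
      (h \<odot> g) \<odot> f = h \<odot> (g \<odot> f)"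

definition is_inverse :: "('o, 'm, 'z) category_scheme \<Rightarrow> 'o \<Rightarrow> 'o \<Rightarrow> 'm \<Rightarrow> 'm \<Rightarrow> bool" where
  "is_inverse C X Y f g \<longleftrightarrow> f \<in> Hom C X Y \<and> g \<in> Hom C Y X \<and>
     g \<odot>\<^bsub>C\<^esub> f = Idn C X \<and> f \<odot>\<^bsub>C\<^esub> g = Idn C Y"

definition iso :: "('o, 'm, 'z) category_scheme \<Rightarrow> 'o \<Rightarrow> 'o \<Rightarrow> 'm \<Rightarrow> bool" where
  "iso C X Y f \<longleftrightarrow> (\<exists>g. is_inverse C X Y f g)"

definition inverse_arrow :: "('o, 'm, 'z) category_scheme \<Rightarrow> 'o \<Rightarrow> 'o \<Rightarrow> 'm \<Rightarrow> 'm" where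
  "inverse_arrow C X Y f = (THE g. is_inverse C X Y f g)"

text \<open>
  Orientation of the structure isomorphisms:
  \<open>Assoc X Y Z : (X \<otimes> Y) \<otimes> Z \<rightarrow> X \<otimes> (Y \<otimes> Z)\<close>, \<open>Lunit X : I \<otimes> X \<rightarrow> X\<close>,
  \<open>Runit X : X \<otimes> I \<rightarrow> X\<close>, \<open>Symm X Y : X \<otimes> Y \<rightarrow> Y \<otimes> X\<close>.
  The tensor is written \<open>\<otimes>\<close> on objects and \<open>\<boxtimes>\<close> on arrows.
\<close>

record ('o, 'm) smc = "('o, 'm) category" +
  TenO :: "'o \<Rightarrow> 'o \<Rightarrow> 'o" (infixr "\<otimes>\<index>" 70)
  TenA :: "'m \<Rightarrow> 'm \<Rightarrow> 'm" (infixr "\<boxtimes>\<index>" 70)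
  Unit :: "'o"
  Assoc :: "'o \<Rightarrow> 'o \<Rightarrow> 'o \<Rightarrow> 'm"
  Lunit :: "'o \<Rightarrow> 'm"
  Runit :: "'o \<Rightarrow> 'm"
  Symm :: "'o \<Rightarrow> 'o \<Rightarrow> 'm"

locale symmetric_monoidal_category = category C
  for C :: "('o, 'm, 'z) smc_scheme" (structure) +
  assumes Unit_Obj: "Unit C \<in> Obj C"
    and TenO_Obj: "X \<in> Obj C \<Longrightarrow> Y \<in> Obj C \<Longrightarrow> X \<otimes> Y \<in> Obj C"
    and TenA_Hom: "f \<in> Hom C X X' \<Longrightarrow> g \<in> Hom C Y Y' \<Longrightarrow> f \<boxtimes> g \<in> Hom C (X \<otimes> Y) (X' \<otimes> Y')"
    and TenA_Idn: "X \<in> Obj C \<Longrightarrow> Y \<in> Obj C \<Longrightarrow> Idn C X \<boxtimes> Idn C Y = Idn C (X \<otimes> Y)"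
    and TenA_Comp: "f \<in> Hom C X X' \<Longrightarrow> f' \<in> Hom C X' X'' \<Longrightarrow> g \<in> Hom C Y Y' \<Longrightarrow> g' \<in> Hom C Y' Y'' \<Longrightarrow>
      (f' \<odot> f) \<boxtimes> (g' \<odot> g) = (f' \<boxtimes> g') \<odot> (f \<boxtimes> g)"
    and Assoc_iso: "X \<in> Obj C \<Longrightarrow> Y \<in> Obj C \<Longrightarrow> Z \<in> Obj C \<Longrightarrow>
      iso C ((X \<otimes> Y) \<otimes> Z) (X \<otimes> (Y \<otimes> Z)) (Assoc C X Y Z)"
    and Lunit_iso: "X \<in> Obj C \<Longrightarrow> iso C (Unit C \<otimes> X) X (Lunit C X)"
    and Runit_iso: "X \<in> Obj C \<Longrightarrow> iso C (X \<otimes> Unit C) X (Runit C X)"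
    and Symm_Hom: "X \<in> Obj C \<Longrightarrow> Y \<in> Obj C \<Longrightarrow> Symm C X Y \<in> Hom C (X \<otimes> Y) (Y \<otimes> X)"
    and Symm_Symm: "X \<in> Obj C \<Longrightarrow> Y \<in> Obj C \<Longrightarrow> Symm C Y X \<odot> Symm C X Y = Idn C (X \<otimes> Y)"
    and Assoc_natural: "f \<in> Hom C X X' \<Longrightarrow> g \<in> Hom C Y Y' \<Longrightarrow> h \<in> Hom C Z Z' \<Longrightarrow>
      Assoc C X' Y' Z' \<odot> ((f \<boxtimes> g) \<boxtimes> h) = (f \<boxtimes> (g \<boxtimes> h)) \<odot> Assoc C X Y Z"
    and Lunit_natural: "f \<in> Hom C X X' \<Longrightarrow> Lunit C X' \<odot> (Idn C (Unit C) \<boxtimes> f) = f \<odot> Lunit C X"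
    and Runit_natural: "f \<in> Hom C X X' \<Longrightarrow> Runit C X' \<odot> (f \<boxtimes> Idn C (Unit C)) = f \<odot> Runit C X"
    and Symm_natural: "f \<in> Hom C X X' \<Longrightarrow> g \<in> Hom C Y Y' \<Longrightarrow>
      Symm C X' Y' \<odot> (f \<boxtimes> g) = (g \<boxtimes> f) \<odot> Symm C X Y"
    and pentagon: "X \<in> Obj C \<Longrightarrow> Y \<in> Obj C \<Longrightarrow> Z \<in> Obj C \<Longrightarrow> W \<in> Obj C \<Longrightarrow>
      (Idn C X \<boxtimes> Assoc C Y Z W) \<odot> Assoc C X (Y \<otimes> Z) W \<odot> (Assoc C X Y Z \<boxtimes> Idn C W)
        = Assoc C X Y (Z \<otimes> W) \<odot> Assoc C (X \<otimes> Y) Z W"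
    and triangle: "X \<in> Obj C \<Longrightarrow> Y \<in> Obj C \<Longrightarrow>
      (Idn C X \<boxtimes> Lunit C Y) \<odot> Assoc C X (Unit C) Y = Runit C X \<boxtimes> Idn C Y"
    and hexagon: "X \<in> Obj C \<Longrightarrow> Y \<in> Obj C \<Longrightarrow> Z \<in> Obj C \<Longrightarrow>
      Assoc C Y Z X \<odot> Symm C X (Y \<otimes> Z) \<odot> Assoc C X Y Z
        = (Idn C Y \<boxtimes> Symm C X Z) \<odot> Assoc C Y X Z \<odot> (Symm C X Y \<boxtimes> Idn C Z)"

definition opposite :: "('o, 'm) smc \<Rightarrow> ('o, 'm) smc" where
  "opposite C = \<lparr>
     Obj = Obj C,
     Hom = (\<lambda>X Y. Hom C Y X),
     Idn = Idn C,
     Comp = (\<lambda>g f. f \<odot>\<^bsub>C\<^esub> g),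
     TenO = TenO C,
     TenA = TenA C,
     Unit = Unit C,
     Assoc = (\<lambda>X Y Z. inverse_arrow C ((X \<otimes>\<^bsub>C\<^esub> Y) \<otimes>\<^bsub>C\<^esub> Z) (X \<otimes>\<^bsub>C\<^esub> (Y \<otimes>\<^bsub>C\<^esub> Z)) (Assoc C X Y Z)),
     Lunit = (\<lambda>X. inverse_arrow C (Unit C \<otimes>\<^bsub>C\<^esub> X) X (Lunit C X)),
     Runit = (\<lambda>X. inverse_arrow C (X \<otimes>\<^bsub>C\<^esub> Unit C) X (Runit C X)),
     Symm = (\<lambda>X Y. inverse_arrow C (X \<otimes>\<^bsub>C\<^esub> Y) (Y \<otimes>\<^bsub>C\<^esub> X) (Symm C X Y)) \<rparr>"


section \<open>Monoidal endofunctors and their transformations\<close>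

record ('o, 'm) mon_functor =
  FO :: "'o \<Rightarrow> 'o"
  FA :: "'m \<Rightarrow> 'm"
  FM :: "'o \<Rightarrow> 'o \<Rightarrow> 'm" \<comment> \<open>\<open>F X \<otimes> F Y \<rightarrow> F (X \<otimes> Y)\<close>\<close>
  FI :: "'m" \<comment> \<open>\<open>I \<rightarrow> F I\<close>\<close>

locale monoidal_endofunctor = symmetric_monoidal_category C
  for C :: "('o, 'm, 'z) smc_scheme" (structure) +
  fixes F :: "('o, 'm) mon_functor"
  assumes FO_Obj: "X \<in> Obj C \<Longrightarrow> FO F X \<in> Obj C"
    and FA_Hom: "f \<in> Hom C X Y \<Longrightarrow> FA F f \<in> Hom C (FO F X) (FO F Y)"
    and FA_Idn: "X \<in> Obj C \<Longrightarrow> FA F (Idn C X) = Idn C (FO F X)"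
    and FA_Comp: "f \<in> Hom C X Y \<Longrightarrow> g \<in> Hom C Y Z \<Longrightarrow> FA F (g \<odot> f) = FA F g \<odot> FA F f"
    and FM_Hom: "X \<in> Obj C \<Longrightarrow> Y \<in> Obj C \<Longrightarrow> FM F X Y \<in> Hom C (FO F X \<otimes> FO F Y) (FO F (X \<otimes> Y))"
    and FI_Hom: "FI F \<in> Hom C (Unit C) (FO F (Unit C))"
    and FM_natural: "f \<in> Hom C X X' \<Longrightarrow> g \<in> Hom C Y Y' \<Longrightarrow>
      FM F X' Y' \<odot> (FA F f \<boxtimes> FA F g) = FA F (f \<boxtimes> g) \<odot> FM F X Y"
    and FM_Assoc: "X \<in> Obj C \<Longrightarrow> Y \<in> Obj C \<Longrightarrow> Z \<in> Obj C \<Longrightarrow>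
      FA F (Assoc C X Y Z) \<odot> FM F (X \<otimes> Y) Z \<odot> (FM F X Y \<boxtimes> Idn C (FO F Z))
        = FM F X (Y \<otimes> Z) \<odot> (Idn C (FO F X) \<boxtimes> FM F Y Z) \<odot> Assoc C (FO F X) (FO F Y) (FO F Z)"
    and FM_Lunit: "X \<in> Obj C \<Longrightarrow>
      FA F (Lunit C X) \<odot> FM F (Unit C) X \<odot> (FI F \<boxtimes> Idn C (FO F X)) = Lunit C (FO F X)"
    and FM_Runit: "X \<in> Obj C \<Longrightarrow>
      FA F (Runit C X) \<odot> FM F X (Unit C) \<odot> (Idn C (FO F X) \<boxtimes> FI F) = Runit C (FO F X)"
    and FM_Symm: "X \<in> Obj C \<Longrightarrow> Y \<in> Obj C \<Longrightarrow>
      FA F (Symm C X Y) \<odot> FM F X Y = FM F Y X \<odot> Symm C (FO F X) (FO F Y)"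

definition id_functor :: "('o, 'm, 'z) smc_scheme \<Rightarrow> ('o, 'm) mon_functor" where
  "id_functor C = \<lparr> FO = (\<lambda>X. X), FA = (\<lambda>f. f),
     FM = (\<lambda>X Y. Idn C (X \<otimes>\<^bsub>C\<^esub> Y)), FI = Idn C (Unit C) \<rparr>"

definition comp_functor ::
  "('o, 'm, 'z) smc_scheme \<Rightarrow> ('o, 'm) mon_functor \<Rightarrow> ('o, 'm) mon_functor \<Rightarrow> ('o, 'm) mon_functor" where
  "comp_functor C G F = \<lparr> FO = (\<lambda>X. FO G (FO F X)), FA = (\<lambda>f. FA G (FA F f)),
     FM = (\<lambda>X Y. FA G (FM F X Y) \<odot>\<^bsub>C\<^esub> FM G (FO F X) (FO F Y)),
     FI = FA G (FI F) \<odot>\<^bsub>C\<^esub> FI G \<rparr>"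

definition unit_functor :: "('o, 'm, 'z) smc_scheme \<Rightarrow> ('o, 'm) mon_functor" where
  "unit_functor C = \<lparr> FO = (\<lambda>X. Unit C), FA = (\<lambda>f. Idn C (Unit C)),
     FM = (\<lambda>X Y. Lunit C (Unit C)), FI = Idn C (Unit C) \<rparr>"

text \<open>\<open>middle_swap C X Y Z W : (X \<otimes> Y) \<otimes> (Z \<otimes> W) \<rightarrow> (X \<otimes> Z) \<otimes> (Y \<otimes> W)\<close>\<close>

definition middle_swap :: "('o, 'm, 'z) smc_scheme \<Rightarrow> 'o \<Rightarrow> 'o \<Rightarrow> 'o \<Rightarrow> 'o \<Rightarrow> 'm" where
  "middle_swap C X Y Z W =
     inverse_arrow C ((X \<otimes>\<^bsub>C\<^esub> Z) \<otimes>\<^bsub>C\<^esub> (Y \<otimes>\<^bsub>C\<^esub> W)) (X \<otimes>\<^bsub>C\<^esub> (Z \<otimes>\<^bsub>C\<^esub> (Y \<otimes>\<^bsub>C\<^esub> W))) (Assoc C X Z (Y \<otimes>\<^bsub>C\<^esub> W))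
     \<odot>\<^bsub>C\<^esub> (Idn C X \<boxtimes>\<^bsub>C\<^esub>
        (Assoc C Z Y W \<odot>\<^bsub>C\<^esub> (Symm C Y Z \<boxtimes>\<^bsub>C\<^esub> Idn C W) \<odot>\<^bsub>C\<^esub>
         inverse_arrow C ((Y \<otimes>\<^bsub>C\<^esub> Z) \<otimes>\<^bsub>C\<^esub> W) (Y \<otimes>\<^bsub>C\<^esub> (Z \<otimes>\<^bsub>C\<^esub> W)) (Assoc C Y Z W)))
     \<odot>\<^bsub>C\<^esub> Assoc C X Y (Z \<otimes>\<^bsub>C\<^esub> W)"

definition ten_functor ::
  "('o, 'm, 'z) smc_scheme \<Rightarrow> ('o, 'm) mon_functor \<Rightarrow> ('o, 'm) mon_functor \<Rightarrow> ('o, 'm) mon_functor" where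
  "ten_functor C F G = \<lparr> FO = (\<lambda>X. FO F X \<otimes>\<^bsub>C\<^esub> FO G X), FA = (\<lambda>f. FA F f \<boxtimes>\<^bsub>C\<^esub> FA G f),
     FM = (\<lambda>X Y. (FM F X Y \<boxtimes>\<^bsub>C\<^esub> FM G X Y) \<odot>\<^bsub>C\<^esub> middle_swap C (FO F X) (FO G X) (FO F Y) (FO G Y)),
     FI = (FI F \<boxtimes>\<^bsub>C\<^esub> FI G) \<odot>\<^bsub>C\<^esub>
        inverse_arrow C (Unit C \<otimes>\<^bsub>C\<^esub> Unit C) (Unit C) (Lunit C (Unit C)) \<rparr>"

text \<open>
  Below, \<open>F\<close> and \<open>G\<close> are built from a monoidal endofunctor by the four constructions above, which
  preserve monoidality, so that only the conditions on the transformation are listed.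
\<close>

locale monoidal_transformation =
  fixes C :: "('o, 'm, 'z) smc_scheme" (structure)
    and F G :: "('o, 'm) mon_functor" and t :: "'o \<Rightarrow> 'm"
  assumes component_Hom: "X \<in> Obj C \<Longrightarrow> t X \<in> Hom C (FO F X) (FO G X)"
    and natural: "f \<in> Hom C X Y \<Longrightarrow> t Y \<odot> FA F f = FA G f \<odot> t X"
    and monoidal_ten: "X \<in> Obj C \<Longrightarrow> Y \<in> Obj C \<Longrightarrow>
      t (X \<otimes> Y) \<odot> FM F X Y = FM G X Y \<odot> (t X \<boxtimes> t Y)"
    and monoidal_unit: "t (Unit C) \<odot> FI F = FI G"


section \<open>Linear exponential comonads\<close>

locale monoidal_comonad = monoidal_endofunctor C E
  for C :: "('o, 'm, 'z) smc_scheme" (structure) and E :: "('o, 'm) mon_functor" +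
  fixes s d :: "'o \<Rightarrow> 'm"
  assumes s_monoidal: "monoidal_transformation C E (comp_functor C E E) s"
    and d_monoidal: "monoidal_transformation C E (id_functor C) d"
    and comonad_assoc: "X \<in> Obj C \<Longrightarrow> s (FO E X) \<odot> s X = FA E (s X) \<odot> s X"
    and comonad_counit_left: "X \<in> Obj C \<Longrightarrow> d (FO E X) \<odot> s X = Idn C (FO E X)"
    and comonad_counit_right: "X \<in> Obj C \<Longrightarrow> FA E (d X) \<odot> s X = Idn C (FO E X)"

locale coalgebra =
  fixes C :: "('o, 'm, 'z) smc_scheme" (structure)
    and E :: "('o, 'm) mon_functor" and s d :: "'o \<Rightarrow> 'm" and A :: 'o and h :: 'm
  assumes coaction_Hom: "h \<in> Hom C A (FO E A)"
    and coaction_counit: "d A \<odot> h = Idn C A"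
    and coaction_assoc: "s A \<odot> h = FA E h \<odot> h"

locale coalgebra_morphism = dom: coalgebra C E s d A h + cod: coalgebra C E s d B k
  for C :: "('o, 'm, 'z) smc_scheme" (structure) and E s d A h B k +
  fixes f :: 'm
  assumes coalgebra_morphism_Hom: "f \<in> Hom C A B"
    and coalgebra_morphism_coaction: "k \<odot> f = FA E f \<odot> h"

locale commutative_comonoid =
  fixes C :: "('o, 'm, 'z) smc_scheme" (structure) and A :: 'o and c w :: 'm
  assumes comult_Hom: "c \<in> Hom C A (A \<otimes> A)"
    and counit_Hom: "w \<in> Hom C A (Unit C)"
    and comult_assoc: "Assoc C A A A \<odot> (c \<boxtimes> Idn C A) \<odot> c = (Idn C A \<boxtimes> c) \<odot> c"
    and comult_counit_left: "Lunit C A \<odot> (w \<boxtimes> Idn C A) \<odot> c = Idn C A"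
    and comult_counit_right: "Runit C A \<odot> (Idn C A \<boxtimes> w) \<odot> c = Idn C A"
    and comult_commute: "Symm C A A \<odot> c = c"

locale comonoid_morphism = dom: commutative_comonoid C A c w + cod: commutative_comonoid C B c' w'
  for C :: "('o, 'm, 'z) smc_scheme" (structure) and A c w B c' w' +
  fixes f :: 'm
  assumes comonoid_morphism_Hom: "f \<in> Hom C A B"
    and comonoid_morphism_comult: "c' \<odot> f = (f \<boxtimes> f) \<odot> c"
    and comonoid_morphism_counit: "w' \<odot> f = w"

locale linear_exponential_comonad = monoidal_comonad C E s d
  for C :: "('o, 'm, 'z) smc_scheme" (structure) and E :: "('o, 'm) mon_functor" and s d +
  fixes c w :: "'o \<Rightarrow> 'm"
  assumes c_monoidal: "monoidal_transformation C E (ten_functor C E E) c"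
    and w_monoidal: "monoidal_transformation C E (unit_functor C) w"
    and comonoid: "X \<in> Obj C \<Longrightarrow> commutative_comonoid C (FO E X) (c X) (w X)"
    and c_coalgebra_morphism: "X \<in> Obj C \<Longrightarrow>
      coalgebra_morphism C E s d (FO E X) (s X)
        (FO E X \<otimes> FO E X) (FM E (FO E X) (FO E X) \<odot> (s X \<boxtimes> s X)) (c X)"
    and w_coalgebra_morphism: "X \<in> Obj C \<Longrightarrow>
      coalgebra_morphism C E s d (FO E X) (s X) (Unit C) (FI E) (w X)"
    and s_comonoid_morphism: "X \<in> Obj C \<Longrightarrow>
      comonoid_morphism C (FO E X) (c X) (w X)
        (FO E (FO E X)) (c (FO E X)) (w (FO E X)) (s X)"


section \<open>Transition kernels\<close>

definition transition_kernel :: "'a measure \<Rightarrow> 'b measure \<Rightarrow> ('a \<Rightarrow> 'b measure) \<Rightarrow> bool" where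
  "transition_kernel X Y \<kappa> \<longleftrightarrow> (\<forall>x\<in>space X. sets (\<kappa> x) = sets Y) \<and>
     (\<forall>B\<in>sets Y. (\<lambda>x. emeasure (\<kappa> x) B) \<in> borel_measurable X)"

definition finite_kernel :: "'a measure \<Rightarrow> 'b measure \<Rightarrow> ('a \<Rightarrow> 'b measure) \<Rightarrow> bool" where
  "finite_kernel X Y \<kappa> \<longleftrightarrow> transition_kernel X Y \<kappa> \<and> (SUP x\<in>space X. emeasure (\<kappa> x) (space Y)) < \<infinity>"

definition s_finite_kernel :: "'a measure \<Rightarrow> 'b measure \<Rightarrow> ('a \<Rightarrow> 'b measure) \<Rightarrow> bool" where
  "s_finite_kernel X Y \<kappa> \<longleftrightarrow> transition_kernel X Y \<kappa> \<and>
     (\<exists>\<kappa>'. (\<forall>i::nat. finite_kernel X Y (\<kappa>' i)) \<and>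
           (\<forall>x\<in>space X. \<forall>B\<in>sets Y. emeasure (\<kappa> x) B = (\<Sum>i. emeasure (\<kappa>' i x) B)))"

text \<open>The measurable space \<open>X\<^sup>n\<close> of sequences of length \<open>n\<close> with its product \<open>\<sigma>\<close>-field.\<close>

definition seq_space :: "'a measure \<Rightarrow> nat \<Rightarrow> 'a list measure" where
  "seq_space X n = sigma {xs. length xs = n \<and> set xs \<subseteq> space X}
     {{xs. list_all2 (\<in>) xs As} | As. length As = n \<and> set As \<subseteq> sets X}"

text \<open>\<open>kernel_pow Y \<kappa> [x\<^sub>1, \<dots>, x\<^sub>m]\<close> is the measure \<open>\<kappa>\<^sup>\<otimes>\<^sup>m((x\<^sub>1, \<dots>, x\<^sub>m), -)\<close> on \<open>Y\<^sup>m\<close>.\<close>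

primrec kernel_pow :: "'b measure \<Rightarrow> ('a \<Rightarrow> 'b measure) \<Rightarrow> 'a list \<Rightarrow> 'b list measure" where
  "kernel_pow Y \<kappa> [] = return (seq_space Y 0) []"
| "kernel_pow Y \<kappa> (x # xs) =
     distr (\<kappa> x \<Otimes>\<^sub>M kernel_pow Y \<kappa> xs) (seq_space Y (Suc (length xs))) (\<lambda>(y, ys). y # ys)"

text \<open>Arrows carry their source and target. Kernel maps are made unique by taking them
  \<open>undefined\<close> outside the source space.\<close>

datatype ('a, 'b) kernel =
  Kernel (src: "'a measure") (tgt: "'b measure") (app: "'a \<Rightarrow> 'b measure")

definition kernel_comp :: "('b, 'c) kernel \<Rightarrow> ('a, 'b) kernel \<Rightarrow> ('a, 'c) kernel" where
  "kernel_comp \<iota> \<kappa> = Kernel (src \<kappa>) (tgt \<iota>)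
     (\<lambda>x\<in>space (src \<kappa>). measure_of (space (tgt \<iota>)) (sets (tgt \<iota>))
        (\<lambda>C. \<integral>\<^sup>+ y. emeasure (app \<iota> y) C \<partial>app \<kappa> x))"

definition dirac_kernel :: "'a measure \<Rightarrow> 'b measure \<Rightarrow> ('a \<Rightarrow> 'b) \<Rightarrow> ('a, 'b) kernel" where
  "dirac_kernel X Y f = Kernel X Y (\<lambda>x\<in>space X. return Y (f x))"


section \<open>The category of measurable spaces and s-finite kernels\<close>

text \<open>
  A category in HOL has a single type of objects, so measurable spaces live on subsets of a universe
  over an arbitrary type \<open>'u\<close> that contains a copy of \<open>'u\<close> and a point, and is closed under pairs and
  finite multisets. Every measurable space on a set of elements of \<open>'u\<close> is represented via \<open>Atom\<close>.
\<close>

datatype 'u univ =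
    Atom 'u
  | Star
  | Pr (pfst: "'u univ") (psnd: "'u univ")
  | Ms (bag: "'u univ multiset")

text \<open>A measurable space is a value of type \<open>measure\<close> whose measure is zero.\<close>

definition measurable_spaces :: "'a measure set" where
  "measurable_spaces = {X. null_measure X = X}"

definition one_space :: "'u univ measure" where
  "one_space = sigma {Star} {{}, {Star}}"

definition prod_space :: "'u univ measure \<Rightarrow> 'u univ measure \<Rightarrow> 'u univ measure" where
  "prod_space X Y = sigma {Pr x y | x y. x \<in> space X \<and> y \<in> space Y}
     {{Pr x y | x y. x \<in> A \<and> y \<in> B} | A B. A \<in> sets X \<and> B \<in> sets Y}"

text \<open>
  An s-finite kernel on a product is not determined by its values on rectangles when these are
  infinite; the tensor of kernels is the one for which Fubini's theorem holds, i.e.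
  \<open>(\<kappa>\<^sub>1 \<otimes> \<kappa>\<^sub>2)((x\<^sub>1, x\<^sub>2), C) = \<integral>\<integral> 1\<^sub>C(y\<^sub>1, y\<^sub>2) \<kappa>\<^sub>2(x\<^sub>2, dy\<^sub>2) \<kappa>\<^sub>1(x\<^sub>1, dy\<^sub>1)\<close>, which is how \<open>\<Otimes>\<^sub>M\<close> is defined.
\<close>

definition kernel_prod ::
  "('u univ, 'u univ) kernel \<Rightarrow> ('u univ, 'u univ) kernel \<Rightarrow> ('u univ, 'u univ) kernel" where
  "kernel_prod \<kappa>\<^sub>1 \<kappa>\<^sub>2 = Kernel (prod_space (src \<kappa>\<^sub>1) (src \<kappa>\<^sub>2)) (prod_space (tgt \<kappa>\<^sub>1) (tgt \<kappa>\<^sub>2))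
     (\<lambda>x\<in>space (prod_space (src \<kappa>\<^sub>1) (src \<kappa>\<^sub>2)).
        distr (app \<kappa>\<^sub>1 (pfst x) \<Otimes>\<^sub>M app \<kappa>\<^sub>2 (psnd x)) (prod_space (tgt \<kappa>\<^sub>1) (tgt \<kappa>\<^sub>2)) (\<lambda>(y\<^sub>1, y\<^sub>2). Pr y\<^sub>1 y\<^sub>2))"

definition TsKer :: "('u univ measure, ('u univ, 'u univ) kernel) smc" where
  "TsKer = \<lparr>
     Obj = measurable_spaces,
     Hom = (\<lambda>X Y. {Kernel X Y \<kappa> | \<kappa>. X \<in> measurable_spaces \<and> Y \<in> measurable_spaces \<and>
                     \<kappa> \<in> extensional (space X) \<and> s_finite_kernel X Y \<kappa>}),
     Idn = (\<lambda>X. dirac_kernel X X (\<lambda>x. x)),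
     Comp = kernel_comp,
     TenO = prod_space,
     TenA = kernel_prod,
     Unit = one_space,
     Assoc = (\<lambda>X Y Z. dirac_kernel (prod_space (prod_space X Y) Z) (prod_space X (prod_space Y Z))
        (\<lambda>z. Pr (pfst (pfst z)) (Pr (psnd (pfst z)) (psnd z)))),
     Lunit = (\<lambda>X. dirac_kernel (prod_space one_space X) X psnd),
     Runit = (\<lambda>X. dirac_kernel (prod_space X one_space) X pfst),
     Symm = (\<lambda>X Y. dirac_kernel (prod_space X Y) (prod_space Y X) (\<lambda>z. Pr (psnd z) (pfst z))) \<rparr>"


section \<open>The exponential comonad\<close>

definition exp_space :: "'u univ measure \<Rightarrow> 'u univ measure" where
  "exp_space X = sigma {Ms M | M. set_mset M \<subseteq> space X}
     {{Ms (mset xs) | xs. list_all2 (\<in>) xs As} | As. set As \<subseteq> sets X}"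

text \<open>The value does not depend on the ordering \<open>xs\<close> of the multiset.\<close>

definition exp_kernel :: "('u univ, 'u univ) kernel \<Rightarrow> ('u univ, 'u univ) kernel" where
  "exp_kernel \<kappa> = Kernel (exp_space (src \<kappa>)) (exp_space (tgt \<kappa>))
     (\<lambda>x\<in>space (exp_space (src \<kappa>)).
        distr (kernel_pow (tgt \<kappa>) (app \<kappa>) (SOME xs. mset xs = bag x)) (exp_space (tgt \<kappa>)) (\<lambda>ys. Ms (mset ys)))"

text \<open>
  The structure maps are given as kernels; as arrows of the opposite category they go from the
  target of the kernel to its source.
\<close>

definition dereliction :: "'u univ measure \<Rightarrow> ('u univ, 'u univ) kernel" where
  "dereliction X = dirac_kernel X (exp_space X) (\<lambda>x. Ms {#x#})"

definition storage :: "'u univ measure \<Rightarrow> ('u univ, 'u univ) kernel" where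
  "storage X = dirac_kernel (exp_space (exp_space X)) (exp_space X)
     (\<lambda>y. Ms (sum_mset (image_mset bag (bag y))))"

definition monoidal_map :: "'u univ measure \<Rightarrow> 'u univ measure \<Rightarrow> ('u univ, 'u univ) kernel" where
  "monoidal_map X Y = dirac_kernel (exp_space (prod_space X Y)) (prod_space (exp_space X) (exp_space Y))
     (\<lambda>z. Pr (Ms (image_mset pfst (bag z))) (Ms (image_mset psnd (bag z))))"

text \<open>
  The map \<open>m\<^sub>I\<close> gives \<open>{*}\<close> mass 1 at \<open>*\<^sup>n\<close> for every \<open>n\<close>, including \<open>n = 0\<close>. This corrects the formula
  \<open>min(n, 1)\<close> of the source, which agrees with it for \<open>n \<ge> 1\<close> but is 0 at the empty multiset, where the
  unit laws of a monoidal functor and the equation \<open>w\<^sub>I \<circ> m\<^sub>I = id\<close> force the value 1.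
\<close>

definition monoidal_unit_map :: "('u univ, 'u univ) kernel" where
  "monoidal_unit_map = dirac_kernel (exp_space one_space) one_space (\<lambda>z. Star)"

definition weakening :: "'u univ measure \<Rightarrow> ('u univ, 'u univ) kernel" where
  "weakening X = dirac_kernel one_space (exp_space X) (\<lambda>x. Ms {#})"

definition contraction :: "'u univ measure \<Rightarrow> ('u univ, 'u univ) kernel" where
  "contraction X = dirac_kernel (prod_space (exp_space X) (exp_space X)) (exp_space X)
     (\<lambda>z. Ms (bag (pfst z) + bag (psnd z)))"

definition exp_functor :: "('u univ measure, ('u univ, 'u univ) kernel) mon_functor" where
  "exp_functor = \<lparr> FO = exp_space, FA = exp_kernel, FM = monoidal_map, FI = monoidal_unit_map \<rparr>"

end

theory Submission
  imports Defs
begin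

text \<open>
  A kernel is s-finite iff it is the increasing limit of finite kernels. Monotone convergence along
  such limits gives Fubini's theorem for s-finite measures and the closure of s-finite kernels under
  composition, products and exponentials. On the exponential space everything is reduced to
  sequences: measurability because the \<open>\<sigma>\<close>-field is generated by the counting functions and is also
  the quotient of the one on sequences, and integrals because \<open>\<integral> f d\<kappa>\<^sub>e(x\<^sub>1 \<dots> x\<^sub>m)\<close> is an iterated
  integral of \<open>f\<close> along the list \<open>x\<^sub>1, \<dots>, x\<^sub>m\<close>, whose order is irrelevant by Fubini. Naturality of
  the structure maps is then proved by induction on lists. All remaining axioms equate Dirac kernels
  of point maps, so that they are identities between maps of multisets.
\<close>

section \<open>Mixtures of measures\<close>

text \<open>The obstacle is that s-finite kernels may take infinite values and need not be
  sigma-finite. Two such measures can agree on a generating family closed under intersection and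
  still differ, so equality of kernels cannot be checked on rectangles or on the generators of the
  exponential space. Equations between kernels are therefore tested against all nonnegative
  measurable functions (\<open>hom_eqI\<close>): composition and tensor turn into iterated
  integrals, and functoriality and naturality into rearrangements of them. Increasing limits are
  preferred to series because all factors of a construction can be approximated with the same index
  n; the sigma-finite Fubini theorem is then applied to finite measures only. Passing to the
  opposite category reverses composites and replaces the structure isomorphisms by their inverses,
  after which the comonad laws are those of the finite multiset monad and of the free commutative
  monoid.\<close>

abbreviation mixture :: "'a measure \<Rightarrow> 'b measure \<Rightarrow> ('a \<Rightarrow> 'b measure) \<Rightarrow> 'b measure" where
  "mixture M N k \<equiv> measure_of (space N) (sets N) (\<lambda>B. \<integral>\<^sup>+ x. emeasure (k x) B \<partial>M)"

text \<open>\<open>measure_of\<close> yields the null measure for a set function that is not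
  countably additive, so additivity has to come first; it is the exchange of a series with the
  integral. A mixture is the value of \<open>kernel_comp\<close> at a point, and over a
  \<open>count_space\<close> it is a sum of measures.\<close>

lemma emeasure_mixture:
  assumes k: "\<And>x. x \<in> space M \<Longrightarrow> sets (k x) = sets N"
    and meas: "\<And>B. B \<in> sets N \<Longrightarrow> (\<lambda>x. emeasure (k x) B) \<in> borel_measurable M"
    and B: "B \<in> sets N"
  shows "emeasure (mixture M N k) B = (\<integral>\<^sup>+ x. emeasure (k x) B \<partial>M)"
proof (rule emeasure_measure_of_sigma)
  show "sigma_algebra (space N) (sets N)" ..
  show "positive (sets N) (\<lambda>B. \<integral>\<^sup>+ x. emeasure (k x) B \<partial>M)"
    by (simp add: positive_def)
  show "countably_additive (sets N) (\<lambda>B. \<integral>\<^sup>+ x. emeasure (k x) B \<partial>M)"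
  proof (rule countably_additiveI)
    fix A :: "nat \<Rightarrow> _"
    assume A: "range A \<subseteq> sets N" "disjoint_family A"
    have "(\<Sum>i. \<integral>\<^sup>+ x. emeasure (k x) (A i) \<partial>M) = (\<integral>\<^sup>+ x. (\<Sum>i. emeasure (k x) (A i)) \<partial>M)"
      using A meas by (intro nn_integral_suminf[symmetric]) auto
    also have "\<dots> = (\<integral>\<^sup>+ x. emeasure (k x) (\<Union>i. A i) \<partial>M)"
      using A k by (intro nn_integral_cong suminf_emeasure) auto
    finally show "(\<Sum>i. \<integral>\<^sup>+ x. emeasure (k x) (A i) \<partial>M) = (\<integral>\<^sup>+ x. emeasure (k x) (\<Union>i. A i) \<partial>M)" .
  qed
qed fact

text \<open>Induction over measurable functions. As f does not depend on x, this covers arbitrary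
  kernels; integrands that also depend on x are treated by
  \<open>finite_kernel_measurable_nn_integral\<close>.\<close>

lemma mixture_measurable_nn_integral:
  assumes k: "\<And>x. x \<in> space M \<Longrightarrow> sets (k x) = sets N"
    and meas: "\<And>B. B \<in> sets N \<Longrightarrow> (\<lambda>x. emeasure (k x) B) \<in> borel_measurable M"
    and f: "f \<in> borel_measurable N"
  shows "(\<lambda>x. \<integral>\<^sup>+ y. f y \<partial>k x) \<in> borel_measurable M"
  using f
proof induction
  case (cong f g)
  have "(\<integral>\<^sup>+ y. f y \<partial>k x) = (\<integral>\<^sup>+ y. g y \<partial>k x)" if "x \<in> space M" for x
    using cong(3) sets_eq_imp_space_eq[OF k[OF that]] by (intro nn_integral_cong) auto
  then show ?case using cong(4) by (simp cong: measurable_cong)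
next
  case (set A)
  then show ?case using meas k by (simp cong: measurable_cong)
next
  case (mult u c)
  then have "u \<in> borel_measurable (k x)" if "x \<in> space M" for x
    using k[OF that] by (simp cong: measurable_cong_sets)
  then show ?case using mult by (simp add: nn_integral_cmult cong: measurable_cong)
next
  case (add u v)
  then have "u \<in> borel_measurable (k x)" "v \<in> borel_measurable (k x)" if "x \<in> space M" for x
    using k[OF that] by (simp_all cong: measurable_cong_sets)
  then show ?case using add by (simp add: nn_integral_add cong: measurable_cong)
next
  case (seq U)
  then have "U i \<in> borel_measurable (k x)" if "x \<in> space M" for x i
    using k[OF that] by (simp cong: measurable_cong_sets)
  then show ?case using seq
    by (simp add: nn_integral_monotone_convergence_SUP image_comp cong: measurable_cong)
qed

lemma nn_integral_mixture:
  assumes k: "\<And>x. x \<in> space M \<Longrightarrow> sets (k x) = sets N"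
    and meas: "\<And>B. B \<in> sets N \<Longrightarrow> (\<lambda>x. emeasure (k x) B) \<in> borel_measurable M"
    and f: "f \<in> borel_measurable N"
  shows "(\<integral>\<^sup>+ y. f y \<partial>mixture M N k)
    = (\<integral>\<^sup>+ x. \<integral>\<^sup>+ y. f y \<partial>k x \<partial>M)" (is "integral\<^sup>N ?N _ = _")
  using f
proof induction
  case (cong f g)
  have "(\<integral>\<^sup>+ y. f y \<partial>k x) = (\<integral>\<^sup>+ y. g y \<partial>k x)" if "x \<in> space M" for x
    using cong(3) sets_eq_imp_space_eq[OF k[OF that]] by (intro nn_integral_cong) auto
  moreover have "integral\<^sup>N ?N f = integral\<^sup>N ?N g"
    using cong(3) by (intro nn_integral_cong) auto
  ultimately show ?case using cong(4) by (simp cong: nn_integral_cong)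
next
  case (set A)
  then show ?case using k by (simp add: emeasure_mixture[OF k meas] cong: nn_integral_cong)
next
  case (mult u c)
  have "u \<in> borel_measurable (k x)" if "x \<in> space M" for x
    using mult k[OF that] by (simp cong: measurable_cong_sets)
  moreover have "u \<in> borel_measurable ?N"
    using mult by (simp cong: measurable_cong_sets)
  moreover note mixture_measurable_nn_integral[OF k meas \<open>u \<in> borel_measurable N\<close>]
  ultimately show ?case using mult by (simp add: nn_integral_cmult cong: nn_integral_cong)
next
  case (add u v)
  have "u \<in> borel_measurable (k x)" "v \<in> borel_measurable (k x)" if "x \<in> space M" for x
    using add k[OF that] by (simp_all cong: measurable_cong_sets)
  moreover have "u \<in> borel_measurable ?N" "v \<in> borel_measurable ?N"
    using add by (simp_all cong: measurable_cong_sets)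
  moreover note mixture_measurable_nn_integral[OF k meas \<open>u \<in> borel_measurable N\<close>]
    mixture_measurable_nn_integral[OF k meas \<open>v \<in> borel_measurable N\<close>]
  ultimately show ?case using add by (simp add: nn_integral_add cong: nn_integral_cong)
next
  case (seq U)
  have U: "U i \<in> borel_measurable (k x)" if "x \<in> space M" for x i
    using seq(1) k[OF that] by (simp cong: measurable_cong_sets)
  have UN: "U i \<in> borel_measurable ?N" for i
    using seq(1) by (simp cong: measurable_cong_sets)
  have mono: "incseq (\<lambda>i x. \<integral>\<^sup>+ y. U i y \<partial>k x)"
    using \<open>incseq U\<close> by (auto simp: incseq_def le_fun_def intro!: nn_integral_mono)
  have "integral\<^sup>N ?N (SUP i. U i) = (SUP i. integral\<^sup>N ?N (U i))"
    using nn_integral_monotone_convergence_SUP[OF \<open>incseq U\<close> UN] by (simp add: SUP_apply[abs_def])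
  also have "\<dots> = (\<integral>\<^sup>+ x. (SUP i. \<integral>\<^sup>+ y. U i y \<partial>k x) \<partial>M)"
    using seq by (simp add: nn_integral_monotone_convergence_SUP[OF mono] mixture_measurable_nn_integral[OF k meas])
  also have "\<dots> = (\<integral>\<^sup>+ x. \<integral>\<^sup>+ y. (SUP i. U i) y \<partial>k x \<partial>M)"
    using nn_integral_monotone_convergence_SUP[OF \<open>incseq U\<close> U]
    by (intro nn_integral_cong) (simp add: image_comp)
  finally show ?case .
qed

section \<open>Approximation by finite measures\<close>

definition approximates :: "(nat \<Rightarrow> 'a measure) \<Rightarrow> 'a measure \<Rightarrow> bool" where
  "approximates \<mu> M \<longleftrightarrow> (\<forall>n. sets (\<mu> n) = sets M) \<and>
     (\<forall>A\<in>sets M. incseq (\<lambda>n. emeasure (\<mu> n) A) \<and> (SUP n. emeasure (\<mu> n) A) = emeasure M A)"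

text \<open>The increasing form of a countable sum of finite measures: partial sums lead one way and
  successive differences the other.\<close>

definition s_finite_measure :: "'a measure \<Rightarrow> bool" where
  "s_finite_measure M \<longleftrightarrow> (\<exists>\<mu>. (\<forall>n. finite_measure (\<mu> n)) \<and> approximates \<mu> M)"

lemma approximatesD:
  assumes "approximates \<mu> M"
  shows "sets (\<mu> n) = sets M" "space (\<mu> n) = space M"
    and "A \<in> sets M \<Longrightarrow> incseq (\<lambda>n. emeasure (\<mu> n) A)"
    and "A \<in> sets M \<Longrightarrow> (SUP n. emeasure (\<mu> n) A) = emeasure M A"
proof -
  show *: "sets (\<mu> n) = sets M" using assms by (simp add: approximates_def)
  show "space (\<mu> n) = space M" by (rule sets_eq_imp_space_eq[OF *])
  show "A \<in> sets M \<Longrightarrow> incseq (\<lambda>n. emeasure (\<mu> n) A)"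
    and "A \<in> sets M \<Longrightarrow> (SUP n. emeasure (\<mu> n) A) = emeasure M A"
    using assms by (simp_all only: approximates_def)
qed

lemma approximates_measurable:
  "approximates \<mu> M \<Longrightarrow> f \<in> measurable M N \<Longrightarrow> f \<in> measurable (\<mu> n) N"
  by (simp add: approximatesD(1) cong: measurable_cong_sets)

lemma approximates_mono:
  assumes "approximates \<mu> M" "m \<le> n"
  shows "\<mu> m \<le> \<mu> n"
proof -
  have "sets (\<mu> m) = sets (\<mu> n)" using approximatesD(1)[OF assms(1)] by simp
  moreover have "emeasure (\<mu> m) A \<le> emeasure (\<mu> n) A" for A
    using approximatesD(1,3)[OF assms(1)] assms(2) by (cases "A \<in> sets M") (auto dest: incseqD simp: emeasure_notin_sets)
  ultimately show ?thesis
    using approximatesD(2)[OF assms(1)] by (simp add: le_measure_iff le_fun_def)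
qed

lemma approximates_nn_integral_incseq:
  assumes "approximates \<mu> M" "incseq f"
  shows "incseq (\<lambda>n. integral\<^sup>N (\<mu> n) (f n))"
proof (rule incseq_SucI)
  fix n
  have "integral\<^sup>N (\<mu> n) (f n) \<le> integral\<^sup>N (\<mu> n) (f (Suc n))"
    using incseq_SucD[OF assms(2)] by (intro nn_integral_mono) (simp add: le_fun_def)
  also have "\<dots> \<le> integral\<^sup>N (\<mu> (Suc n)) (f (Suc n))"
    using approximates_mono[OF assms(1), of n "Suc n"] approximatesD(1)[OF assms(1)]
    by (intro nn_integral_mono_measure) auto
  finally show "integral\<^sup>N (\<mu> n) (f n) \<le> integral\<^sup>N (\<mu> (Suc n)) (f (Suc n))" .
qed

lemma approximates_nn_integral_const:
  assumes appr: "approximates \<mu> M" and f: "f \<in> borel_measurable M"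
  shows "(SUP n. integral\<^sup>N (\<mu> n) f) = integral\<^sup>N M f"
  using f
proof induction
  case (cong f g)
  have "integral\<^sup>N (\<mu> n) f = integral\<^sup>N (\<mu> n) g" for n
    using cong(3) approximatesD[OF appr] by (intro nn_integral_cong) auto
  moreover have "integral\<^sup>N M f = integral\<^sup>N M g"
    using cong(3) by (intro nn_integral_cong) auto
  ultimately show ?case using cong(4) by simp
next
  case (set A)
  then show ?case using approximatesD[OF appr] by simp
next
  case (mult u c)
  then show ?case
    by (simp add: nn_integral_cmult approximates_measurable[OF appr] flip: SUP_mult_left_ennreal)
next
  case (add u v)
  \<comment> \<open>The supremum of a sum splits because both integrals increase with n.\<close>
  have inc: "incseq (\<lambda>n. integral\<^sup>N (\<mu> n) h)" for h
    by (rule approximates_nn_integral_incseq[OF appr]) simp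
  show ?case using add
    by (simp add: nn_integral_add approximates_measurable[OF appr] ennreal_SUP_add[OF inc inc])
next
  case (seq U)
  have *: "integral\<^sup>N N (SUP i. U i) = (SUP i. integral\<^sup>N N (U i))" if "sets N = sets M" for N
    using nn_integral_monotone_convergence_SUP[OF \<open>incseq U\<close>, of N] seq(1) that
    by (simp add: SUP_apply[abs_def] cong: measurable_cong_sets)
  have "(SUP n. SUP i. integral\<^sup>N (\<mu> n) (U i)) = (SUP i. SUP n. integral\<^sup>N (\<mu> n) (U i))"
    by (rule SUP_commute)
  moreover have "(SUP n. integral\<^sup>N (\<mu> n) (U i)) = integral\<^sup>N M (U i)" for i by (rule seq.IH)
  ultimately show ?case unfolding *[OF approximatesD(1)[OF appr]] *[OF refl] by simp
qed

text \<open>Monotone convergence with measure and integrand moving together. Everything is monotone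
  in both indices, so the diagonal has the same supremum as the double family.\<close>

lemma approximates_nn_integral:
  assumes appr: "approximates \<mu> M" and f: "incseq f" "\<And>n. f n \<in> borel_measurable M"
  shows "(SUP n. integral\<^sup>N (\<mu> n) (f n)) = (\<integral>\<^sup>+ x. (SUP n. f n x) \<partial>M)"
proof (rule antisym)
  have "(SUP n. integral\<^sup>N (\<mu> n) (f n)) \<le> (SUP n. integral\<^sup>N M (f n))"
  proof (intro SUP_mono bexI)
    fix n
    have "integral\<^sup>N (\<mu> n) (f n) \<le> (SUP m. integral\<^sup>N (\<mu> m) (f n))" by (rule SUP_upper) simp
    then show "integral\<^sup>N (\<mu> n) (f n) \<le> integral\<^sup>N M (f n)"
      by (simp add: approximates_nn_integral_const[OF appr f(2)])
  qed simp
  then show "(SUP n. integral\<^sup>N (\<mu> n) (f n)) \<le> (\<integral>\<^sup>+ x. (SUP n. f n x) \<partial>M)"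
    by (simp add: nn_integral_monotone_convergence_SUP[OF f])
next
  have "integral\<^sup>N (\<mu> m) (f n) \<le> (SUP k. integral\<^sup>N (\<mu> k) (f k))" for m n
  proof -
    \<comment> \<open>Any pair (m, n) is dominated by the diagonal pair at \<open>max m n\<close>;
      the measure is raised first, then the integrand.\<close>
    have "integral\<^sup>N (\<mu> m) (f n) \<le> integral\<^sup>N (\<mu> (max m n)) (f n)"
      using approximates_mono[OF appr, of m "max m n"] approximatesD(1)[OF appr]
      by (intro nn_integral_mono_measure) auto
    also have "\<dots> \<le> integral\<^sup>N (\<mu> (max m n)) (f (max m n))"
      using incseqD[OF f(1), of n "max m n"] by (intro nn_integral_mono) (simp add: le_fun_def)
    also have "\<dots> \<le> (SUP k. integral\<^sup>N (\<mu> k) (f k))" by (rule SUP_upper) simp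
    finally show ?thesis .
  qed
  then show "(\<integral>\<^sup>+ x. (SUP n. f n x) \<partial>M) \<le> (SUP n. integral\<^sup>N (\<mu> n) (f n))"
    by (simp add: nn_integral_monotone_convergence_SUP[OF f] SUP_least
        flip: approximates_nn_integral_const[OF appr f(2)])
qed

section \<open>S-finite kernels\<close>

lemma transition_kernelD:
  assumes "transition_kernel X Y \<kappa>"
  shows "x \<in> space X \<Longrightarrow> sets (\<kappa> x) = sets Y" "x \<in> space X \<Longrightarrow> space (\<kappa> x) = space Y"
    and "B \<in> sets Y \<Longrightarrow> (\<lambda>x. emeasure (\<kappa> x) B) \<in> borel_measurable X"
  using assms by (auto simp: transition_kernel_def dest: sets_eq_imp_space_eq)

lemma finite_kernelI:
  assumes "transition_kernel X Y \<kappa>" "\<And>x. x \<in> space X \<Longrightarrow> emeasure (\<kappa> x) (space Y) \<le> b" "b < top"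
  shows "finite_kernel X Y \<kappa>"
proof -
  have "(SUP x\<in>space X. emeasure (\<kappa> x) (space Y)) \<le> b" using assms(2) by (rule SUP_least)
  then show ?thesis using assms(1,3) by (simp add: finite_kernel_def le_less_trans)
qed

lemma finite_kernelD:
  assumes "finite_kernel X Y \<kappa>"
  shows "transition_kernel X Y \<kappa>"
    and "\<exists>b. 0 < b \<and> (\<forall>x\<in>space X. emeasure (\<kappa> x) (space Y) \<le> ennreal b)"
proof -
  show "transition_kernel X Y \<kappa>" using assms by (simp add: finite_kernel_def)
  define s where "s = (SUP x\<in>space X. emeasure (\<kappa> x) (space Y))"
  have s: "s < top" using assms by (simp add: finite_kernel_def s_def)
  \<comment> \<open>The summand 1 makes the bound positive, so that kernels can later be divided by
    it.\<close>
  have "emeasure (\<kappa> x) (space Y) \<le> ennreal (enn2real s + 1)" if "x \<in> space X" for x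
  proof -
    have "emeasure (\<kappa> x) (space Y) \<le> s" unfolding s_def by (rule SUP_upper[OF that])
    also have "s = ennreal (enn2real s)" using s by simp
    also have "\<dots> \<le> ennreal (enn2real s + 1)" by (rule ennreal_leI) simp
    finally show ?thesis .
  qed
  then show "\<exists>b. 0 < b \<and> (\<forall>x\<in>space X. emeasure (\<kappa> x) (space Y) \<le> ennreal b)"
    by (intro exI[of _ "enn2real s + 1"]) (auto simp: add_nonneg_pos)
qed

lemma finite_kernel_finite_measure:
  assumes "finite_kernel X Y \<kappa>" "x \<in> space X"
  shows "finite_measure (\<kappa> x)"
proof
  obtain b where "emeasure (\<kappa> x) (space Y) \<le> ennreal b"
    using finite_kernelD(2)[OF assms(1)] assms(2) by auto
  then show "emeasure (\<kappa> x) (space (\<kappa> x)) \<noteq> \<infinity>"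
    using transition_kernelD(2)[OF finite_kernelD(1)[OF assms(1)] assms(2)] by (auto simp: top_unique)
qed

text \<open>Division by the bound b gives a measurable map into \<open>subprob_algebra Y\<close>,
  where integrals of parametrised integrands are measurable. The map g lets the kernel depend on a
  part of the parameter z, as happens in nested integrals.\<close>

lemma finite_kernel_measurable_nn_integral:
  assumes \<kappa>: "finite_kernel X Y \<kappa>" and g[measurable]: "g \<in> Z \<rightarrow>\<^sub>M X"
    and f[measurable]: "(\<lambda>(z, y). f z y) \<in> borel_measurable (Z \<Otimes>\<^sub>M Y)"
  shows "(\<lambda>z. \<integral>\<^sup>+ y. f z y \<partial>\<kappa> (g z)) \<in> borel_measurable Z"
\<comment> \<open>A subprobability space has to be nonempty, so the empty target is
  separated.\<close>
proof (cases "space Y = {}")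
  case True
  then have "(\<integral>\<^sup>+ y. f z y \<partial>\<kappa> (g z)) = 0" if "z \<in> space Z" for z
    using transition_kernelD(2)[OF finite_kernelD(1)[OF \<kappa>] measurable_space[OF g that]]
    by (intro nn_integral_empty) simp
  then show ?thesis by (simp cong: measurable_cong)
next
  case False
  obtain b where b: "0 < b" "\<And>x. x \<in> space X \<Longrightarrow> emeasure (\<kappa> x) (space Y) \<le> ennreal b"
    using finite_kernelD(2)[OF \<kappa>] by auto
  note [measurable] = transition_kernelD(3)[OF finite_kernelD(1)[OF \<kappa>]]
  have sets: "sets (\<kappa> (g z)) = sets Y" "space (\<kappa> (g z)) = space Y" if "z \<in> space Z" for z
    using transition_kernelD(1,2)[OF finite_kernelD(1)[OF \<kappa>] measurable_space[OF g that]] by auto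
  have inv: "ennreal b * ennreal (1 / b) = 1" using b(1) by (simp add: ennreal_mult'[symmetric])
  define L where "L z = scale_measure (ennreal (1 / b)) (\<kappa> (g z))" for z
  have "L \<in> Z \<rightarrow>\<^sub>M subprob_algebra Y"
  proof (rule measurable_subprob_algebra)
    fix z assume z: "z \<in> space Z"
    have "emeasure (\<kappa> (g z)) (space Y) \<le> ennreal b" using b(2) measurable_space[OF g z] by simp
    then have "ennreal (1 / b) * emeasure (\<kappa> (g z)) (space Y) \<le> ennreal (1 / b) * ennreal b"
      by (intro mult_left_mono) auto
    then show "subprob_space (L z)"
      using False sets[OF z] inv by (intro subprob_spaceI) (auto simp: L_def mult.commute space_scale_measure)
    show "sets (L z) = sets Y" using sets[OF z] by (simp add: L_def)
  next
    fix A assume "A \<in> sets Y"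
    then show "(\<lambda>z. emeasure (L z) A) \<in> borel_measurable Z"
      unfolding L_def emeasure_scale_measure by measurable
  qed
  from nn_integral_measurable_subprob_algebra2[OF f this]
  have "(\<lambda>z. ennreal b * \<integral>\<^sup>+ y. f z y \<partial>L z) \<in> borel_measurable Z" by measurable
  moreover have "ennreal b * (\<integral>\<^sup>+ y. f z y \<partial>L z) = (\<integral>\<^sup>+ y. f z y \<partial>\<kappa> (g z))" if z: "z \<in> space Z" for z
  proof -
    have "f z \<in> borel_measurable (\<kappa> (g z))"
      using measurable_Pair2[OF f z] sets[OF z] by (simp cong: measurable_cong_sets)
    then show ?thesis
      using inv by (simp add: L_def nn_integral_scale_measure flip: mult.assoc)
  qed
  ultimately show ?thesis by (simp cong: measurable_cong)
qed

text \<open>The way back from increasing limits to series: the summands are the increments of the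
  approximating kernels, which are measures since finite measures can be subtracted.\<close>

lemma s_finite_kernelI:
  assumes sets: "\<And>x. x \<in> space X \<Longrightarrow> sets (\<kappa> x) = sets Y"
    and fin: "\<And>n. finite_kernel X Y (\<kappa>' n)"
    and appr: "\<And>x. x \<in> space X \<Longrightarrow> approximates (\<lambda>n. \<kappa>' n x) (\<kappa> x)"
  shows "s_finite_kernel X Y \<kappa>"
proof -
  note tr = finite_kernelD(1)[OF fin]
  have trans: "transition_kernel X Y \<kappa>"
  proof -
    have "(\<lambda>x. SUP n. emeasure (\<kappa>' n x) B) \<in> borel_measurable X" if "B \<in> sets Y" for B
      using transition_kernelD(3)[OF tr that] by measurable
    moreover have "(SUP n. emeasure (\<kappa>' n x) B) = emeasure (\<kappa> x) B" if "B \<in> sets Y" "x \<in> space X" for B x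
      using approximatesD(4)[OF appr] that sets by blast
    ultimately show ?thesis unfolding transition_kernel_def
      using sets by (simp cong: measurable_cong)
  qed
  \<comment> \<open>The increments of the approximation, with the first approximant itself at index
    0.\<close>
  define p where "p n x = (case n of 0 \<Rightarrow> \<kappa>' 0 x | Suc m \<Rightarrow> diff_measure (\<kappa>' (Suc m) x) (\<kappa>' m x))" for n x
  have inc: "emeasure (\<kappa>' m x) B \<le> emeasure (\<kappa>' (Suc m) x) B"
    if "B \<in> sets Y" "x \<in> space X" for B x m
    using incseq_SucD[OF approximatesD(3)[OF appr]] that sets by blast
  have p_Suc: "emeasure (p (Suc m) x) B = emeasure (\<kappa>' (Suc m) x) B - emeasure (\<kappa>' m x) B"
    if "B \<in> sets Y" "x \<in> space X" for B x m
    unfolding p_def nat.case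
    using that transition_kernelD(1)[OF tr] finite_kernel_finite_measure[OF fin] inc
    by (intro emeasure_diff_measure) auto
  have p_sets: "sets (p n x) = sets Y" if "x \<in> space X" for n x
    using that transition_kernelD(1)[OF tr] by (cases n) (simp_all add: p_def)
  have p_le: "emeasure (p n x) B \<le> emeasure (\<kappa>' n x) B" if "B \<in> sets Y" "x \<in> space X" for n x B
  proof (cases n)
    case (Suc m)
    then show ?thesis using p_Suc[OF that] by (simp add: diff_le_self_ennreal)
  qed (simp add: p_def)
  have "finite_kernel X Y (p n)" for n
  proof -
    obtain b where "\<forall>x\<in>space X. emeasure (\<kappa>' n x) (space Y) \<le> ennreal b"
      using finite_kernelD(2)[OF fin[of n]] by auto
    moreover have "transition_kernel X Y (p n)"
    proof -
      have "(\<lambda>x. emeasure (p n x) B) \<in> borel_measurable X" if "B \<in> sets Y" for B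
      proof (cases n)
        case 0
        then show ?thesis using transition_kernelD(3)[OF tr that] by (simp add: p_def)
      next
        case (Suc m)
        have "(\<lambda>x. emeasure (\<kappa>' (Suc m) x) B - emeasure (\<kappa>' m x) B) \<in> borel_measurable X"
          by (intro borel_measurable_minus_ennreal transition_kernelD(3)[OF tr that])
        then show ?thesis unfolding Suc using p_Suc[OF that] by (simp cong: measurable_cong)
      qed
      then show ?thesis using p_sets by (simp add: transition_kernel_def)
    qed
    ultimately show ?thesis
      using order_trans[OF p_le[OF sets.top]] by (intro finite_kernelI[of _ _ _ "ennreal b"]) auto
  qed
  moreover have "emeasure (\<kappa> x) B = (\<Sum>n. emeasure (p n x) B)" if "x \<in> space X" "B \<in> sets Y" for x B
  proof -
    have "(\<Sum>i<Suc n. emeasure (p i x) B) = emeasure (\<kappa>' n x) B" for n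
    proof (induction n)
      case 0
      then show ?case by (simp add: p_def)
    next
      case (Suc n)
      have "(\<Sum>i<Suc (Suc n). emeasure (p i x) B)
          = emeasure (\<kappa>' n x) B + (emeasure (\<kappa>' (Suc n) x) B - emeasure (\<kappa>' n x) B)"
        using Suc p_Suc[OF that(2,1), of n] by (simp only: sum.lessThan_Suc)
      also have "\<dots> = emeasure (\<kappa>' (Suc n) x) B"
        using inc[OF that(2,1)] by (rule add_diff_inverse_ennreal)
      finally show ?case .
    qed
    moreover have "(\<lambda>n. emeasure (\<kappa>' n x) B) \<longlonglongrightarrow> emeasure (\<kappa> x) B"
      using approximatesD(3,4)[OF appr[OF that(1)], of B] that sets by (metis LIMSEQ_SUP)
    \<comment> \<open>The first n + 1 increments add up to \<open>\<kappa>' n\<close>, so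
      convergence of the partial sums is obtained after shifting the index by one.\<close>
    ultimately have "(\<lambda>n. emeasure (p n x) B) sums emeasure (\<kappa> x) B"
      by (simp add: sums_def flip: filterlim_sequentially_Suc[of "\<lambda>n. \<Sum>i<n. emeasure (p i x) B"])
    then show ?thesis by (rule sums_unique)
  qed
  ultimately show ?thesis unfolding s_finite_kernel_def
    using trans by (intro conjI exI[of _ p]) simp_all
qed

text \<open>Kernels are controlled only at points of the space, whereas
  \<open>approximates_nn_integral\<close> asks for a sequence increasing everywhere. Multiplying by
  the indicator of the space bridges the two without changing any integral.\<close>

lemma approximates_nn_integral_on:
  assumes appr: "approximates \<mu> M" and f: "\<And>n. f n \<in> borel_measurable M"
    and inc: "\<And>x. x \<in> space M \<Longrightarrow> incseq (\<lambda>n. f n x)"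
    and sup: "\<And>x. x \<in> space M \<Longrightarrow> (SUP n. f n x) = g x"
  shows "incseq (\<lambda>n. integral\<^sup>N (\<mu> n) (f n))" "(SUP n. integral\<^sup>N (\<mu> n) (f n)) = integral\<^sup>N M g"
proof -
  define f' where "f' n x = f n x * indicator (space M) x" for n x
  have f': "f' n \<in> borel_measurable M" for n unfolding f'_def using f by measurable
  have inc': "incseq f'"
    using inc by (auto simp: f'_def incseq_def le_fun_def indicator_def)
  have eq: "integral\<^sup>N (\<mu> n) (f n) = integral\<^sup>N (\<mu> n) (f' n)" for n
    using approximatesD(2)[OF appr] by (intro nn_integral_cong) (simp add: f'_def)
  show "incseq (\<lambda>n. integral\<^sup>N (\<mu> n) (f n))"
    unfolding eq by (rule approximates_nn_integral_incseq[OF appr inc'])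
  show "(SUP n. integral\<^sup>N (\<mu> n) (f n)) = integral\<^sup>N M g"
    unfolding eq approximates_nn_integral[OF appr inc' f']
    using sup by (intro nn_integral_cong) (simp add: f'_def)
qed

lemma s_finite_kernelD:
  assumes "s_finite_kernel X Y \<kappa>"
  shows "transition_kernel X Y \<kappa>" "x \<in> space X \<Longrightarrow> sets (\<kappa> x) = sets Y"
    "x \<in> space X \<Longrightarrow> space (\<kappa> x) = space Y"
proof -
  show *: "transition_kernel X Y \<kappa>" using assms unfolding s_finite_kernel_def ..
  show "x \<in> space X \<Longrightarrow> sets (\<kappa> x) = sets Y" "x \<in> space X \<Longrightarrow> space (\<kappa> x) = space Y"
    using transition_kernelD[OF *] by auto
qed

lemma s_finite_kernel_approx:
  assumes "s_finite_kernel X Y \<kappa>"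
  obtains \<kappa>' where "\<And>n. finite_kernel X Y (\<kappa>' n)"
    and "\<And>x. x \<in> space X \<Longrightarrow> approximates (\<lambda>n. \<kappa>' n x) (\<kappa> x)"
proof -
  obtain p where p: "\<And>i::nat. finite_kernel X Y (p i)"
    and sum: "\<And>x B. x \<in> space X \<Longrightarrow> B \<in> sets Y \<Longrightarrow> emeasure (\<kappa> x) B = (\<Sum>i. emeasure (p i x) B)"
    using assms unfolding s_finite_kernel_def by metis
  note tr = finite_kernelD(1)[OF p]
  \<comment> \<open>The n-th partial sum, obtained as a measure by mixing over the finite counting
    space.\<close>
  define q where "q n x = mixture (count_space {..<n}) Y (\<lambda>i. p i x)" for n x
  have q: "emeasure (q n x) B = (\<Sum>i<n. emeasure (p i x) B)" if "x \<in> space X" "B \<in> sets Y" for n x B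
    unfolding q_def using transition_kernelD(1)[OF tr that(1)] that(2)
    by (subst emeasure_mixture) (auto simp: nn_integral_count_space_finite)
  have sets_q: "sets (q n x) = sets Y" for n x by (simp add: q_def)
  have "finite_kernel X Y (q n)" for n
  proof -
    obtain b where b: "\<And>i x. x \<in> space X \<Longrightarrow> emeasure (p i x) (space Y) \<le> ennreal (b i)"
      using finite_kernelD(2)[OF p] by metis
    have "(\<lambda>x. emeasure (q n x) B) \<in> borel_measurable X" if B: "B \<in> sets Y" for B
    proof -
      have "(\<lambda>x. \<Sum>i<n. emeasure (p i x) B) \<in> borel_measurable X"
        using transition_kernelD(3)[OF tr B] by measurable
      then show ?thesis using q[OF _ B] by (simp cong: measurable_cong)
    qed
    then have "transition_kernel X Y (q n)" using sets_q by (simp add: transition_kernel_def)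
    moreover have "emeasure (q n x) (space Y) \<le> (\<Sum>i<n. ennreal (b i))" if "x \<in> space X" for x
      using b[OF that] by (simp add: q[OF that sets.top] sum_mono)
    ultimately show ?thesis by (rule finite_kernelI) simp_all
  qed
  moreover have "approximates (\<lambda>n. q n x) (\<kappa> x)" if x: "x \<in> space X" for x
    unfolding approximates_def
  proof (intro conjI allI ballI)
    show "sets (q n x) = sets (\<kappa> x)" for n
      using s_finite_kernelD(2)[OF assms x] sets_q by simp
  next
    fix B assume "B \<in> sets (\<kappa> x)"
    then have B: "B \<in> sets Y" using s_finite_kernelD(2)[OF assms x] by simp
    show "incseq (\<lambda>n. emeasure (q n x) B)"
      unfolding q[OF x B] by (auto simp: incseq_def intro!: sum_mono2)
    show "(SUP n. emeasure (q n x) B) = emeasure (\<kappa> x) B"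
      unfolding q[OF x B] sum[OF x B] by (rule suminf_eq_SUP[symmetric])
  qed
  ultimately show thesis by (rule that)
qed

lemma s_finite_kernel_s_finite_measure:
  assumes "s_finite_kernel X Y \<kappa>" "x \<in> space X"
  shows "s_finite_measure (\<kappa> x)"
  using s_finite_kernel_approx[OF assms(1)] finite_kernel_finite_measure assms(2)
  unfolding s_finite_measure_def by metis

text \<open>Turns a single measure into a kernel, so that measurability of parametrised integrals
  becomes available for s-finite measures.\<close>

lemma s_finite_kernel_const:
  assumes "s_finite_measure M" "sets M = sets Y"
  shows "s_finite_kernel X Y (\<lambda>_. M)"
proof -
  obtain \<mu> where fin: "\<And>n. finite_measure (\<mu> n)" and appr: "approximates \<mu> M"
    using assms(1) by (auto simp: s_finite_measure_def)
  have "sets (\<mu> n) = sets Y" for n using approximatesD(1)[OF appr] assms(2) by simp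
  then have "finite_kernel X Y (\<lambda>_. \<mu> n)" for n
    using finite_measure.emeasure_finite[OF fin]
    by (intro finite_kernelI[of _ _ _ "emeasure (\<mu> n) (space Y)"])
      (auto simp: transition_kernel_def less_top)
  then show ?thesis using assms(2) appr by (intro s_finite_kernelI) auto
qed

lemma s_finite_kernel_measurable_nn_integral:
  assumes \<kappa>: "s_finite_kernel X Y \<kappa>" and g: "g \<in> Z \<rightarrow>\<^sub>M X"
    and f: "(\<lambda>(z, y). f z y) \<in> borel_measurable (Z \<Otimes>\<^sub>M Y)"
  shows "(\<lambda>z. \<integral>\<^sup>+ y. f z y \<partial>\<kappa> (g z)) \<in> borel_measurable Z"
proof -
  obtain \<kappa>' where fin: "\<And>n. finite_kernel X Y (\<kappa>' n)"
    and appr: "\<And>x. x \<in> space X \<Longrightarrow> approximates (\<lambda>n. \<kappa>' n x) (\<kappa> x)"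
    using s_finite_kernel_approx[OF \<kappa>] by blast
  note [measurable] = finite_kernel_measurable_nn_integral[OF fin g f]
  have "(\<lambda>z. SUP n. \<integral>\<^sup>+ y. f z y \<partial>\<kappa>' n (g z)) \<in> borel_measurable Z" by measurable
  moreover have "(SUP n. \<integral>\<^sup>+ y. f z y \<partial>\<kappa>' n (g z)) = (\<integral>\<^sup>+ y. f z y \<partial>\<kappa> (g z))" if z: "z \<in> space Z" for z
    using measurable_Pair2[OF f z] s_finite_kernelD(2)[OF \<kappa> measurable_space[OF g z]]
    by (intro approximates_nn_integral_const appr measurable_space[OF g z]) (simp cong: measurable_cong_sets)
  ultimately show ?thesis by (simp cong: measurable_cong)
qed

lemma s_finite_measure_measurable_nn_integral:
  assumes "s_finite_measure M" "(\<lambda>(z, y). f z y) \<in> borel_measurable (Z \<Otimes>\<^sub>M M)"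
  shows "(\<lambda>z. \<integral>\<^sup>+ y. f z y \<partial>M) \<in> borel_measurable Z"
  using s_finite_kernel_measurable_nn_integral[OF s_finite_kernel_const[OF assms(1) refl, of Z] measurable_ident assms(2)]
  by simp

section \<open>Products of s-finite measures\<close>

text \<open>The product is \<open>measure_of\<close> the iterated integral with \<open>M2\<close>
  inside. S-finiteness of \<open>M2\<close> makes the inner integral measurable in x, hence the
  iterated integral countably additive.\<close>

lemma emeasure_pair_s_finite:
  assumes M2: "s_finite_measure M2" and C: "C \<in> sets (M1 \<Otimes>\<^sub>M M2)"
  shows "emeasure (M1 \<Otimes>\<^sub>M M2) C = (\<integral>\<^sup>+ x. \<integral>\<^sup>+ y. indicator C (x, y) \<partial>M2 \<partial>M1)" (is "_ = ?\<mu> C")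
proof (rule emeasure_measure_of[OF pair_measure_def])
  show "positive (sets (M1 \<Otimes>\<^sub>M M2)) ?\<mu>"
    by (auto simp: positive_def)
  show "countably_additive (sets (M1 \<Otimes>\<^sub>M M2)) ?\<mu>"
  proof (rule countably_additiveI)
    fix F :: "nat \<Rightarrow> _" assume F: "range F \<subseteq> sets (M1 \<Otimes>\<^sub>M M2)" "disjoint_family F"
    then have [measurable]: "F i \<in> sets (M1 \<Otimes>\<^sub>M M2)" for i by auto
    have [measurable]: "(\<lambda>x. \<integral>\<^sup>+ y. indicator (F i) (x, y) \<partial>M2) \<in> borel_measurable M1" for i
      by (intro s_finite_measure_measurable_nn_integral[OF M2]) (simp add: case_prod_unfold)
    have "(\<Sum>n. ?\<mu> (F n)) = (\<integral>\<^sup>+ x. (\<Sum>n. \<integral>\<^sup>+ y. indicator (F n) (x, y) \<partial>M2) \<partial>M1)"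
      by (intro nn_integral_suminf[symmetric]) measurable
    also have "\<dots> = (\<integral>\<^sup>+ x. \<integral>\<^sup>+ y. (\<Sum>n. indicator (F n) (x, y)) \<partial>M2 \<partial>M1)"
      by (intro nn_integral_cong nn_integral_suminf[symmetric]) measurable
    also have "\<dots> = ?\<mu> (\<Union>i. F i)"
      using F(2) by (simp add: suminf_indicator)
    finally show "(\<Sum>n. ?\<mu> (F n)) = ?\<mu> (\<Union>i. F i)" .
  qed
qed (use pair_measure_closed[of M1 M2] C in auto)

lemma nn_integral_pair_s_finite:
  assumes M2: "s_finite_measure M2" and f: "f \<in> borel_measurable (M1 \<Otimes>\<^sub>M M2)"
  shows "integral\<^sup>N (M1 \<Otimes>\<^sub>M M2) f = (\<integral>\<^sup>+ x. \<integral>\<^sup>+ y. f (x, y) \<partial>M2 \<partial>M1)"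
proof -
  \<comment> \<open>The product measure is the mixture over x of copies of \<open>M2\<close> placed
    on the slices at x; the integral formula is then that of mixtures.\<close>
  let ?k = "\<lambda>x. distr M2 (M1 \<Otimes>\<^sub>M M2) (Pair x)"
  have k: "emeasure (?k x) C = (\<integral>\<^sup>+ y. indicator C (x, y) \<partial>M2)"
    if "x \<in> space M1" "C \<in> sets (M1 \<Otimes>\<^sub>M M2)" for x C
    using that by (simp add: nn_integral_distr flip: nn_integral_indicator)
  have meas: "(\<lambda>x. emeasure (?k x) C) \<in> borel_measurable M1" if [measurable]: "C \<in> sets (M1 \<Otimes>\<^sub>M M2)" for C
  proof -
    have "(\<lambda>x. \<integral>\<^sup>+ y. indicator C (x, y) \<partial>M2) \<in> borel_measurable M1"
      by (intro s_finite_measure_measurable_nn_integral[OF M2]) (simp add: case_prod_unfold)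
    then show ?thesis using k[OF _ that] by (simp cong: measurable_cong)
  qed
  have "M1 \<Otimes>\<^sub>M M2 = mixture M1 (M1 \<Otimes>\<^sub>M M2) ?k"
    using k by (intro measure_eqI) (simp_all add: emeasure_mixture[OF sets_distr meas] emeasure_pair_s_finite[OF M2] cong: nn_integral_cong)
  then have "integral\<^sup>N (M1 \<Otimes>\<^sub>M M2) f = integral\<^sup>N (mixture M1 (M1 \<Otimes>\<^sub>M M2) ?k) f"
    by (rule arg_cong[where f="\<lambda>M. integral\<^sup>N M f"])
  also have "\<dots> = (\<integral>\<^sup>+ x. \<integral>\<^sup>+ y. f y \<partial>?k x \<partial>M1)"
    by (rule nn_integral_mixture[OF sets_distr meas f])
  also have "\<dots> = (\<integral>\<^sup>+ x. \<integral>\<^sup>+ y. f (x, y) \<partial>M2 \<partial>M1)"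
    using f by (intro nn_integral_cong) (simp add: nn_integral_distr)
  finally show ?thesis .
qed

text \<open>Both iterated integrals are suprema, along one index, of iterated integrals over finite
  measures, and for each index these agree by the sigma-finite Fubini theorem.\<close>

lemma Fubini_s_finite:
  assumes M1: "s_finite_measure M1" and M2: "s_finite_measure M2"
    and f: "(\<lambda>(x, y). f x y) \<in> borel_measurable (M1 \<Otimes>\<^sub>M M2)"
  shows "(\<integral>\<^sup>+ x. \<integral>\<^sup>+ y. f x y \<partial>M2 \<partial>M1) = (\<integral>\<^sup>+ y. \<integral>\<^sup>+ x. f x y \<partial>M1 \<partial>M2)"
proof -
  obtain \<mu>1 where fin1: "\<And>n. finite_measure (\<mu>1 n)" and appr1: "approximates \<mu>1 M1"
    using M1 by (auto simp: s_finite_measure_def)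
  obtain \<mu>2 where fin2: "\<And>n. finite_measure (\<mu>2 n)" and appr2: "approximates \<mu>2 M2"
    using M2 by (auto simp: s_finite_measure_def)
  have f': "(\<lambda>(y, x). f x y) \<in> borel_measurable (M2 \<Otimes>\<^sub>M M1)"
    using measurable_pair_swap[OF f] by (simp add: case_prod_unfold)
  \<comment> \<open>Stated for fresh measures and a fresh integrand because it is used for both
    orders of integration.\<close>
  have iter: "(SUP n. \<integral>\<^sup>+ x. \<integral>\<^sup>+ y. f x y \<partial>\<nu> n \<partial>\<mu> n) = (\<integral>\<^sup>+ x. \<integral>\<^sup>+ y. f x y \<partial>N \<partial>M)"
    if fin: "\<And>n. finite_measure (\<nu> n)" and appr: "approximates \<mu> M" "approximates \<nu> N"
      and f: "(\<lambda>(x, y). f x y) \<in> borel_measurable (M \<Otimes>\<^sub>M N)"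
    for \<mu> \<nu> and M :: "'c measure" and N :: "'d measure" and f
  proof (rule approximates_nn_integral_on(2)[OF appr(1)])
    fix n
    interpret finite_measure "\<nu> n" by (rule fin)
    show "(\<lambda>x. \<integral>\<^sup>+ y. f x y \<partial>\<nu> n) \<in> borel_measurable M"
      using f approximatesD(1)[OF appr(2)]
      by (intro borel_measurable_nn_integral) (simp cong: measurable_cong_sets sets_pair_measure_cong)
  next
    fix x assume x: "x \<in> space M"
    show "incseq (\<lambda>n. \<integral>\<^sup>+ y. f x y \<partial>\<nu> n)"
      by (rule approximates_nn_integral_incseq[OF appr(2)]) simp
    show "(SUP n. \<integral>\<^sup>+ y. f x y \<partial>\<nu> n) = (\<integral>\<^sup>+ y. f x y \<partial>N)"
      using measurable_Pair2[OF f x] by (intro approximates_nn_integral_const[OF appr(2)]) simp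
  qed
  have "(\<integral>\<^sup>+ x. \<integral>\<^sup>+ y. f x y \<partial>\<mu>2 n \<partial>\<mu>1 n) = (\<integral>\<^sup>+ y. \<integral>\<^sup>+ x. f x y \<partial>\<mu>1 n \<partial>\<mu>2 n)" for n
  proof -
    interpret finite_measure "\<mu>1 n" by (rule fin1)
    interpret f2: finite_measure "\<mu>2 n" by (rule fin2)
    interpret pair_sigma_finite "\<mu>1 n" "\<mu>2 n" ..
    show ?thesis
      using f approximatesD(1)[OF appr1] approximatesD(1)[OF appr2]
      by (intro Fubini'[symmetric]) (simp cong: measurable_cong_sets sets_pair_measure_cong)
  qed
  then show ?thesis
    using iter[OF fin2 appr1 appr2 f] iter[OF fin1 appr2 appr1 f'] by simp
qed

lemma s_finite_measure_finite: "finite_measure M \<Longrightarrow> s_finite_measure M"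
  unfolding s_finite_measure_def by (intro exI[of _ "\<lambda>n. M"]) (simp add: approximates_def)

text \<open>For an indicator, the inner integral increases to its limit at each y, and the outer one
  then has measure and integrand growing together. Finiteness of \<nu> gives each approximating
  product its iterated integral form.\<close>

lemma approximates_pair:
  assumes \<mu>: "approximates \<mu> M" and \<nu>: "approximates \<nu> N" and fin: "\<And>n. finite_measure (\<nu> n)"
  shows "approximates (\<lambda>n. \<mu> n \<Otimes>\<^sub>M \<nu> n) (M \<Otimes>\<^sub>M N)"
proof -
  note sets = sets_pair_measure_cong[OF approximatesD(1)[OF \<mu>] approximatesD(1)[OF \<nu>]]
  have N: "s_finite_measure N" using \<nu> fin by (auto simp: s_finite_measure_def)
  have em: "emeasure (\<mu> n \<Otimes>\<^sub>M \<nu> n) C = (\<integral>\<^sup>+ y. \<integral>\<^sup>+ z. indicator C (y, z) \<partial>\<nu> n \<partial>\<mu> n)"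
    if "C \<in> sets (M \<Otimes>\<^sub>M N)" for C n
    using that by (intro emeasure_pair_s_finite s_finite_measure_finite fin) (simp add: sets)
  have "incseq (\<lambda>n. \<integral>\<^sup>+ y. \<integral>\<^sup>+ z. indicator C (y, z) \<partial>\<nu> n \<partial>\<mu> n) \<and>
    (SUP n. \<integral>\<^sup>+ y. \<integral>\<^sup>+ z. indicator C (y, z) \<partial>\<nu> n \<partial>\<mu> n) = (\<integral>\<^sup>+ y. \<integral>\<^sup>+ z. indicator C (y, z) \<partial>N \<partial>M)"
    if C: "C \<in> sets (M \<Otimes>\<^sub>M N)" for C
  proof -
    have m: "(\<lambda>y. \<integral>\<^sup>+ z. indicator C (y, z) \<partial>\<nu> n) \<in> borel_measurable M" for n
      using C approximatesD(1)[OF \<nu>]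
      by (intro s_finite_measure_measurable_nn_integral s_finite_measure_finite fin)
        (simp_all add: case_prod_unfold cong: measurable_cong_sets sets_pair_measure_cong)
    have "incseq (\<lambda>n. \<integral>\<^sup>+ z. indicator C (y, z) \<partial>\<nu> n)" for y
      by (rule approximates_nn_integral_incseq[OF \<nu>]) simp
    moreover have "(SUP n. \<integral>\<^sup>+ z. indicator C (y, z) \<partial>\<nu> n) = (\<integral>\<^sup>+ z. indicator C (y, z) \<partial>N)"
      if y: "y \<in> space M" for y
      using measurable_Pair2[OF borel_measurable_indicator[OF C] y]
      by (intro approximates_nn_integral_const[OF \<nu>])
    ultimately show ?thesis by (intro conjI approximates_nn_integral_on[OF \<mu> m])
  qed
  then show ?thesis
    unfolding approximates_def by (simp add: sets em emeasure_pair_s_finite[OF N])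
qed

lemma approximates_distr:
  assumes "approximates \<mu> M" "h \<in> M \<rightarrow>\<^sub>M N"
  shows "approximates (\<lambda>n. distr (\<mu> n) N h) (distr M N h)"
  using approximatesD[OF assms(1)] approximates_measurable[OF assms] measurable_sets[OF assms(2)] assms(2)
  by (simp add: approximates_def emeasure_distr)

section \<open>Operations on s-finite kernels\<close>

lemma s_finite_kernel_return:
  assumes "f \<in> X \<rightarrow>\<^sub>M Y"
  shows "s_finite_kernel X Y (\<lambda>x. return Y (f x))"
proof -
  have "finite_kernel X Y (\<lambda>x. return Y (f x))"
  proof (rule finite_kernelI[of _ _ _ 1])
    have "(\<lambda>x. indicator B (f x) :: ennreal) \<in> borel_measurable X" if [measurable]: "B \<in> sets Y" for B
      using assms by measurable
    then show "transition_kernel X Y (\<lambda>x. return Y (f x))" by (simp add: transition_kernel_def)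
  qed (simp_all add: indicator_def)
  then show ?thesis by (intro s_finite_kernelI[where \<kappa>'="\<lambda>n x. return Y (f x)"]) (auto simp: approximates_def)
qed

text \<open>Arrows are restricted to their source space; this moves s-finiteness between a kernel
  and its restriction.\<close>

lemma s_finite_kernel_cong:
  assumes "s_finite_kernel X Y \<kappa>" "\<And>x. x \<in> space X \<Longrightarrow> \<kappa> x = \<kappa>' x"
  shows "s_finite_kernel X Y \<kappa>'"
proof -
  obtain p where p: "\<And>n. finite_kernel X Y (p n)"
    and appr: "\<And>x. x \<in> space X \<Longrightarrow> approximates (\<lambda>n. p n x) (\<kappa> x)"
    using s_finite_kernel_approx[OF assms(1)] by blast
  show ?thesis
    using assms(2) appr s_finite_kernelD(2)[OF assms(1)] by (intro s_finite_kernelI[OF _ p]) auto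
qed

lemma s_finite_kernel_compose:
  assumes \<kappa>: "s_finite_kernel X Y \<kappa>" and g: "g \<in> Z \<rightarrow>\<^sub>M X"
  shows "s_finite_kernel Z Y (\<lambda>z. \<kappa> (g z))"
proof -
  obtain p where p: "\<And>n. finite_kernel X Y (p n)"
    and appr: "\<And>x. x \<in> space X \<Longrightarrow> approximates (\<lambda>n. p n x) (\<kappa> x)"
    using s_finite_kernel_approx[OF \<kappa>] by blast
  note tr = finite_kernelD(1)[OF p]
  have "finite_kernel Z Y (\<lambda>z. p n (g z))" for n
  proof -
    obtain b where b: "\<forall>x\<in>space X. emeasure (p n x) (space Y) \<le> ennreal b"
      using finite_kernelD(2)[OF p, of n] by auto
    show ?thesis
      using b measurable_space[OF g] transition_kernelD(1)[OF tr] measurable_compose[OF g transition_kernelD(3)[OF tr]]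
      by (intro finite_kernelI[of _ _ _ "ennreal b"]) (auto simp: transition_kernel_def)
  qed
  then show ?thesis
    using s_finite_kernelD(2)[OF \<kappa>] appr measurable_space[OF g]
    by (intro s_finite_kernelI[where \<kappa>'="\<lambda>n z. p n (g z)"]) auto
qed

text \<open>An image measure has the same total mass, so the bounds of the approximants carry
  over.\<close>

lemma s_finite_kernel_distr:
  assumes \<kappa>: "s_finite_kernel X Y \<kappa>" and h: "h \<in> Y \<rightarrow>\<^sub>M Z"
  shows "s_finite_kernel X Z (\<lambda>x. distr (\<kappa> x) Z h)"
proof -
  obtain p where p: "\<And>n. finite_kernel X Y (p n)"
    and appr: "\<And>x. x \<in> space X \<Longrightarrow> approximates (\<lambda>n. p n x) (\<kappa> x)"
    using s_finite_kernel_approx[OF \<kappa>] by blast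
  note tr = finite_kernelD(1)[OF p]
  have em: "emeasure (distr N Z h) B = emeasure N (h -` B \<inter> space Y)" if "sets N = sets Y" "B \<in> sets Z" for N B
    using that h sets_eq_imp_space_eq[OF that(1)] by (simp add: emeasure_distr cong: measurable_cong_sets)
  have fin: "finite_kernel X Z (\<lambda>x. distr (p n x) Z h)" for n
  proof -
    obtain b where b: "\<forall>x\<in>space X. emeasure (p n x) (space Y) \<le> ennreal b"
      using finite_kernelD(2)[OF p, of n] by auto
    have "(\<lambda>x. emeasure (distr (p n x) Z h) B) \<in> borel_measurable X" if "B \<in> sets Z" for B
      using transition_kernelD(3)[OF tr measurable_sets[OF h that]] em[OF transition_kernelD(1)[OF tr] that]
      by (simp cong: measurable_cong)
    moreover have "h -` space Z \<inter> space Y = space Y" using measurable_space[OF h] by auto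
    ultimately show ?thesis
      using b em[OF transition_kernelD(1)[OF tr] sets.top]
      by (intro finite_kernelI[of _ _ _ "ennreal b"]) (auto simp: transition_kernel_def)
  qed
  show ?thesis
  proof (rule s_finite_kernelI[OF sets_distr fin])
    fix x assume x: "x \<in> space X"
    show "approximates (\<lambda>n. distr (p n x) Z h) (distr (\<kappa> x) Z h)"
      using appr[OF x] h s_finite_kernelD(2)[OF \<kappa> x] by (intro approximates_distr) (simp_all cong: measurable_cong_sets)
  qed
qed

text \<open>The approximant of the composite is the composite of the n-th approximants; its mass is
  bounded by the product of the two bounds.\<close>

lemma s_finite_kernel_mixture:
  assumes \<kappa>: "s_finite_kernel X Y \<kappa>" and \<iota>: "s_finite_kernel Y Z \<iota>"
  shows "s_finite_kernel X Z (\<lambda>x. mixture (\<kappa> x) Z \<iota>)"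
proof -
  obtain p where p: "\<And>n. finite_kernel X Y (p n)"
    and p_appr: "\<And>x. x \<in> space X \<Longrightarrow> approximates (\<lambda>n. p n x) (\<kappa> x)"
    using s_finite_kernel_approx[OF \<kappa>] by blast
  obtain q where q: "\<And>n. finite_kernel Y Z (q n)"
    and q_appr: "\<And>x. x \<in> space Y \<Longrightarrow> approximates (\<lambda>n. q n x) (\<iota> x)"
    using s_finite_kernel_approx[OF \<iota>] by blast
  have em: "emeasure (mixture M Z k) C = (\<integral>\<^sup>+ y. emeasure (k y) C \<partial>M)"
    if "transition_kernel Y Z k" "sets M = sets Y" "C \<in> sets Z" for M k C
    using that transition_kernelD[OF that(1)] sets_eq_imp_space_eq[OF that(2)]
    by (intro emeasure_mixture) (auto cong: measurable_cong_sets)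
  note p_tr = finite_kernelD(1)[OF p] and q_tr = finite_kernelD(1)[OF q]
  note p_sets = transition_kernelD(1)[OF p_tr] and p_space = transition_kernelD(2)[OF p_tr]
  have fin: "finite_kernel X Z (\<lambda>x. mixture (p n x) Z (q n))" for n
  proof -
    obtain b where b: "\<forall>x\<in>space X. emeasure (p n x) (space Y) \<le> ennreal b"
      using finite_kernelD(2)[OF p, of n] by auto
    obtain c where c: "\<forall>x\<in>space Y. emeasure (q n x) (space Z) \<le> ennreal c"
      using finite_kernelD(2)[OF q, of n] by auto
    have "(\<lambda>x. emeasure (mixture (p n x) Z (q n)) C) \<in> borel_measurable X" if C: "C \<in> sets Z" for C
    proof -
      have "(\<lambda>x. \<integral>\<^sup>+ y. emeasure (q n y) C \<partial>p n x) \<in> borel_measurable X"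
        by (rule mixture_measurable_nn_integral[OF p_sets transition_kernelD(3)[OF p_tr] transition_kernelD(3)[OF q_tr C]])
      then show ?thesis using em[OF q_tr p_sets C] by (simp cong: measurable_cong)
    qed
    then have "transition_kernel X Z (\<lambda>x. mixture (p n x) Z (q n))" by (simp add: transition_kernel_def)
    moreover have "emeasure (mixture (p n x) Z (q n)) (space Z) \<le> ennreal c * ennreal b" if x: "x \<in> space X" for x
    proof -
      have "(\<integral>\<^sup>+ y. emeasure (q n y) (space Z) \<partial>p n x) \<le> (\<integral>\<^sup>+ y. ennreal c \<partial>p n x)"
        using c p_space[OF x] by (intro nn_integral_mono) simp
      also have "\<dots> = ennreal c * emeasure (p n x) (space Y)" using p_space[OF x] by simp
      also have "\<dots> \<le> ennreal c * ennreal b" using b x by (intro mult_left_mono) auto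
      finally show ?thesis using em[OF q_tr p_sets[OF x] sets.top] by simp
    qed
    ultimately show ?thesis by (rule finite_kernelI) (simp_all add: ennreal_mult_less_top)
  qed
  show ?thesis
  proof (rule s_finite_kernelI[OF _ fin])
    fix x assume x: "x \<in> space X"
    have "incseq (\<lambda>n. \<integral>\<^sup>+ y. emeasure (q n y) C \<partial>p n x) \<and>
      (SUP n. \<integral>\<^sup>+ y. emeasure (q n y) C \<partial>p n x) = (\<integral>\<^sup>+ y. emeasure (\<iota> y) C \<partial>\<kappa> x)" if C: "C \<in> sets Z" for C
    proof -
      have m: "(\<lambda>y. emeasure (q n y) C) \<in> borel_measurable (\<kappa> x)" for n
        using transition_kernelD(3)[OF q_tr C] s_finite_kernelD(2)[OF \<kappa> x] by (simp cong: measurable_cong_sets)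
      have "incseq (\<lambda>n. emeasure (q n y) C)" "(SUP n. emeasure (q n y) C) = emeasure (\<iota> y) C" if "y \<in> space (\<kappa> x)" for y
        using approximatesD(3,4)[OF q_appr, of y C] that C s_finite_kernelD(2)[OF \<iota>] s_finite_kernelD(3)[OF \<kappa> x] by auto
      then show ?thesis by (intro conjI approximates_nn_integral_on[OF p_appr[OF x] m])
    qed
    then show "approximates (\<lambda>n. mixture (p n x) Z (q n)) (mixture (\<kappa> x) Z \<iota>)"
      by (simp add: approximates_def em[OF q_tr p_sets[OF x]] em[OF s_finite_kernelD(1)[OF \<iota>] s_finite_kernelD(2)[OF \<kappa> x]])
  qed simp
qed

text \<open>Both kernels share the parameter x. The tensor of arrows arises after precomposition
  with \<open>pfst\<close> and \<open>psnd\<close>, and powers after precomposition with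
  \<open>hd\<close> and \<open>tl\<close>.\<close>

lemma s_finite_kernel_pair:
  assumes \<kappa>: "s_finite_kernel X Y \<kappa>" and \<iota>: "s_finite_kernel X Z \<iota>"
  shows "s_finite_kernel X (Y \<Otimes>\<^sub>M Z) (\<lambda>x. \<kappa> x \<Otimes>\<^sub>M \<iota> x)"
proof -
  obtain p where p: "\<And>n. finite_kernel X Y (p n)"
    and p_appr: "\<And>x. x \<in> space X \<Longrightarrow> approximates (\<lambda>n. p n x) (\<kappa> x)"
    using s_finite_kernel_approx[OF \<kappa>] by blast
  obtain q where q: "\<And>n. finite_kernel X Z (q n)"
    and q_appr: "\<And>x. x \<in> space X \<Longrightarrow> approximates (\<lambda>n. q n x) (\<iota> x)"
    using s_finite_kernel_approx[OF \<iota>] by blast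
  note p_sets = transition_kernelD(1)[OF finite_kernelD(1)[OF p]]
    and p_space = transition_kernelD(2)[OF finite_kernelD(1)[OF p]]
    and q_sets = transition_kernelD(1)[OF finite_kernelD(1)[OF q]]
    and q_space = transition_kernelD(2)[OF finite_kernelD(1)[OF q]]
    and q_fin = s_finite_measure_finite[OF finite_kernel_finite_measure[OF q]]
  have em: "emeasure (M \<Otimes>\<^sub>M N) C = (\<integral>\<^sup>+ y. \<integral>\<^sup>+ z. indicator C (y, z) \<partial>N \<partial>M)"
    if "s_finite_measure N" "sets M = sets Y" "sets N = sets Z" "C \<in> sets (Y \<Otimes>\<^sub>M Z)" for M N C
    using that sets_pair_measure_cong[OF that(2,3)] by (intro emeasure_pair_s_finite) auto
  have fin: "finite_kernel X (Y \<Otimes>\<^sub>M Z) (\<lambda>x. p n x \<Otimes>\<^sub>M q n x)" for n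
  proof -
    obtain b where b: "\<forall>x\<in>space X. emeasure (p n x) (space Y) \<le> ennreal b"
      using finite_kernelD(2)[OF p, of n] by auto
    obtain c where c: "\<forall>x\<in>space X. emeasure (q n x) (space Z) \<le> ennreal c"
      using finite_kernelD(2)[OF q, of n] by auto
    have "(\<lambda>x. emeasure (p n x \<Otimes>\<^sub>M q n x) C) \<in> borel_measurable X" if C[measurable]: "C \<in> sets (Y \<Otimes>\<^sub>M Z)" for C
    proof -
      have "(\<lambda>x. \<integral>\<^sup>+ y. \<integral>\<^sup>+ z. indicator C (y, z) \<partial>q n x \<partial>p n x) \<in> borel_measurable X"
      proof (rule finite_kernel_measurable_nn_integral[OF p measurable_ident_sets[OF refl]])
        have "(\<lambda>w. \<integral>\<^sup>+ z. indicator C (snd w, z) \<partial>q n (fst w)) \<in> borel_measurable (X \<Otimes>\<^sub>M Y)"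
          by (rule finite_kernel_measurable_nn_integral[OF q]) (simp_all add: case_prod_unfold)
        then show "(\<lambda>(x, y). \<integral>\<^sup>+ z. indicator C (y, z) \<partial>q n x) \<in> borel_measurable (X \<Otimes>\<^sub>M Y)"
          by (simp add: case_prod_unfold)
      qed
      then show ?thesis using em[OF q_fin p_sets q_sets C] by (simp cong: measurable_cong)
    qed
    then have "transition_kernel X (Y \<Otimes>\<^sub>M Z) (\<lambda>x. p n x \<Otimes>\<^sub>M q n x)"
      using sets_pair_measure_cong[OF p_sets q_sets] by (simp add: transition_kernel_def)
    moreover have "emeasure (p n x \<Otimes>\<^sub>M q n x) (space (Y \<Otimes>\<^sub>M Z)) \<le> ennreal c * ennreal b" if x: "x \<in> space X" for x
    proof -
      have "emeasure (p n x \<Otimes>\<^sub>M q n x) (space (Y \<Otimes>\<^sub>M Z))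
        = (\<integral>\<^sup>+ y. \<integral>\<^sup>+ z. indicator (space Y \<times> space Z) (y, z) \<partial>q n x \<partial>p n x)"
        unfolding em[OF q_fin[OF x] p_sets[OF x] q_sets[OF x] sets.top] by (simp add: space_pair_measure)
      also have "\<dots> \<le> (\<integral>\<^sup>+ y. \<integral>\<^sup>+ z. 1 \<partial>q n x \<partial>p n x)"
        by (intro nn_integral_mono) (simp add: indicator_def)
      also have "\<dots> = emeasure (q n x) (space Z) * emeasure (p n x) (space Y)"
        using p_space[OF x] q_space[OF x] by simp
      also have "\<dots> \<le> ennreal c * ennreal b" using b c x by (intro mult_mono) auto
      finally show ?thesis .
    qed
    ultimately show ?thesis by (rule finite_kernelI) (simp_all add: ennreal_mult_less_top)
  qed
  show ?thesis
  proof (rule s_finite_kernelI[OF _ fin])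
    show "sets (\<kappa> x \<Otimes>\<^sub>M \<iota> x) = sets (Y \<Otimes>\<^sub>M Z)" if "x \<in> space X" for x
      by (rule sets_pair_measure_cong[OF s_finite_kernelD(2)[OF \<kappa> that] s_finite_kernelD(2)[OF \<iota> that]])
  qed (rule approximates_pair[OF p_appr q_appr finite_kernel_finite_measure[OF q]])
qed

lemma list_all2_replicate_iff: "list_all2 (\<in>) xs (replicate n A) \<longleftrightarrow> length xs = n \<and> set xs \<subseteq> A"
proof -
  have "list_all2 (\<in>) xs (replicate (length xs) A) \<longleftrightarrow> set xs \<subseteq> A" by (induction xs) auto
  then show ?thesis by (metis length_replicate list_all2_lengthD)
qed

section \<open>Product and sequence spaces\<close>

lemma prod_space_closed:
  "{{Pr x y |x y. x \<in> A \<and> y \<in> B} |A B. A \<in> sets X \<and> B \<in> sets Y}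
    \<subseteq> Pow {Pr x y |x y. x \<in> space X \<and> y \<in> space Y}"
  using sets.sets_into_space by fastforce

lemma space_prod_space: "space (prod_space X Y) = {Pr x y |x y. x \<in> space X \<and> y \<in> space Y}"
  unfolding prod_space_def by (rule space_measure_of[OF prod_space_closed])

lemma sets_prod_space:
  "sets (prod_space X Y) = sigma_sets {Pr x y |x y. x \<in> space X \<and> y \<in> space Y}
     {{Pr x y |x y. x \<in> A \<and> y \<in> B} |A B. A \<in> sets X \<and> B \<in> sets Y}"
  unfolding prod_space_def by (rule sets_measure_of[OF prod_space_closed])

lemma Pr_in_prod_space [simp]: "Pr x y \<in> space (prod_space X Y) \<longleftrightarrow> x \<in> space X \<and> y \<in> space Y"
  by (simp add: space_prod_space)

lemma prod_spaceE:
  assumes "z \<in> space (prod_space X Y)"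
  obtains x y where "z = Pr x y" "x \<in> space X" "y \<in> space Y"
  using assms by (auto simp: space_prod_space)

lemma measurable_Pr [measurable (raw)]:
  assumes [measurable]: "f \<in> M \<rightarrow>\<^sub>M X" "g \<in> M \<rightarrow>\<^sub>M Y"
  shows "(\<lambda>z. Pr (f z) (g z)) \<in> M \<rightarrow>\<^sub>M prod_space X Y"
  unfolding prod_space_def
proof (rule measurable_measure_of[OF prod_space_closed])
  show "(\<lambda>z. Pr (f z) (g z)) \<in> space M \<rightarrow> {Pr x y |x y. x \<in> space X \<and> y \<in> space Y}"
    using measurable_space[OF assms(1)] measurable_space[OF assms(2)] by auto
next
  fix C assume "C \<in> {{Pr x y |x y. x \<in> A \<and> y \<in> B} |A B. A \<in> sets X \<and> B \<in> sets Y}"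
  then obtain A B where C: "C = {Pr x y |x y. x \<in> A \<and> y \<in> B}" and [measurable]: "A \<in> sets X" "B \<in> sets Y"
    by blast
  have "(\<lambda>z. Pr (f z) (g z)) -` C \<inter> space M = {z \<in> space M. f z \<in> A \<and> g z \<in> B}"
    by (auto simp: C)
  also have "\<dots> \<in> sets M" by measurable
  finally show "(\<lambda>z. Pr (f z) (g z)) -` C \<inter> space M \<in> sets M" .
qed

lemma measurable_pfst [measurable]: "pfst \<in> prod_space X Y \<rightarrow>\<^sub>M X"
proof (rule measurableI)
  fix A assume A: "A \<in> sets X"
  have "pfst -` A \<inter> space (prod_space X Y) = {Pr x y |x y. x \<in> A \<and> y \<in> space Y}"
    using sets.sets_into_space[OF A] by (fastforce simp: space_prod_space)
  then show "pfst -` A \<inter> space (prod_space X Y) \<in> sets (prod_space X Y)"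
    using A unfolding sets_prod_space by (intro sigma_sets.Basic) blast
qed (auto simp: space_prod_space)

lemma measurable_psnd [measurable]: "psnd \<in> prod_space X Y \<rightarrow>\<^sub>M Y"
proof (rule measurableI)
  fix A assume A: "A \<in> sets Y"
  have "psnd -` A \<inter> space (prod_space X Y) = {Pr x y |x y. x \<in> space X \<and> y \<in> A}"
    using sets.sets_into_space[OF A] by (fastforce simp: space_prod_space)
  then show "psnd -` A \<inter> space (prod_space X Y) \<in> sets (prod_space X Y)"
    using A unfolding sets_prod_space by (intro sigma_sets.Basic) blast
qed (auto simp: space_prod_space)

section \<open>Sequence spaces\<close>

abbreviation rectangle :: "'a set list \<Rightarrow> 'a list set" where
  "rectangle As \<equiv> {xs. list_all2 (\<in>) xs As}"

lemma rectangle_subset: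
  assumes "set As \<subseteq> sets X"
  shows "rectangle As \<subseteq> {xs. length xs = length As \<and> set xs \<subseteq> space X}"
proof safe
  fix xs x assume xs: "list_all2 (\<in>) xs As"
  then show "length xs = length As" by (rule list_all2_lengthD)
  assume "x \<in> set xs"
  then obtain A where "A \<in> set As" "x \<in> A"
    using xs by (metis in_set_conv_nth list_all2_conv_all_nth)
  then show "x \<in> space X" using assms sets.sets_into_space by blast
qed

lemma seq_space_closed:
  "{rectangle As |As. length As = n \<and> set As \<subseteq> sets X} \<subseteq> Pow {xs. length xs = n \<and> set xs \<subseteq> space X}"
  using rectangle_subset by blast

lemma space_seq_space: "space (seq_space X n) = {xs. length xs = n \<and> set xs \<subseteq> space X}"
  unfolding seq_space_def by (rule space_measure_of[OF seq_space_closed])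

lemma sets_seq_space:
  "sets (seq_space X n) = sigma_sets {xs. length xs = n \<and> set xs \<subseteq> space X}
     {rectangle As |As. length As = n \<and> set As \<subseteq> sets X}"
  unfolding seq_space_def by (rule sets_measure_of[OF seq_space_closed])

lemma rectangle_in_sets: "set As \<subseteq> sets X \<Longrightarrow> rectangle As \<in> sets (seq_space X (length As))"
  unfolding sets_seq_space by (rule sigma_sets.Basic) blast

text \<open>Prepares the Dynkin induction in \<open>measurable_perm_sum\<close>.\<close>

lemma Int_stable_rectangle: "Int_stable {rectangle As |As. length As = n \<and> set As \<subseteq> sets X}"
proof (rule Int_stableI)
  fix a b assume "a \<in> {rectangle As |As. length As = n \<and> set As \<subseteq> sets X}" "b \<in> {rectangle As |As. length As = n \<and> set As \<subseteq> sets X}"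
  then obtain As Bs where *: "a = rectangle As" "length As = n" "set As \<subseteq> sets X" "b = rectangle Bs" "length Bs = n" "set Bs \<subseteq> sets X"
    by blast
  have "a \<inter> b = rectangle (map2 (\<inter>) As Bs)"
    unfolding * using * by (auto simp: list_all2_conv_all_nth)
  moreover have "set (map2 (\<inter>) As Bs) \<subseteq> sets X"
    using *(3,6) by (fastforce dest: set_zip_leftD set_zip_rightD)
  ultimately show "a \<inter> b \<in> {rectangle As |As. length As = n \<and> set As \<subseteq> sets X}"
    using * by (intro CollectI exI[of _ "map2 (\<inter>) As Bs"]) simp
qed

text \<open>Together with the measurability of \<open>hd\<close> and \<open>tl\<close> this lets a
  sequence space of length n + 1 be handled as a binary product, so that proofs go by induction on
  the length.\<close>

lemma measurable_Cons_seq [measurable (raw)]: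
  assumes [measurable]: "f \<in> M \<rightarrow>\<^sub>M X" "g \<in> M \<rightarrow>\<^sub>M seq_space X n"
  shows "(\<lambda>z. f z # g z) \<in> M \<rightarrow>\<^sub>M seq_space X (Suc n)"
  unfolding seq_space_def[of X "Suc n"]
proof (rule measurable_measure_of[OF seq_space_closed])
  show "(\<lambda>z. f z # g z) \<in> space M \<rightarrow> {xs. length xs = Suc n \<and> set xs \<subseteq> space X}"
    using measurable_space[OF assms(1)] measurable_space[OF assms(2)] by (auto simp: space_seq_space)
next
  fix C assume "C \<in> {rectangle As |As. length As = Suc n \<and> set As \<subseteq> sets X}"
  then obtain A As where C: "C = rectangle (A # As)" and A[measurable]: "A \<in> sets X" and As: "set As \<subseteq> sets X" "length As = n"
    by (auto simp: length_Suc_conv)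
  note [measurable] = rectangle_in_sets[OF As(1), unfolded As(2)]
  have "(\<lambda>z. f z # g z) -` C \<inter> space M = {z \<in> space M. f z \<in> A \<and> g z \<in> rectangle As}"
    by (auto simp: C)
  also have "\<dots> \<in> sets M" by measurable
  finally show "(\<lambda>z. f z # g z) -` C \<inter> space M \<in> sets M" .
qed

lemma measurable_hd_seq [measurable]: "hd \<in> seq_space X (Suc n) \<rightarrow>\<^sub>M X"
proof (rule measurableI)
  fix A assume A: "A \<in> sets X"
  \<comment> \<open>Unconstrained positions are filled with the whole space.\<close>
  have "hd -` A \<inter> space (seq_space X (Suc n)) = rectangle (A # replicate n (space X))"
    using sets.sets_into_space[OF A]
    by (auto simp: space_seq_space list_all2_Cons2 list_all2_replicate_iff length_Suc_conv)
  also have "\<dots> \<in> sets (seq_space X (Suc n))"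
    using rectangle_in_sets[of "A # replicate n (space X)" X] A by (auto simp: set_replicate_conv_if)
  finally show "hd -` A \<inter> space (seq_space X (Suc n)) \<in> sets (seq_space X (Suc n))" .
qed (auto simp: space_seq_space length_Suc_conv)

lemma measurable_tl_seq [measurable]: "tl \<in> seq_space X (Suc n) \<rightarrow>\<^sub>M seq_space X n"
  unfolding seq_space_def[of X n]
proof (rule measurable_measure_of[OF seq_space_closed])
  show "tl \<in> space (seq_space X (Suc n)) \<rightarrow> {xs. length xs = n \<and> set xs \<subseteq> space X}"
    by (auto simp: space_seq_space length_Suc_conv)
next
  fix C assume "C \<in> {rectangle As |As. length As = n \<and> set As \<subseteq> sets X}"
  then obtain As where As: "C = rectangle As" "length As = n" "set As \<subseteq> sets X" by blast
  have "tl -` C \<inter> space (seq_space X (Suc n)) = rectangle (space X # As)"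
    using rectangle_subset[OF As(3)] As(2)
    by (fastforce simp: As(1) space_seq_space list_all2_Cons2 length_Suc_conv)
  also have "\<dots> \<in> sets (seq_space X (Suc n))"
    using rectangle_in_sets[of "space X # As" X] As by simp
  finally show "tl -` C \<inter> space (seq_space X (Suc n)) \<in> sets (seq_space X (Suc n))" .
qed

section \<open>The exponential space\<close>

lemma exp_space_closed:
  "{{Ms (mset xs) |xs. xs \<in> rectangle As} |As. set As \<subseteq> sets X} \<subseteq> Pow {Ms M |M. set_mset M \<subseteq> space X}"
proof -
  have "set_mset (mset xs) \<subseteq> space X" if "xs \<in> rectangle As" "set As \<subseteq> sets X" for xs As
    using rectangle_subset[OF that(2)] that(1) by auto
  then show ?thesis by blast
qed

lemma exp_space_sigma:
  "exp_space X = sigma {Ms M |M. set_mset M \<subseteq> space X} {{Ms (mset xs) |xs. xs \<in> rectangle As} |As. set As \<subseteq> sets X}"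
  by (simp add: exp_space_def)

lemma space_exp_space: "space (exp_space X) = {Ms M |M. set_mset M \<subseteq> space X}"
  unfolding exp_space_sigma by (rule space_measure_of[OF exp_space_closed])

lemma sets_exp_space:
  "sets (exp_space X) = sigma_sets {Ms M |M. set_mset M \<subseteq> space X} {{Ms (mset xs) |xs. xs \<in> rectangle As} |As. set As \<subseteq> sets X}"
  unfolding exp_space_sigma by (rule sets_measure_of[OF exp_space_closed])

lemma Ms_in_exp_space [simp]: "Ms M \<in> space (exp_space X) \<longleftrightarrow> set_mset M \<subseteq> space X"
  by (simp add: space_exp_space)

lemma exp_spaceE:
  assumes "z \<in> space (exp_space X)"
  obtains xs where "z = Ms (mset xs)" "set xs \<subseteq> space X"
proof -
  obtain M where M: "z = Ms M" "set_mset M \<subseteq> space X" using assms by (auto simp: space_exp_space)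
  obtain xs where "mset xs = M" using ex_mset by blast
  with M show thesis by (intro that) auto
qed

section \<open>Counting functions on the exponential space\<close>

abbreviation num_in :: "'u univ set \<Rightarrow> 'u univ \<Rightarrow> nat" where
  "num_in A z \<equiv> size (filter_mset (\<lambda>x. x \<in> A) (bag z))"

lemma measurable_nat_ge:
  fixes f :: "'a \<Rightarrow> nat"
  assumes "\<And>k. {z \<in> space M. k \<le> f z} \<in> sets M"
  shows "f \<in> M \<rightarrow>\<^sub>M count_space UNIV"
  unfolding measurable_count_space_eq2_countable
proof (intro conjI ballI)
  fix k
  have "f -` {k} \<inter> space M = {z \<in> space M. k \<le> f z} - {z \<in> space M. Suc k \<le> f z}" by auto
  then show "f -` {k} \<inter> space M \<in> sets M" using assms by (simp add: sets.Diff)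
qed simp

lemma measurable_num_in:
  assumes A: "A \<in> sets X"
  shows "num_in A \<in> exp_space X \<rightarrow>\<^sub>M count_space UNIV"
proof (rule measurable_nat_ge)
  fix k
  \<comment> \<open>At least k points in A means that, for some n, the multiset lies in the
    generator built from k copies of A and n copies of the whole space. The union over n is
    countable.\<close>
  let ?As = "\<lambda>n. replicate k A @ replicate n (space X)"
  have "{z \<in> space (exp_space X). k \<le> num_in A z} = (\<Union>n. {Ms (mset xs) |xs. xs \<in> rectangle (?As n)})"
  proof (intro equalityI subsetI)
    fix z assume "z \<in> {z \<in> space (exp_space X). k \<le> num_in A z}"
    then obtain xs where z: "z = Ms (mset xs)" "set xs \<subseteq> space X" and k: "k \<le> length (filter (\<lambda>x. x \<in> A) xs)"
      by (auto elim!: exp_spaceE simp flip: mset_filter)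
    \<comment> \<open>The witness ordering puts k of the points of A in front; the surplus points of
      A join the remaining points, where only membership in the space is required.\<close>
    define us where "us = filter (\<lambda>x. x \<in> A) xs"
    define vs where "vs = drop k us @ filter (\<lambda>x. x \<notin> A) xs"
    have "mset (take k us @ vs) = mset xs" by (simp add: vs_def us_def flip: append_assoc)
    moreover have "take k us @ vs \<in> rectangle (?As (length vs))"
      using k z(2) unfolding us_def vs_def
      by (intro CollectI list_all2_appendI) (auto simp: list_all2_replicate_iff dest!: in_set_takeD in_set_dropD)
    ultimately show "z \<in> (\<Union>n. {Ms (mset xs) |xs. xs \<in> rectangle (?As n)})" unfolding z by (metis (mono_tags, lifting) UN_I UNIV_I mem_Collect_eq)
  next
    fix z assume "z \<in> (\<Union>n. {Ms (mset xs) |xs. xs \<in> rectangle (?As n)})"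
    then obtain n us vs where z: "z = Ms (mset (us @ vs))" "length us = k" "set us \<subseteq> A" "set vs \<subseteq> space X"
      by (auto simp: list_all2_append2 list_all2_replicate_iff)
    have "filter_mset (\<lambda>x. x \<in> A) (mset us) = mset us"
      using z(3) by (auto simp: filter_mset_eq_conv)
    then show "z \<in> {z \<in> space (exp_space X). k \<le> num_in A z}"
      using z sets.sets_into_space[OF A] by auto
  qed
  also have "\<dots> \<in> sets (exp_space X)"
    using A by (intro sets.countable_UN) (auto simp: sets_exp_space set_replicate_conv_if intro!: sigma_sets.Basic split: if_splits)
  finally show "{z \<in> space (exp_space X). k \<le> num_in A z} \<in> sets (exp_space X)" .
qed

lemma countable_multisets: "countable (UNIV :: 'a::countable multiset set)"
proof -
  have "surj (mset :: 'a list \<Rightarrow> _)" unfolding surj_def by (metis ex_mset)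
  then show ?thesis by (metis countable_image countableI_type)
qed

lemma count_image_mset_size: "count (image_mset f M) y = size (filter_mset (\<lambda>x. f x = y) M)"
  by (induction M) auto

text \<open>A symmetric condition on the memberships of points in the sets \<open>As\<close> only depends on the
  multiset of their patterns, which lives in a countable type.\<close>

abbreviation pattern :: "'a set list \<Rightarrow> 'a \<Rightarrow> bool list" where
  "pattern As x \<equiv> map (\<lambda>A. x \<in> A) As"

lemma measurable_image_pattern:
  assumes f: "\<And>z. z \<in> space Z \<Longrightarrow> f z \<in> space (exp_space X)"
    and num[measurable]: "\<And>A. A \<in> sets X \<Longrightarrow> (\<lambda>z. num_in A (f z)) \<in> Z \<rightarrow>\<^sub>M count_space UNIV"
    and As: "set As \<subseteq> sets X"
  shows "(\<lambda>z. image_mset (pattern As) (bag (f z))) \<in> Z \<rightarrow>\<^sub>M count_space UNIV"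
  unfolding measurable_count_space_eq_countable[OF countable_multisets]
proof (intro conjI ballI)
  fix Q :: "bool list multiset"
  \<comment> \<open>The sets \<open>B q\<close> are the atoms of the partition generated by
    \<open>As\<close>. The multiplicity of the pattern q is the number of points in
    \<open>B q\<close>, so each pattern multiset is described by countably many counting
    conditions.\<close>
  define B where "B q = {x \<in> space X. pattern As x = q}" for q
  have B[measurable]: "B q \<in> sets X" for q
  proof (cases "length q = length As")
    case True
    then have "B q = {x \<in> space X. \<forall>i\<in>{..<length As}. (x \<in> As ! i) = q ! i}"
      by (auto simp: B_def list_eq_iff_nth_eq)
    also have "\<dots> \<in> sets X"
    proof (rule sets.sets_Collect_finite_All)
      fix i assume "i \<in> {..<length As}"
      then have [measurable]: "As ! i \<in> sets X" using As by auto
      show "{x \<in> space X. (x \<in> As ! i) = q ! i} \<in> sets X" by measurable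
    qed simp
    finally show ?thesis .
  next
    case False
    then have "B q = {}" by (auto simp: B_def)
    then show ?thesis by simp
  qed
  have "(\<lambda>z. image_mset (pattern As) (bag (f z))) -` {Q} \<inter> space Z
    = {z \<in> space Z. \<forall>q. num_in (B q) (f z) = count Q q}"
  proof -
    have "count (image_mset (pattern As) (bag (f z))) q = num_in (B q) (f z)" if "z \<in> space Z" for z q
    proof -
      have "set_mset (bag (f z)) \<subseteq> space X" using f[OF that] by (auto simp: space_exp_space)
      then show ?thesis unfolding count_image_mset_size
        by (intro arg_cong[where f=size] filter_mset_cong) (auto simp: B_def)
    qed
    then show ?thesis by (auto simp: multiset_eq_iff)
  qed
  also have "\<dots> \<in> sets Z" by measurable
  finally show "(\<lambda>z. image_mset (pattern As) (bag (f z))) -` {Q} \<inter> space Z \<in> sets Z" .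
qed simp

text \<open>Membership in a generator asks for a bijective matching of the points with the sets
  \<open>As\<close>, which can be decided from the multiset of patterns. Hence the counting
  functions alone control measurability.\<close>

lemma measurable_into_exp_space:
  assumes f: "\<And>z. z \<in> space Z \<Longrightarrow> f z \<in> space (exp_space X)"
    and num: "\<And>A. A \<in> sets X \<Longrightarrow> (\<lambda>z. num_in A (f z)) \<in> Z \<rightarrow>\<^sub>M count_space UNIV"
  shows "f \<in> Z \<rightarrow>\<^sub>M exp_space X"
  unfolding exp_space_sigma
proof (rule measurable_measure_of[OF exp_space_closed])
  show "f \<in> space Z \<rightarrow> {Ms M |M. set_mset M \<subseteq> space X}" using f by (auto simp: space_exp_space)
next
  fix C assume "C \<in> {{Ms (mset xs) |xs. xs \<in> rectangle As} |As. set As \<subseteq> sets X}"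
  then obtain As where C: "C = {Ms (mset xs) |xs. xs \<in> rectangle As}" and As: "set As \<subseteq> sets X" by blast
  \<comment> \<open>The matching condition on patterns: in a suitable order, the i-th pattern is
    true at its i-th entry, meaning that the i-th point lies in the i-th set.\<close>
  define h where "h Q \<longleftrightarrow> (\<exists>qs. mset qs = Q \<and> length qs = length As \<and> (\<forall>i<length As. qs ! i ! i))" for Q
  have "f z \<in> C \<longleftrightarrow> h (image_mset (pattern As) (bag (f z)))" if z: "z \<in> space Z" for z
  proof
    assume "f z \<in> C"
    then obtain xs where xs: "f z = Ms (mset xs)" "xs \<in> rectangle As" by (auto simp: C)
    then show "h (image_mset (pattern As) (bag (f z)))" unfolding h_def
      by (intro exI[of _ "map (pattern As) xs"]) (auto simp: list_all2_conv_all_nth)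
  next
    assume "h (image_mset (pattern As) (bag (f z)))"
    then obtain qs where qs: "mset qs = image_mset (pattern As) (bag (f z))" "length qs = length As" "\<forall>i<length As. qs ! i ! i"
      by (auto simp: h_def)
    obtain ys where ys: "f z = Ms (mset ys)" using exp_spaceE[OF f[OF z]] by metis
    \<comment> \<open>The reordering of the patterns is a permutation of positions, so it can be
      applied to the points themselves.\<close>
    have "mset qs = mset (map (pattern As) ys)" using qs(1) ys by simp
    then obtain p where p: "p permutes {..<length (map (pattern As) ys)}" "permute_list p (map (pattern As) ys) = qs"
      by (rule mset_eq_permutation)
    then have "map (pattern As) (permute_list p ys) = qs" by (simp add: permute_list_map)
    moreover from this have "length ys = length As" using qs(2) by auto
    ultimately have "permute_list p ys \<in> rectangle As"
      using qs(3) by (auto simp: list_all2_conv_all_nth)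
    moreover have "f z = Ms (mset (permute_list p ys))" using p(1) ys by simp
    ultimately show "f z \<in> C" unfolding C by blast
  qed
  then have "f -` C \<inter> space Z = {z \<in> space Z. h (image_mset (pattern As) (bag (f z)))}" by blast
  also have "\<dots> \<in> sets Z"
    using measurable_sets[OF measurable_image_pattern[OF f num As], of "{Q. h Q}"]
    by (simp add: vimage_def Int_def conj_commute)
  finally show "f -` C \<inter> space Z \<in> sets Z" .
qed

lemma measurable_Ms_mset [measurable]: "(\<lambda>xs. Ms (mset xs)) \<in> seq_space X n \<rightarrow>\<^sub>M exp_space X"
proof (rule measurable_into_exp_space)
  show "(\<lambda>xs. num_in A (Ms (mset xs))) \<in> seq_space X n \<rightarrow>\<^sub>M count_space UNIV" if [measurable]: "A \<in> sets X" for A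
  proof (induction n)
    case 0
    have "(\<lambda>xs. num_in A (Ms (mset xs))) \<in> seq_space X 0 \<rightarrow>\<^sub>M count_space UNIV
      \<longleftrightarrow> (\<lambda>xs. 0 :: nat) \<in> seq_space X 0 \<rightarrow>\<^sub>M count_space UNIV"
      by (rule measurable_cong) (simp add: space_seq_space)
    then show ?case by simp
  next
    case (Suc n)
    note [measurable] = measurable_compose[OF measurable_tl_seq Suc]
    have "(\<lambda>xs. (if hd xs \<in> A then 1 else 0) + num_in A (Ms (mset (tl xs)))) \<in> seq_space X (Suc n) \<rightarrow>\<^sub>M count_space UNIV"
      by measurable
    moreover have "(if hd xs \<in> A then 1 else 0) + num_in A (Ms (mset (tl xs))) = num_in A (Ms (mset xs))"
      if "xs \<in> space (seq_space X (Suc n))" for xs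
      using that by (auto simp: space_seq_space length_Suc_conv)
    ultimately show ?case by (simp cong: measurable_cong)
  qed
qed (auto simp: space_seq_space)

section \<open>Symmetrisation over permutations\<close>

definition perm_sum :: "('a list \<Rightarrow> ennreal) \<Rightarrow> 'a list \<Rightarrow> ennreal" where
  "perm_sum g xs = (\<Sum>p | p permutes {..<length xs}. g (permute_list p xs))"

text \<open>\<open>perm_sum\<close> is the symmetrisation of g without the factor 1/n!. Composing
  with a fixed permutation only reindexes its summands.\<close>

lemma perm_sum_mset_eq:
  assumes "mset xs = mset ys"
  shows "perm_sum g xs = perm_sum g ys"
proof -
  obtain q where q: "q permutes {..<length ys}" "permute_list q ys = xs"
    using mset_eq_permutation[OF assms] .
  have "perm_sum g ys = (\<Sum>p | p permutes {..<length ys}. g (permute_list (q \<circ> p) ys))"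
    unfolding perm_sum_def by (rule setum_permutations_compose_left[OF q(1)])
  also have "\<dots> = perm_sum g xs"
    unfolding perm_sum_def q(2)[symmetric] by (intro sum.cong) (auto simp: permute_list_compose)
  finally show ?thesis ..
qed

text \<open>The same choice of an ordering as in \<open>exp_kernel\<close>, so that unfolding that
  definition produces this term.\<close>

abbreviation enum_mset :: "'a multiset \<Rightarrow> 'a list" where
  "enum_mset M \<equiv> SOME xs. mset xs = M"

lemma mset_enum_mset: "mset (enum_mset M) = M"
  using ex_mset by (rule someI_ex)

lemma length_enum_mset: "length (enum_mset M) = size M"
  by (metis mset_enum_mset size_mset)

text \<open>Dynkin induction on C. For a rectangle the sum depends on the multiset of patterns only,
  a complement subtracts from n!, and a disjoint union gives a series.\<close>

lemma measurable_perm_sum: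
  assumes "C \<in> sets (seq_space X n)"
  shows "(\<lambda>z. if size (bag z) = n then perm_sum (indicator C) (enum_mset (bag z)) else 0) \<in> borel_measurable (exp_space X)"
    (is "?\<Phi> C \<in> _")
  using Int_stable_rectangle seq_space_closed assms[unfolded sets_seq_space]
proof (induction C rule: sigma_sets_induct_disjoint)
  case (basic C)
  then obtain As where As: "C = rectangle As" "length As = n" "set As \<subseteq> sets X" by blast
  \<comment> \<open>Patterns record all memberships, so the indicator of the rectangle becomes the
    diagonal condition on the pattern list.\<close>
  define h where "h Q = (if size Q = n then perm_sum (\<lambda>qs. of_bool (\<forall>i<n. qs ! i ! i)) (enum_mset Q) else 0)" for Q
  have "?\<Phi> C z = h (image_mset (pattern As) (bag z))" for z
  proof (cases "size (bag z) = n")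
    case True
    let ?xs = "enum_mset (bag z)"
    have "perm_sum (indicator C) ?xs = perm_sum (\<lambda>qs. of_bool (\<forall>i<n. qs ! i ! i)) (map (pattern As) ?xs)"
      unfolding perm_sum_def using True As(2)
      by (intro sum.cong) (auto simp: As(1) list_all2_conv_all_nth permute_list_map length_enum_mset indicator_def)
    also have "\<dots> = perm_sum (\<lambda>qs. of_bool (\<forall>i<n. qs ! i ! i)) (enum_mset (image_mset (pattern As) (bag z)))"
      by (rule perm_sum_mset_eq) (simp add: mset_enum_mset)
    finally show ?thesis using True by (simp add: h_def)
  qed (simp add: h_def)
  moreover have "(\<lambda>z. h (image_mset (pattern As) (bag z))) \<in> borel_measurable (exp_space X)"
    by (rule measurable_compose[OF measurable_image_pattern[OF _ measurable_num_in As(3)]]) auto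
  ultimately show ?case by simp
next
  case empty
  have "perm_sum (indicator {}) xs = 0" for xs :: "'a univ list" by (simp add: perm_sum_def)
  then show ?case by (simp only: if_cancel borel_measurable_const)
next
  case (compl C)
  let ?\<Omega> = "{xs. length xs = n \<and> set xs \<subseteq> space X}"
  \<comment> \<open>The size is the counting function of the whole space. It is derived directly
    because \<open>measurable_from_exp_space\<close> rests on the present lemma.\<close>
  have [measurable]: "(\<lambda>z. size (bag z)) \<in> exp_space X \<rightarrow>\<^sub>M count_space UNIV"
  proof -
    have "num_in (space X) z = size (bag z)" if "z \<in> space (exp_space X)" for z
    proof -
      have "filter_mset (\<lambda>x. x \<in> space X) (bag z) = bag z"
        using that by (auto simp: space_exp_space filter_mset_eq_conv)
      then show ?thesis by simp
    qed
    then show ?thesis using measurable_num_in[OF sets.top, of X] by (simp cong: measurable_cong)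
  qed
  have "?\<Phi> (?\<Omega> - C) z = (if size (bag z) = n then fact n else 0) - ?\<Phi> C z" if z: "z \<in> space (exp_space X)" for z
  proof (cases "size (bag z) = n")
    case True
    let ?xs = "enum_mset (bag z)"
    have xs: "length ?xs = n" "set ?xs \<subseteq> space X"
      using True z mset_enum_mset[of "bag z"] by (simp add: length_enum_mset, metis Ms_in_exp_space exp_spaceE set_mset_mset univ.sel(4))
    have perm: "permute_list p ?xs \<in> ?\<Omega>" if "p permutes {..<n}" for p
      using xs that by (simp add: set_permute_list)
    \<comment> \<open>Each of the n! orderings lies either in C or in its complement.\<close>
    have "perm_sum (indicator C) ?xs + perm_sum (indicator (?\<Omega> - C)) ?xs = (\<Sum>p | p permutes {..<n}. 1)"
      unfolding perm_sum_def xs(1) sum.distrib[symmetric]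
    proof (intro sum.cong refl)
      fix p assume "p \<in> {p. p permutes {..<n}}"
      then have "permute_list p ?xs \<in> ?\<Omega>" by (intro perm) simp
      then show "indicator C (permute_list p ?xs) + indicator (?\<Omega> - C) (permute_list p ?xs) = (1::ennreal)"
        unfolding indicator_def by simp
    qed
    also have "\<dots> = fact n" by (simp add: card_permutations)
    finally have "perm_sum (indicator C) ?xs + perm_sum (indicator (?\<Omega> - C)) ?xs = fact n" .
    \<comment> \<open>Cancellation in \<open>ennreal\<close> requires a finite subtrahend.\<close>
    moreover have "perm_sum (indicator C) ?xs \<noteq> top"
      unfolding perm_sum_def using finite_permutations[of "{..<length ?xs}"] by (auto simp: indicator_def)
    ultimately show ?thesis unfolding if_P[OF True]
      using ennreal_add_diff_cancel_left[of "perm_sum (indicator C) ?xs" "perm_sum (indicator (?\<Omega> - C)) ?xs"] by argo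
  qed simp
  moreover note compl.IH[measurable]
  have "(\<lambda>z. (if size (bag z) = n then fact n else 0) - ?\<Phi> C z) \<in> borel_measurable (exp_space X)"
    by measurable
  ultimately show ?case by (simp cong: measurable_cong)
next
  case (union A)
  have "?\<Phi> (\<Union>i. A i) z = (\<Sum>i. ?\<Phi> (A i) z)" for z
  proof -
    have "perm_sum (indicator (\<Union>i. A i)) xs = (\<Sum>i. perm_sum (indicator (A i)) xs)" for xs
      unfolding perm_sum_def using suminf_indicator[OF union.hyps(1)]
      by (simp add: suminf_sum)
    then show ?thesis by simp
  qed
  moreover note union.IH[measurable]
  have "(\<lambda>z. \<Sum>i. ?\<Phi> (A i) z) \<in> borel_measurable (exp_space X)" by measurable
  ultimately show ?case by simp
qed

text \<open>The \<open>\<sigma>\<close>-field of \<open>X\<^sub>e\<close> is the quotient of the one on sequences: a symmetric measurable set \<open>C\<close> of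
  sequences is recovered as the set where the symmetrised indicator of \<open>C\<close> is nonzero.\<close>

lemma measurable_from_exp_space:
  assumes f: "\<And>n. (\<lambda>xs. f (Ms (mset xs))) \<in> seq_space X n \<rightarrow>\<^sub>M Z"
  shows "f \<in> exp_space X \<rightarrow>\<^sub>M Z"
proof (rule measurableI)
  fix z assume "z \<in> space (exp_space X)"
  then obtain xs where xs: "z = Ms (mset xs)" "set xs \<subseteq> space X" by (rule exp_spaceE)
  then have "xs \<in> space (seq_space X (length xs))" by (simp add: space_seq_space)
  then show "f z \<in> space Z" using measurable_space[OF f] xs by blast
next
  fix B assume B: "B \<in> sets Z"
  define C where "C n = (\<lambda>xs. f (Ms (mset xs))) -` B \<inter> space (seq_space X n)" for n
  let ?\<Phi> = "\<lambda>n z. if size (bag z) = n then perm_sum (indicator (C n)) (enum_mset (bag z)) else 0"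
  have C: "C n \<in> sets (seq_space X n)" for n unfolding C_def by (rule measurable_sets[OF f B])
  note [measurable] = measurable_perm_sum[OF C]
  have "f -` B \<inter> space (exp_space X) = (\<Union>n. {z \<in> space (exp_space X). ?\<Phi> n z \<noteq> 0})"
  proof -
    have "f z \<in> B \<longleftrightarrow> ?\<Phi> (size (bag z)) z \<noteq> 0" if z: "z \<in> space (exp_space X)" for z
    proof -
      let ?xs = "enum_mset (bag z)"
      \<comment> \<open>Membership in \<open>C n\<close> depends on the underlying multiset only, so
        either all orderings contribute to the sum or none does; a nonzero sum thus detects the
        preimage of B.\<close>
      have "permute_list p ?xs \<in> C (size (bag z)) \<longleftrightarrow> f z \<in> B" if p: "p permutes {..<length ?xs}" for p
        using z p unfolding C_def
        by (auto simp: space_exp_space space_seq_space mset_enum_mset length_enum_mset set_permute_list simp flip: set_mset_mset)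
      moreover have "\<exists>p. p permutes {..<length ?xs}" using permutes_id by blast
      ultimately show ?thesis
        by (simp add: perm_sum_def sum_eq_0_iff finite_permutations indicator_def)
    qed
    then show ?thesis by (auto split: if_splits)
  qed
  also have "\<dots> \<in> sets (exp_space X)" by measurable
  finally show "f -` B \<inter> space (exp_space X) \<in> sets (exp_space X)" .
qed

section \<open>Measurability of the multiset operations\<close>

lemma measurable_Ms_add_mset [measurable (raw)]:
  assumes [measurable]: "f \<in> M \<rightarrow>\<^sub>M X" "g \<in> M \<rightarrow>\<^sub>M exp_space X"
  shows "(\<lambda>z. Ms (add_mset (f z) (bag (g z)))) \<in> M \<rightarrow>\<^sub>M exp_space X"
proof (rule measurable_into_exp_space)
  show "Ms (add_mset (f z) (bag (g z))) \<in> space (exp_space X)" if "z \<in> space M" for z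
    using measurable_space[OF assms(1) that] measurable_space[OF assms(2) that] by (auto simp: space_exp_space)
  fix A assume [measurable]: "A \<in> sets X"
  note [measurable] = measurable_compose[OF assms(2) measurable_num_in[of A X]]
  have "(\<lambda>z. (if f z \<in> A then 1 else 0) + num_in A (g z)) \<in> M \<rightarrow>\<^sub>M count_space UNIV" by measurable
  moreover have "num_in A (Ms (add_mset (f z) (bag (g z)))) = (if f z \<in> A then 1 else 0) + num_in A (g z)" for z
    by simp
  ultimately show "(\<lambda>z. num_in A (Ms (add_mset (f z) (bag (g z))))) \<in> M \<rightarrow>\<^sub>M count_space UNIV" by (simp only:)
qed

lemma measurable_Ms_plus [measurable (raw)]:
  assumes [measurable]: "f \<in> M \<rightarrow>\<^sub>M exp_space X" "g \<in> M \<rightarrow>\<^sub>M exp_space X"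
  shows "(\<lambda>z. Ms (bag (f z) + bag (g z))) \<in> M \<rightarrow>\<^sub>M exp_space X"
proof (rule measurable_into_exp_space)
  show "Ms (bag (f z) + bag (g z)) \<in> space (exp_space X)" if "z \<in> space M" for z
    using measurable_space[OF assms(1) that] measurable_space[OF assms(2) that] by (auto simp: space_exp_space)
  fix A assume [measurable]: "A \<in> sets X"
  note [measurable] = measurable_compose[OF assms(2) measurable_num_in[of A X]]
    measurable_compose[OF assms(1) measurable_num_in[of A X]]
  have "(\<lambda>z. num_in A (f z) + num_in A (g z)) \<in> M \<rightarrow>\<^sub>M count_space UNIV" by measurable
  then show "(\<lambda>z. num_in A (Ms (bag (f z) + bag (g z)))) \<in> M \<rightarrow>\<^sub>M count_space UNIV" by simp
qed

lemma measurable_Ms_mset_plus: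
  assumes "f \<in> M \<rightarrow>\<^sub>M seq_space X m" "g \<in> M \<rightarrow>\<^sub>M seq_space X n"
  shows "(\<lambda>z. Ms (mset (f z) + mset (g z))) \<in> M \<rightarrow>\<^sub>M exp_space X"
  using measurable_Ms_plus[OF measurable_compose[OF assms(1) measurable_Ms_mset] measurable_compose[OF assms(2) measurable_Ms_mset]]
  by simp

text \<open>The points of the image in A are counted by the points of the original multiset in the
  preimage of A.\<close>

lemma measurable_Ms_image:
  assumes h: "h \<in> X \<rightarrow>\<^sub>M Y" and f: "f \<in> M \<rightarrow>\<^sub>M exp_space X"
  shows "(\<lambda>z. Ms (image_mset h (bag (f z)))) \<in> M \<rightarrow>\<^sub>M exp_space Y"
proof (rule measurable_into_exp_space)
  have sub: "set_mset (bag (f z)) \<subseteq> space X" if "z \<in> space M" for z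
    using measurable_space[OF f that] by (auto simp: space_exp_space)
  then show "Ms (image_mset h (bag (f z))) \<in> space (exp_space Y)" if "z \<in> space M" for z
    using measurable_space[OF h] that by auto
  fix A assume A: "A \<in> sets Y"
  have "num_in (h -` A \<inter> space X) (f z) = num_in A (Ms (image_mset h (bag (f z))))" if "z \<in> space M" for z
  proof -
    have "filter_mset (\<lambda>x. x \<in> h -` A \<inter> space X) (bag (f z)) = filter_mset (\<lambda>x. h x \<in> A) (bag (f z))"
      using sub[OF that] by (intro filter_mset_cong) auto
    then show ?thesis by (simp add: filter_mset_image_mset)
  qed
  then show "(\<lambda>z. num_in A (Ms (image_mset h (bag (f z))))) \<in> M \<rightarrow>\<^sub>M count_space UNIV"
    using measurable_compose[OF f measurable_num_in[OF measurable_sets[OF h A]]] by (simp cong: measurable_cong)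
qed

text \<open>Counting after flattening sums over the inner multisets, which is not a counting
  function of the outer one. The quotient description is used instead: on sequences of fixed length
  flattening is a repeated binary sum.\<close>

lemma measurable_flatten: "(\<lambda>z. Ms (sum_mset (image_mset bag (bag z)))) \<in> exp_space (exp_space X) \<rightarrow>\<^sub>M exp_space X"
proof (rule measurable_from_exp_space)
  fix n show "(\<lambda>xs. Ms (sum_mset (image_mset bag (bag (Ms (mset xs)))))) \<in> seq_space (exp_space X) n \<rightarrow>\<^sub>M exp_space X"
  proof (induction n)
    case 0
    have "(\<lambda>xs. Ms (sum_mset (image_mset bag (bag (Ms (mset xs)))))) \<in> seq_space (exp_space X) 0 \<rightarrow>\<^sub>M exp_space X
      \<longleftrightarrow> (\<lambda>xs. Ms {#}) \<in> seq_space (exp_space X) 0 \<rightarrow>\<^sub>M exp_space X"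
      by (rule measurable_cong) (simp add: space_seq_space)
    then show ?case by simp
  next
    case (Suc n)
    note [measurable] = measurable_compose[OF measurable_tl_seq Suc]
    have "(\<lambda>xs. Ms (sum_mset (image_mset bag (bag (Ms (mset xs)))))) \<in> seq_space (exp_space X) (Suc n) \<rightarrow>\<^sub>M exp_space X
      \<longleftrightarrow> (\<lambda>xs. Ms (bag (hd xs) + bag (Ms (sum_mset (image_mset bag (bag (Ms (mset (tl xs)))))))))
        \<in> seq_space (exp_space X) (Suc n) \<rightarrow>\<^sub>M exp_space X"
      by (rule measurable_cong) (auto simp: space_seq_space length_Suc_conv)
    also have "\<dots>" by measurable
    finally show ?case .
  qed
qed

section \<open>Powers of kernels\<close>

lemma sets_kernel_pow: "sets (kernel_pow Y \<kappa> xs) = sets (seq_space Y (length xs))"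
  by (cases xs) simp_all

lemma space_kernel_pow: "space (kernel_pow Y \<kappa> xs) = space (seq_space Y (length xs))"
  by (rule sets_eq_imp_space_eq[OF sets_kernel_pow])

text \<open>On sequences of length n + 1 the power is an image of the product of \<kappa> after
  \<open>hd\<close> and the lower power after \<open>tl\<close>.\<close>

lemma s_finite_kernel_pow:
  assumes \<kappa>: "s_finite_kernel X Y \<kappa>"
  shows "s_finite_kernel (seq_space X n) (seq_space Y n) (kernel_pow Y \<kappa>)"
proof (induction n)
  case 0
  have "s_finite_kernel (seq_space X 0) (seq_space Y 0) (\<lambda>_. return (seq_space Y 0) [])"
    by (intro s_finite_kernel_return measurable_const) (simp add: space_seq_space)
  then show ?case by (rule s_finite_kernel_cong) (simp add: space_seq_space)
next
  case (Suc n)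
  have "s_finite_kernel (seq_space X (Suc n)) (seq_space Y (Suc n))
    (\<lambda>xs. distr (\<kappa> (hd xs) \<Otimes>\<^sub>M kernel_pow Y \<kappa> (tl xs)) (seq_space Y (Suc n)) (\<lambda>(y, ys). y # ys))"
    by (intro s_finite_kernel_distr[where Y="Y \<Otimes>\<^sub>M seq_space Y n"] s_finite_kernel_pair
        s_finite_kernel_compose[OF \<kappa>] s_finite_kernel_compose[OF Suc]) measurable
  then show ?case by (rule s_finite_kernel_cong) (auto simp: space_seq_space length_Suc_conv)
qed

lemma s_finite_measure_kernel_pow:
  assumes "s_finite_kernel X Y \<kappa>" "set xs \<subseteq> space X"
  shows "s_finite_measure (kernel_pow Y \<kappa> xs)"
  using s_finite_kernel_s_finite_measure[OF s_finite_kernel_pow[OF assms(1)], of xs "length xs"] assms(2)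
  by (simp add: space_seq_space)

lemma nn_integral_kernel_pow_Nil:
  assumes "f \<in> borel_measurable (seq_space Y 0)"
  shows "(\<integral>\<^sup>+ ys. f ys \<partial>kernel_pow Y \<kappa> []) = f []"
  using assms by (simp add: nn_integral_return space_seq_space)

lemma nn_integral_kernel_pow_Cons:
  assumes \<kappa>: "s_finite_kernel X Y \<kappa>" and x: "x \<in> space X" and xs: "set xs \<subseteq> space X"
    and f[measurable]: "f \<in> borel_measurable (seq_space Y (Suc (length xs)))"
  shows "(\<integral>\<^sup>+ ys. f ys \<partial>kernel_pow Y \<kappa> (x # xs)) = (\<integral>\<^sup>+ y. \<integral>\<^sup>+ ys. f (y # ys) \<partial>kernel_pow Y \<kappa> xs \<partial>\<kappa> x)"
proof -
  note [measurable_cong] = s_finite_kernelD(2)[OF \<kappa> x] sets_kernel_pow[of Y \<kappa> xs]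
  have "(\<integral>\<^sup>+ ys. f ys \<partial>kernel_pow Y \<kappa> (x # xs)) = (\<integral>\<^sup>+ (y, ys). f (y # ys) \<partial>(\<kappa> x \<Otimes>\<^sub>M kernel_pow Y \<kappa> xs))"
    unfolding kernel_pow.simps by (subst nn_integral_distr) (simp_all add: case_prod_unfold)
  also have "\<dots> = (\<integral>\<^sup>+ y. \<integral>\<^sup>+ ys. f (y # ys) \<partial>kernel_pow Y \<kappa> xs \<partial>\<kappa> x)"
    by (subst nn_integral_pair_s_finite[OF s_finite_measure_kernel_pow[OF \<kappa> xs]]) simp_all
  finally show ?thesis .
qed

lemma nn_integral_kernel_pow_Cons_mset:
  assumes \<kappa>: "s_finite_kernel X Y \<kappa>" and x: "x \<in> space X" and xs: "set xs \<subseteq> space X"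
    and f[measurable]: "f \<in> borel_measurable (exp_space Y)"
  shows "(\<integral>\<^sup>+ ys. f (Ms (mset ys)) \<partial>kernel_pow Y \<kappa> (x # xs))
    = (\<integral>\<^sup>+ y. \<integral>\<^sup>+ ys. f (Ms (add_mset y (mset ys))) \<partial>kernel_pow Y \<kappa> xs \<partial>\<kappa> x)"
  by (subst nn_integral_kernel_pow_Cons[OF \<kappa> x xs]) simp_all

section \<open>Iterated integrals of symmetric functions\<close>

lemma Fubini_s_finite_sets:
  assumes "s_finite_measure M1" "s_finite_measure M2" "sets M1 = sets X" "sets M2 = sets Y"
    and "(\<lambda>(x, y). f x y) \<in> borel_measurable (X \<Otimes>\<^sub>M Y)"
  shows "(\<integral>\<^sup>+ x. \<integral>\<^sup>+ y. f x y \<partial>M2 \<partial>M1) = (\<integral>\<^sup>+ y. \<integral>\<^sup>+ x. f x y \<partial>M1 \<partial>M2)"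
  using assms by (intro Fubini_s_finite) (simp_all cong: measurable_cong_sets sets_pair_measure_cong)

lemma kernel_pow_measurable_nn_integral:
  assumes \<kappa>: "s_finite_kernel X Y \<kappa>" and xs: "set xs \<subseteq> space X"
    and f: "(\<lambda>(z, ys). f z ys) \<in> borel_measurable (Z \<Otimes>\<^sub>M seq_space Y (length xs))"
  shows "(\<lambda>z. \<integral>\<^sup>+ ys. f z ys \<partial>kernel_pow Y \<kappa> xs) \<in> borel_measurable Z"
  using f by (intro s_finite_measure_measurable_nn_integral[OF s_finite_measure_kernel_pow[OF \<kappa> xs]])
    (simp add: sets_kernel_pow cong: measurable_cong_sets sets_pair_measure_cong)

text \<open>Moving x past one entry is one application of Fubini. Reordering the arguments also
  reorders the resulting values, which is invisible because the integrand sees only their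
  multiset.\<close>

lemma nn_integral_kernel_pow_move:
  assumes \<kappa>: "s_finite_kernel X Y \<kappa>" and x: "x \<in> space X" and us: "set us \<subseteq> space X" and vs: "set vs \<subseteq> space X"
    and f: "f \<in> borel_measurable (exp_space Y)"
  shows "(\<integral>\<^sup>+ ys. f (Ms (mset ys)) \<partial>kernel_pow Y \<kappa> (us @ x # vs))
    = (\<integral>\<^sup>+ ys. f (Ms (mset ys)) \<partial>kernel_pow Y \<kappa> (x # us @ vs))"
  using us f
proof (induction us arbitrary: f)
  case Nil
  then show ?case by simp
next
  case (Cons u us)
  have u: "u \<in> space X" and us: "set us \<subseteq> space X" using Cons.prems by auto
  note [measurable] = Cons.prems(2)
  let ?f = "\<lambda>y y'. \<integral>\<^sup>+ ys. f (Ms (add_mset y (add_mset y' (mset ys)))) \<partial>kernel_pow Y \<kappa> (us @ vs)"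
  have meas: "(\<lambda>(y, y'). ?f y y') \<in> borel_measurable (Y \<Otimes>\<^sub>M Y)"
    unfolding case_prod_unfold
  proof (rule kernel_pow_measurable_nn_integral[OF \<kappa>])
    \<comment> \<open>The detour through \<open>bag (Ms _)\<close> gives the term the shape of
      \<open>measurable_Ms_add_mset\<close>.\<close>
    have "(\<lambda>p. f (Ms (add_mset (fst (fst p)) (bag (Ms (add_mset (snd (fst p)) (bag (Ms (mset (snd p))))))))))
      \<in> borel_measurable ((Y \<Otimes>\<^sub>M Y) \<Otimes>\<^sub>M seq_space Y (length (us @ vs)))" by measurable
    then show "(\<lambda>(p, ys). f (Ms (add_mset (fst p) (add_mset (snd p) (mset ys)))))
      \<in> borel_measurable ((Y \<Otimes>\<^sub>M Y) \<Otimes>\<^sub>M seq_space Y (length (us @ vs)))" by (simp add: case_prod_unfold)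
  qed (use us vs in auto)
  have "(\<integral>\<^sup>+ ys. f (Ms (mset ys)) \<partial>kernel_pow Y \<kappa> ((u # us) @ x # vs))
    = (\<integral>\<^sup>+ y. \<integral>\<^sup>+ ys. f (Ms (add_mset y (mset ys))) \<partial>kernel_pow Y \<kappa> (us @ x # vs) \<partial>\<kappa> u)"
    using nn_integral_kernel_pow_Cons_mset[OF \<kappa> u, of "us @ x # vs" f] us x vs by simp
  also have "\<dots> = (\<integral>\<^sup>+ y. \<integral>\<^sup>+ y'. ?f y y' \<partial>\<kappa> x \<partial>\<kappa> u)"
  proof (rule nn_integral_cong)
    fix y assume "y \<in> space (\<kappa> u)"
    then have y[measurable]: "y \<in> space Y" using s_finite_kernelD(3)[OF \<kappa> u] by simp
    let ?g = "\<lambda>z. f (Ms (add_mset y (bag z)))"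
    have g: "?g \<in> borel_measurable (exp_space Y)" by measurable
    show "(\<integral>\<^sup>+ ys. f (Ms (add_mset y (mset ys))) \<partial>kernel_pow Y \<kappa> (us @ x # vs)) = (\<integral>\<^sup>+ y'. ?f y y' \<partial>\<kappa> x)"
      using Cons.IH[OF us g] nn_integral_kernel_pow_Cons_mset[OF \<kappa> x _ g, of "us @ vs"] us vs by simp
  qed
  \<comment> \<open>Here x and u change places; the surrounding steps only peel off and restore list
    entries.\<close>
  also have "\<dots> = (\<integral>\<^sup>+ y'. \<integral>\<^sup>+ y. ?f y y' \<partial>\<kappa> u \<partial>\<kappa> x)"
    by (intro Fubini_s_finite_sets[OF _ _ _ _ meas] s_finite_kernel_s_finite_measure[OF \<kappa>] s_finite_kernelD(2)[OF \<kappa>] u x)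
  also have "\<dots> = (\<integral>\<^sup>+ y'. \<integral>\<^sup>+ ys. f (Ms (add_mset y' (mset ys))) \<partial>kernel_pow Y \<kappa> (u # us @ vs) \<partial>\<kappa> x)"
  proof (rule nn_integral_cong)
    fix y' assume "y' \<in> space (\<kappa> x)"
    then have y'[measurable]: "y' \<in> space Y" using s_finite_kernelD(3)[OF \<kappa> x] by simp
    let ?g = "\<lambda>z. f (Ms (add_mset y' (bag z)))"
    have g: "?g \<in> borel_measurable (exp_space Y)" by measurable
    show "(\<integral>\<^sup>+ y. ?f y y' \<partial>\<kappa> u) = (\<integral>\<^sup>+ ys. f (Ms (add_mset y' (mset ys))) \<partial>kernel_pow Y \<kappa> (u # us @ vs))"
      using nn_integral_kernel_pow_Cons_mset[OF \<kappa> u _ g, of "us @ vs"] us vs by (simp add: add_mset_commute)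
  qed
  also have "\<dots> = (\<integral>\<^sup>+ ys. f (Ms (mset ys)) \<partial>kernel_pow Y \<kappa> (x # u # us @ vs))"
    using nn_integral_kernel_pow_Cons_mset[OF \<kappa> x, of "u # us @ vs" f] us u vs by simp
  finally show ?case by simp
qed

text \<open>Justifies the arbitrary ordering in \<open>exp_kernel\<close>. The head of the first
  list is located in the second and brought to its front, and induction treats the tails.\<close>

lemma nn_integral_kernel_pow_mset_eq:
  assumes \<kappa>: "s_finite_kernel X Y \<kappa>" and "mset xs = mset xs'" "set xs \<subseteq> space X"
    and f: "f \<in> borel_measurable (exp_space Y)"
  shows "(\<integral>\<^sup>+ ys. f (Ms (mset ys)) \<partial>kernel_pow Y \<kappa> xs) = (\<integral>\<^sup>+ ys. f (Ms (mset ys)) \<partial>kernel_pow Y \<kappa> xs')"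
  using assms(2-)
proof (induction xs arbitrary: xs' f)
  case Nil
  then show ?case by simp
next
  case (Cons x xs)
  note [measurable] = Cons.prems(3)
  have "x \<in> set xs'" using Cons.prems(1) by (metis list.set_intros(1) set_mset_mset)
  then obtain us vs where xs': "xs' = us @ x # vs" by (auto simp: in_set_conv_decomp)
  have eq: "mset xs = mset (us @ vs)" using Cons.prems(1) xs' by simp
  have sub: "x \<in> space X" "set xs \<subseteq> space X" "set us \<subseteq> space X" "set vs \<subseteq> space X"
    using Cons.prems(2) mset_eq_setD[OF eq] by auto
  have "(\<integral>\<^sup>+ ys. f (Ms (mset ys)) \<partial>kernel_pow Y \<kappa> (x # xs))
      = (\<integral>\<^sup>+ y. \<integral>\<^sup>+ ys. f (Ms (add_mset y (mset ys))) \<partial>kernel_pow Y \<kappa> xs \<partial>\<kappa> x)"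
    using sub by (intro nn_integral_kernel_pow_Cons_mset[OF \<kappa>]) simp_all
  also have "\<dots> = (\<integral>\<^sup>+ y. \<integral>\<^sup>+ ys. f (Ms (add_mset y (mset ys))) \<partial>kernel_pow Y \<kappa> (us @ vs) \<partial>\<kappa> x)"
  proof (rule nn_integral_cong)
    fix y assume "y \<in> space (\<kappa> x)"
    then have y[measurable]: "y \<in> space Y" using s_finite_kernelD(3)[OF \<kappa> sub(1)] by simp
    have g: "(\<lambda>z. f (Ms (add_mset y (bag z)))) \<in> borel_measurable (exp_space Y)" by measurable
    show "(\<integral>\<^sup>+ ys. f (Ms (add_mset y (mset ys))) \<partial>kernel_pow Y \<kappa> xs) = (\<integral>\<^sup>+ ys. f (Ms (add_mset y (mset ys))) \<partial>kernel_pow Y \<kappa> (us @ vs))"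
      using Cons.IH[OF eq sub(2) g] by simp
  qed
  also have "\<dots> = (\<integral>\<^sup>+ ys. f (Ms (mset ys)) \<partial>kernel_pow Y \<kappa> (x # us @ vs))"
    using sub by (intro nn_integral_kernel_pow_Cons_mset[OF \<kappa>, symmetric]) simp_all
  also have "\<dots> = (\<integral>\<^sup>+ ys. f (Ms (mset ys)) \<partial>kernel_pow Y \<kappa> xs')"
    unfolding xs' using sub by (intro nn_integral_kernel_pow_move[OF \<kappa>, symmetric]) simp_all
  finally show ?case .
qed

text \<open>The power along a concatenation is an independent product of the two powers. This is the
  source of naturality of the contraction.\<close>

lemma nn_integral_kernel_pow_append:
  assumes \<kappa>: "s_finite_kernel X Y \<kappa>" and us: "set us \<subseteq> space X" and vs: "set vs \<subseteq> space X"
    and f: "f \<in> borel_measurable (exp_space Y)"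
  shows "(\<integral>\<^sup>+ ys. f (Ms (mset ys)) \<partial>kernel_pow Y \<kappa> (us @ vs))
    = (\<integral>\<^sup>+ ys. \<integral>\<^sup>+ zs. f (Ms (mset ys + mset zs)) \<partial>kernel_pow Y \<kappa> vs \<partial>kernel_pow Y \<kappa> us)"
  using us f
proof (induction us arbitrary: f)
  case Nil
  note [measurable] = Nil.prems(2)
  have "(\<lambda>ys. \<integral>\<^sup>+ zs. f (Ms (mset ys + mset zs)) \<partial>kernel_pow Y \<kappa> vs) \<in> borel_measurable (seq_space Y 0)"
    using vs by (intro kernel_pow_measurable_nn_integral[OF \<kappa>])
      (auto simp: case_prod_unfold intro!: measurable_compose[OF measurable_Ms_mset_plus Nil.prems(2)])
  then show ?case by (subst nn_integral_kernel_pow_Nil) simp_all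
next
  case (Cons u us)
  have u: "u \<in> space X" and us: "set us \<subseteq> space X" using Cons.prems by auto
  note [measurable] = Cons.prems(2)
  have meas: "(\<lambda>ys. \<integral>\<^sup>+ zs. f (Ms (mset ys + mset zs)) \<partial>kernel_pow Y \<kappa> vs) \<in> borel_measurable (seq_space Y (Suc (length us)))"
    using vs by (intro kernel_pow_measurable_nn_integral[OF \<kappa>])
      (auto simp: case_prod_unfold intro!: measurable_compose[OF measurable_Ms_mset_plus Cons.prems(2)])
  have "(\<integral>\<^sup>+ ys. f (Ms (mset ys)) \<partial>kernel_pow Y \<kappa> ((u # us) @ vs))
    = (\<integral>\<^sup>+ y. \<integral>\<^sup>+ ys. f (Ms (add_mset y (mset ys))) \<partial>kernel_pow Y \<kappa> (us @ vs) \<partial>\<kappa> u)"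
    using us vs u nn_integral_kernel_pow_Cons_mset[OF \<kappa> u, of "us @ vs" f] by simp
  also have "\<dots> = (\<integral>\<^sup>+ y. \<integral>\<^sup>+ ys. \<integral>\<^sup>+ zs. f (Ms (add_mset y (mset ys + mset zs))) \<partial>kernel_pow Y \<kappa> vs \<partial>kernel_pow Y \<kappa> us \<partial>\<kappa> u)"
  proof (rule nn_integral_cong)
    fix y assume "y \<in> space (\<kappa> u)"
    then have y[measurable]: "y \<in> space Y" using s_finite_kernelD(3)[OF \<kappa> u] by simp
    have g: "(\<lambda>z. f (Ms (add_mset y (bag z)))) \<in> borel_measurable (exp_space Y)" by measurable
    show "(\<integral>\<^sup>+ ys. f (Ms (add_mset y (mset ys))) \<partial>kernel_pow Y \<kappa> (us @ vs))
      = (\<integral>\<^sup>+ ys. \<integral>\<^sup>+ zs. f (Ms (add_mset y (mset ys + mset zs))) \<partial>kernel_pow Y \<kappa> vs \<partial>kernel_pow Y \<kappa> us)"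
      using Cons.IH[OF us g] by simp
  qed
  also have "\<dots> = (\<integral>\<^sup>+ ys. \<integral>\<^sup>+ zs. f (Ms (mset ys + mset zs)) \<partial>kernel_pow Y \<kappa> vs \<partial>kernel_pow Y \<kappa> (u # us))"
    by (subst nn_integral_kernel_pow_Cons[OF \<kappa> u us meas]) simp
  finally show ?case .
qed

text \<open>Functoriality of powers. Peeling off the head leaves the integral over the intermediate
  tail inside the one over the new head value, and Fubini has to exchange them.\<close>

lemma nn_integral_kernel_pow_mixture:
  assumes \<kappa>: "s_finite_kernel X Y \<kappa>" and \<iota>: "s_finite_kernel Y Z \<iota>" and xs: "set xs \<subseteq> space X"
    and f: "f \<in> borel_measurable (seq_space Z (length xs))"
  shows "(\<integral>\<^sup>+ zs. f zs \<partial>kernel_pow Z (\<lambda>x. mixture (\<kappa> x) Z \<iota>) xs)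
    = (\<integral>\<^sup>+ ys. \<integral>\<^sup>+ zs. f zs \<partial>kernel_pow Z \<iota> ys \<partial>kernel_pow Y \<kappa> xs)"
  using xs f
proof (induction xs arbitrary: f)
  case Nil
  have "(\<lambda>ys. \<integral>\<^sup>+ zs. f zs \<partial>kernel_pow Z \<iota> ys) \<in> borel_measurable (seq_space Y 0)"
    using Nil by (intro s_finite_kernel_measurable_nn_integral[OF s_finite_kernel_pow[OF \<iota>, of 0]]) simp_all
  then show ?case using Nil by (simp only: nn_integral_kernel_pow_Nil list.size)
next
  case (Cons x xs)
  have x: "x \<in> space X" and xs: "set xs \<subseteq> space X" using Cons.prems by auto
  note [measurable] = Cons.prems(2)[simplified]
  note mix = s_finite_kernel_mixture[OF \<kappa> \<iota>]
  let ?n = "length xs"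
  let ?f = "\<lambda>z ys. \<integral>\<^sup>+ zs. f (z # zs) \<partial>kernel_pow Z \<iota> ys"
  have meas: "(\<lambda>(z, ys). ?f z ys) \<in> borel_measurable (Z \<Otimes>\<^sub>M seq_space Y ?n)"
    unfolding case_prod_unfold
    by (intro s_finite_kernel_measurable_nn_integral[OF s_finite_kernel_pow[OF \<iota>, of ?n]]) (simp_all add: case_prod_unfold)
  have meas': "(\<lambda>ys. \<integral>\<^sup>+ zs. f zs \<partial>kernel_pow Z \<iota> ys) \<in> borel_measurable (seq_space Y (Suc ?n))"
    by (intro s_finite_kernel_measurable_nn_integral[OF s_finite_kernel_pow[OF \<iota>, of "Suc ?n"]]) simp_all
  have "(\<integral>\<^sup>+ zs. f zs \<partial>kernel_pow Z (\<lambda>x. mixture (\<kappa> x) Z \<iota>) (x # xs))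
    = (\<integral>\<^sup>+ z. \<integral>\<^sup>+ zs. f (z # zs) \<partial>kernel_pow Z (\<lambda>x. mixture (\<kappa> x) Z \<iota>) xs \<partial>mixture (\<kappa> x) Z \<iota>)"
    by (intro nn_integral_kernel_pow_Cons[OF mix x xs]) simp
  also have "\<dots> = (\<integral>\<^sup>+ z. \<integral>\<^sup>+ ys. ?f z ys \<partial>kernel_pow Y \<kappa> xs \<partial>mixture (\<kappa> x) Z \<iota>)"
    using xs by (intro nn_integral_cong Cons.IH) simp_all
  also have "\<dots> = (\<integral>\<^sup>+ y. \<integral>\<^sup>+ z. \<integral>\<^sup>+ ys. ?f z ys \<partial>kernel_pow Y \<kappa> xs \<partial>\<iota> y \<partial>\<kappa> x)"
  proof (rule nn_integral_mixture)
    show "(\<lambda>z. \<integral>\<^sup>+ ys. ?f z ys \<partial>kernel_pow Y \<kappa> xs) \<in> borel_measurable Z"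
      by (rule kernel_pow_measurable_nn_integral[OF \<kappa> xs meas])
    show "sets (\<iota> y) = sets Z" if "y \<in> space (\<kappa> x)" for y
      using s_finite_kernelD(2)[OF \<iota>] s_finite_kernelD(3)[OF \<kappa> x] that by simp
    show "(\<lambda>y. emeasure (\<iota> y) B) \<in> borel_measurable (\<kappa> x)" if "B \<in> sets Z" for B
      using transition_kernelD(3)[OF s_finite_kernelD(1)[OF \<iota>] that] s_finite_kernelD(2)[OF \<kappa> x]
      by (simp cong: measurable_cong_sets)
  qed
  \<comment> \<open>After this exchange the two inner integrals recombine into the power of \<iota>
    along \<open>y # ys\<close>.\<close>
  also have "\<dots> = (\<integral>\<^sup>+ y. \<integral>\<^sup>+ ys. \<integral>\<^sup>+ z. ?f z ys \<partial>\<iota> y \<partial>kernel_pow Y \<kappa> xs \<partial>\<kappa> x)"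
  proof (rule nn_integral_cong)
    fix y assume "y \<in> space (\<kappa> x)"
    then have y: "y \<in> space Y" using s_finite_kernelD(3)[OF \<kappa> x] by simp
    show "(\<integral>\<^sup>+ z. \<integral>\<^sup>+ ys. ?f z ys \<partial>kernel_pow Y \<kappa> xs \<partial>\<iota> y) = (\<integral>\<^sup>+ ys. \<integral>\<^sup>+ z. ?f z ys \<partial>\<iota> y \<partial>kernel_pow Y \<kappa> xs)"
      by (intro Fubini_s_finite_sets[OF s_finite_kernel_s_finite_measure[OF \<iota> y] s_finite_measure_kernel_pow[OF \<kappa> xs]
            s_finite_kernelD(2)[OF \<iota> y] sets_kernel_pow meas])
  qed
  also have "\<dots> = (\<integral>\<^sup>+ y. \<integral>\<^sup>+ ys. \<integral>\<^sup>+ zs. f zs \<partial>kernel_pow Z \<iota> (y # ys) \<partial>kernel_pow Y \<kappa> xs \<partial>\<kappa> x)"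
  proof (intro nn_integral_cong)
    fix y ys assume "y \<in> space (\<kappa> x)" "ys \<in> space (kernel_pow Y \<kappa> xs)"
    then have "y \<in> space Y" "set ys \<subseteq> space Y" "length ys = ?n"
      using s_finite_kernelD(3)[OF \<kappa> x] by (auto simp: space_kernel_pow space_seq_space)
    then show "(\<integral>\<^sup>+ z. ?f z ys \<partial>\<iota> y) = (\<integral>\<^sup>+ zs. f zs \<partial>kernel_pow Z \<iota> (y # ys))"
      by (intro nn_integral_kernel_pow_Cons[OF \<iota>, symmetric]) simp_all
  qed
  also have "\<dots> = (\<integral>\<^sup>+ ys. \<integral>\<^sup>+ zs. f zs \<partial>kernel_pow Z \<iota> ys \<partial>kernel_pow Y \<kappa> (x # xs))"
    by (rule nn_integral_kernel_pow_Cons[OF \<kappa> x xs meas', symmetric])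
  finally show ?case .
qed

lemma nn_integral_kernel_pow_return:
  assumes h: "h \<in> X \<rightarrow>\<^sub>M Y" and "set xs \<subseteq> space X" and "f \<in> borel_measurable (seq_space Y (length xs))"
  shows "(\<integral>\<^sup>+ ys. f ys \<partial>kernel_pow Y (\<lambda>x. return Y (h x)) xs) = f (map h xs)"
  using assms(2-)
proof (induction xs arbitrary: f)
  case Nil
  then show ?case by (simp only: nn_integral_kernel_pow_Nil list.size list.map)
next
  case (Cons x xs)
  note [measurable] = Cons.prems(2)[simplified]
  have x: "x \<in> space X" "h x \<in> space Y" and xs: "set xs \<subseteq> space X" "set (map h xs) \<subseteq> space Y"
    using Cons.prems measurable_space[OF h] by auto
  have "(\<integral>\<^sup>+ ys. f ys \<partial>kernel_pow Y (\<lambda>x. return Y (h x)) (x # xs))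
    = (\<integral>\<^sup>+ y. \<integral>\<^sup>+ ys. f (y # ys) \<partial>kernel_pow Y (\<lambda>x. return Y (h x)) xs \<partial>return Y (h x))"
    by (intro nn_integral_kernel_pow_Cons[OF s_finite_kernel_return[OF h]] x xs) simp
  also have "\<dots> = (\<integral>\<^sup>+ y. f (y # map h xs) \<partial>return Y (h x))"
    using xs by (intro nn_integral_cong Cons.IH) simp_all
  also have "\<dots> = f (map h (x # xs))"
  proof -
    have "(\<lambda>_. map h xs) \<in> Y \<rightarrow>\<^sub>M seq_space Y (length xs)"
      using xs by (intro measurable_const) (simp add: space_seq_space)
    then show ?thesis using x by (simp add: nn_integral_return)
  qed
  finally show ?case .
qed

section \<open>Arrows of the category of s-finite kernels\<close>

lemma sigma_in_measurable_spaces [simp]: "sigma \<Omega> A \<in> measurable_spaces"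
  unfolding measurable_spaces_def by (intro CollectI measure_eqI) (simp_all add: emeasure_sigma)

lemma prod_space_Obj [simp]: "prod_space X Y \<in> measurable_spaces"
  by (simp add: prod_space_def)

lemma exp_space_Obj [simp]: "exp_space X \<in> measurable_spaces"
  by (simp add: exp_space_def)

lemma one_space_Obj [simp]: "one_space \<in> measurable_spaces"
  by (simp add: one_space_def)

lemma space_one_space [simp]: "space one_space = {Star}"
  unfolding one_space_def by (rule space_measure_of) auto

abbreviation hom :: "'u univ measure \<Rightarrow> 'u univ measure \<Rightarrow> ('u univ, 'u univ) kernel set" where
  "hom \<equiv> Hom TsKer"

lemma hom_iff:
  "K \<in> hom X Y \<longleftrightarrow> src K = X \<and> tgt K = Y \<and> X \<in> measurable_spaces \<and> Y \<in> measurable_spaces \<and>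
     app K \<in> extensional (space X) \<and> s_finite_kernel X Y (app K)"
  by (cases K) (auto simp: TsKer_def)

lemma homD:
  assumes "K \<in> hom X Y"
  shows "src K = X" "tgt K = Y" "X \<in> measurable_spaces" "Y \<in> measurable_spaces"
    "app K \<in> extensional (space X)" "s_finite_kernel X Y (app K)"
    "x \<in> space X \<Longrightarrow> sets (app K x) = sets Y" "x \<in> space X \<Longrightarrow> space (app K x) = space Y"
    "x \<in> space X \<Longrightarrow> s_finite_measure (app K x)"
proof -
  show *: "src K = X" "tgt K = Y" "X \<in> measurable_spaces" "Y \<in> measurable_spaces"
    "app K \<in> extensional (space X)" "s_finite_kernel X Y (app K)"
    using assms by (auto simp: hom_iff)
  show "x \<in> space X \<Longrightarrow> sets (app K x) = sets Y" "x \<in> space X \<Longrightarrow> space (app K x) = space Y"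
    "x \<in> space X \<Longrightarrow> s_finite_measure (app K x)"
    using s_finite_kernelD[OF *(6)] s_finite_kernel_s_finite_measure[OF *(6)] by auto
qed

text \<open>Indicators among the test functions recover the measures, and extensionality fixes the
  map outside the source space. Allowing all test functions suits the integral formulas for
  composites and tensors.\<close>

lemma hom_eqI:
  assumes K: "K \<in> hom X Y" and L: "L \<in> hom X Y"
    and eq: "\<And>x f. x \<in> space X \<Longrightarrow> f \<in> borel_measurable Y \<Longrightarrow> (\<integral>\<^sup>+ y. f y \<partial>app K x) = (\<integral>\<^sup>+ y. f y \<partial>app L x)"
  shows "K = L"
proof (rule kernel.expand, intro conjI)
  show "app K = app L"
  proof (rule extensionalityI[OF homD(5)[OF K] homD(5)[OF L]])
    fix x assume x: "x \<in> space X"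
    show "app K x = app L x"
    proof (rule measure_eqI)
      fix A assume "A \<in> sets (app K x)"
      then have "A \<in> sets Y" using homD(7)[OF K x] by simp
      then show "emeasure (app K x) A = emeasure (app L x) A"
        using eq[OF x, of "indicator A"] homD(7)[OF K x] homD(7)[OF L x] by simp
    qed (simp add: homD(7)[OF K x] homD(7)[OF L x])
  qed
qed (simp_all add: homD(1,2)[OF K] homD(1,2)[OF L])

lemma hom_measurable_nn_integral:
  assumes "K \<in> hom X Y" "g \<in> Z \<rightarrow>\<^sub>M X" "(\<lambda>(z, y). f z y) \<in> borel_measurable (Z \<Otimes>\<^sub>M Y)"
  shows "(\<lambda>z. \<integral>\<^sup>+ y. f z y \<partial>app K (g z)) \<in> borel_measurable Z"
  by (rule s_finite_kernel_measurable_nn_integral[OF homD(6)[OF assms(1)] assms(2,3)])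

lemma hom_Fubini:
  assumes K: "K \<in> hom X Y" "x \<in> space X" and L: "L \<in> hom X' Y'" "x' \<in> space X'"
    and f: "(\<lambda>(y, y'). f y y') \<in> borel_measurable (Y \<Otimes>\<^sub>M Y')"
  shows "(\<integral>\<^sup>+ y. \<integral>\<^sup>+ y'. f y y' \<partial>app L x' \<partial>app K x) = (\<integral>\<^sup>+ y'. \<integral>\<^sup>+ y. f y y' \<partial>app K x \<partial>app L x')"
  by (rule Fubini_s_finite_sets[OF homD(9)[OF K] homD(9)[OF L] homD(7)[OF K] homD(7)[OF L] f])

lemma nn_integral_hom_cong:
  assumes "K \<in> hom X Y" "x \<in> space X" "\<And>y. y \<in> space Y \<Longrightarrow> f y = g y"
  shows "(\<integral>\<^sup>+ y. f y \<partial>app K x) = (\<integral>\<^sup>+ y. g y \<partial>app K x)"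
  using assms homD(8)[OF assms(1,2)] by (intro nn_integral_cong) simp

lemma dirac_kernel_hom [intro]:
  assumes "X \<in> measurable_spaces" "Y \<in> measurable_spaces" "g \<in> X \<rightarrow>\<^sub>M Y"
  shows "dirac_kernel X Y g \<in> hom X Y"
  using assms by (auto simp: hom_iff dirac_kernel_def intro: s_finite_kernel_cong[OF s_finite_kernel_return])

lemma nn_integral_dirac_kernel:
  assumes "g \<in> X \<rightarrow>\<^sub>M Y" "x \<in> space X" "f \<in> borel_measurable Y"
  shows "(\<integral>\<^sup>+ y. f y \<partial>app (dirac_kernel X Y g) x) = f (g x)"
  using assms measurable_space[OF assms(1,2)] by (simp add: dirac_kernel_def nn_integral_return)

lemma dirac_kernel_cong:
  "(\<And>x. x \<in> space X \<Longrightarrow> f x = g x) \<Longrightarrow> dirac_kernel X Y f = dirac_kernel X Y g"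
  by (auto simp: dirac_kernel_def restrict_def)

lemma kernel_comp_hom [intro]:
  assumes K: "K \<in> hom X Y" and L: "L \<in> hom Y Z"
  shows "kernel_comp L K \<in> hom X Z"
  using homD(1-4)[OF K] homD(1-4)[OF L] s_finite_kernel_mixture[OF homD(6)[OF K] homD(6)[OF L]]
  by (auto simp: hom_iff kernel_comp_def intro: s_finite_kernel_cong)

lemma nn_integral_kernel_comp:
  assumes K: "K \<in> hom X Y" and L: "L \<in> hom Y Z" and x: "x \<in> space X" and f: "f \<in> borel_measurable Z"
  shows "(\<integral>\<^sup>+ z. f z \<partial>app (kernel_comp L K) x) = (\<integral>\<^sup>+ y. \<integral>\<^sup>+ z. f z \<partial>app L y \<partial>app K x)"
proof -
  have "app (kernel_comp L K) x = mixture (app K x) Z (app L)"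
    using x homD(1,2)[OF K] homD(1,2)[OF L] by (simp add: kernel_comp_def)
  moreover have "(\<lambda>y. emeasure (app L y) B) \<in> borel_measurable (app K x)" if "B \<in> sets Z" for B
    using transition_kernelD(3)[OF s_finite_kernelD(1)[OF homD(6)[OF L]] that] homD(7)[OF K x]
    by (simp cong: measurable_cong_sets)
  moreover have "sets (app L y) = sets Z" if "y \<in> space (app K x)" for y
    using that homD(7)[OF L] homD(8)[OF K x] by simp
  ultimately show ?thesis using f by (simp only: nn_integral_mixture)
qed

text \<open>A point map after K acts on the integrand, and one before K
  (\<open>nn_integral_comp_dirac\<close>) on the point of evaluation, so structure maps add no
  integral to a composite.\<close>

lemma nn_integral_dirac_comp:
  fixes X Y Z :: "'u univ measure"
  assumes K: "K \<in> hom X Y" and g: "g \<in> Y \<rightarrow>\<^sub>M Z" and Z: "Z \<in> measurable_spaces"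
    and x: "x \<in> space X" and f: "f \<in> borel_measurable Z"
  shows "(\<integral>\<^sup>+ z. f z \<partial>app (kernel_comp (dirac_kernel Y Z g) K) x) = (\<integral>\<^sup>+ y. f (g y) \<partial>app K x)"
  by (subst nn_integral_kernel_comp[OF K dirac_kernel_hom[OF homD(4)[OF K] Z g] x f])
    (rule nn_integral_hom_cong[OF K x nn_integral_dirac_kernel[OF g _ f]])

lemma nn_integral_comp_dirac:
  fixes X Y W :: "'u univ measure"
  assumes K: "K \<in> hom X Y" and g: "g \<in> W \<rightarrow>\<^sub>M X" and W: "W \<in> measurable_spaces"
    and w: "w \<in> space W" and f: "f \<in> borel_measurable Y"
  shows "(\<integral>\<^sup>+ y. f y \<partial>app (kernel_comp K (dirac_kernel W X g)) w) = (\<integral>\<^sup>+ y. f y \<partial>app K (g w))"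
proof -
  have "(\<lambda>x. \<integral>\<^sup>+ y. f y \<partial>app K x) \<in> borel_measurable X"
    using f by (intro hom_measurable_nn_integral[OF K]) simp_all
  then show ?thesis
    by (simp add: nn_integral_kernel_comp[OF dirac_kernel_hom[OF W homD(3)[OF K] g] K w f] nn_integral_dirac_kernel[OF g w])
qed

lemma kernel_comp_dirac_dirac:
  fixes X Y Z :: "'u univ measure"
  assumes "X \<in> measurable_spaces" "Y \<in> measurable_spaces" "Z \<in> measurable_spaces"
    and f: "f \<in> X \<rightarrow>\<^sub>M Y" and g: "g \<in> Y \<rightarrow>\<^sub>M Z"
  shows "kernel_comp (dirac_kernel Y Z g) (dirac_kernel X Y f) = dirac_kernel X Z (\<lambda>x. g (f x))"
  by (rule hom_eqI[of _ X Z])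
    (use assms in \<open>auto simp: nn_integral_dirac_comp[OF dirac_kernel_hom] nn_integral_dirac_kernel\<close>)

lemma kernel_prod_hom [intro]:
  assumes K: "K \<in> hom X Y" and L: "L \<in> hom X' Y'"
  shows "kernel_prod K L \<in> hom (prod_space X X') (prod_space Y Y')"
proof -
  have "s_finite_kernel (prod_space X X') (prod_space Y Y')
    (\<lambda>x. distr (app K (pfst x) \<Otimes>\<^sub>M app L (psnd x)) (prod_space Y Y') (\<lambda>(y, y'). Pr y y'))"
    by (intro s_finite_kernel_distr[where Y="Y \<Otimes>\<^sub>M Y'"] s_finite_kernel_pair
        s_finite_kernel_compose[OF homD(6)[OF K]] s_finite_kernel_compose[OF homD(6)[OF L]]) measurable
  then show ?thesis
    using homD(1-4)[OF K] homD(1-4)[OF L] by (auto simp: hom_iff kernel_prod_def intro: s_finite_kernel_cong)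
qed

text \<open>K is outside and L inside, as in the definition of \<open>\<Otimes>\<^sub>M\<close>;
  laws exchanging the factors go through \<open>hom_Fubini\<close>.\<close>

lemma nn_integral_kernel_prod:
  assumes K: "K \<in> hom X Y" and L: "L \<in> hom X' Y'" and x: "x \<in> space X" "x' \<in> space X'"
    and f[measurable]: "f \<in> borel_measurable (prod_space Y Y')"
  shows "(\<integral>\<^sup>+ z. f z \<partial>app (kernel_prod K L) (Pr x x')) = (\<integral>\<^sup>+ y. \<integral>\<^sup>+ y'. f (Pr y y') \<partial>app L x' \<partial>app K x)"
proof -
  note [measurable_cong] = homD(7)[OF K x(1)] homD(7)[OF L x(2)]
  have "app (kernel_prod K L) (Pr x x') = distr (app K x \<Otimes>\<^sub>M app L x') (prod_space Y Y') (\<lambda>(y, y'). Pr y y')"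
    using x homD(1,2)[OF K] homD(1,2)[OF L] by (simp add: kernel_prod_def)
  then show ?thesis
    by (simp add: nn_integral_distr nn_integral_pair_s_finite[OF homD(9)[OF L x(2)]])
qed

lemma kernel_prod_dirac:
  fixes X Y X' Y' :: "'u univ measure"
  assumes "X \<in> measurable_spaces" "X' \<in> measurable_spaces" "Y \<in> measurable_spaces" "Y' \<in> measurable_spaces"
    and [measurable]: "g \<in> X \<rightarrow>\<^sub>M Y" "g' \<in> X' \<rightarrow>\<^sub>M Y'"
  shows "kernel_prod (dirac_kernel X Y g) (dirac_kernel X' Y' g')
    = dirac_kernel (prod_space X X') (prod_space Y Y') (\<lambda>z. Pr (g (pfst z)) (g' (psnd z)))"
proof (rule hom_eqI)
  show "kernel_prod (dirac_kernel X Y g) (dirac_kernel X' Y' g') \<in> hom (prod_space X X') (prod_space Y Y')"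
    using assms by blast
  show "dirac_kernel (prod_space X X') (prod_space Y Y') (\<lambda>z. Pr (g (pfst z)) (g' (psnd z))) \<in> hom (prod_space X X') (prod_space Y Y')"
    by (rule dirac_kernel_hom) simp_all
  fix z :: "'u univ" and f :: "'u univ \<Rightarrow> ennreal" assume z: "z \<in> space (prod_space X X')" and f[measurable]: "f \<in> borel_measurable (prod_space Y Y')"
  obtain x x' where x: "z = Pr x x'" "x \<in> space X" "x' \<in> space X'" using z by (rule prod_spaceE)
  have "(\<integral>\<^sup>+ y. f y \<partial>app (kernel_prod (dirac_kernel X Y g) (dirac_kernel X' Y' g')) z)
    = (\<integral>\<^sup>+ y. \<integral>\<^sup>+ y'. f (Pr y y') \<partial>app (dirac_kernel X' Y' g') x' \<partial>app (dirac_kernel X Y g) x)"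
    unfolding x(1) using assms x by (intro nn_integral_kernel_prod) auto
  also have "\<dots> = (\<integral>\<^sup>+ y. f (Pr y (g' x')) \<partial>app (dirac_kernel X Y g) x)"
    using assms x by (intro nn_integral_hom_cong[of _ X Y] nn_integral_dirac_kernel dirac_kernel_hom) simp_all
  also have "\<dots> = f (Pr (g x) (g' x'))"
    using assms x measurable_space[OF assms(6) x(3)] by (intro nn_integral_dirac_kernel) simp_all
  finally show "(\<integral>\<^sup>+ y. f y \<partial>app (kernel_prod (dirac_kernel X Y g) (dirac_kernel X' Y' g')) z)
    = (\<integral>\<^sup>+ y. f y \<partial>app (dirac_kernel (prod_space X X') (prod_space Y Y') (\<lambda>z. Pr (g (pfst z)) (g' (psnd z)))) z)"
    using x z by (subst nn_integral_dirac_kernel) simp_all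
qed

section \<open>Exponentials of kernels\<close>

lemma nn_integral_distr_mset:
  assumes "f \<in> borel_measurable (exp_space Y)"
  shows "(\<integral>\<^sup>+ z. f z \<partial>distr (kernel_pow Y \<kappa> xs) (exp_space Y) (\<lambda>ys. Ms (mset ys)))
    = (\<integral>\<^sup>+ ys. f (Ms (mset ys)) \<partial>kernel_pow Y \<kappa> xs)"
  using assms by (intro nn_integral_distr) (simp_all add: sets_kernel_pow cong: measurable_cong_sets)

lemma kernel_pow_finite_bound:
  assumes \<kappa>: "s_finite_kernel X Y \<kappa>" and b: "\<And>x. x \<in> space X \<Longrightarrow> emeasure (\<kappa> x) (space Y) \<le> b"
    and "set xs \<subseteq> space X"
  shows "emeasure (kernel_pow Y \<kappa> xs) (space (seq_space Y (length xs))) \<le> b ^ length xs"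
  using assms(3)
proof (induction xs)
  case Nil
  have "emeasure (return (seq_space Y 0) []) (space (seq_space Y 0)) \<le> 1"
    by (simp only: emeasure_return sets.top) (simp add: indicator_def)
  then show ?case by simp
next
  case (Cons x xs)
  then have x: "x \<in> space X" and xs: "set xs \<subseteq> space X" by auto
  have "emeasure (kernel_pow Y \<kappa> (x # xs)) (space (seq_space Y (length (x # xs)))) = (\<integral>\<^sup>+ ys. 1 \<partial>kernel_pow Y \<kappa> (x # xs))"
    by (simp add: space_kernel_pow)
  also have "\<dots> = (\<integral>\<^sup>+ y. \<integral>\<^sup>+ ys. 1 \<partial>kernel_pow Y \<kappa> xs \<partial>\<kappa> x)"
    by (rule nn_integral_kernel_pow_Cons[OF \<kappa> x xs]) simp
  also have "\<dots> = emeasure (kernel_pow Y \<kappa> xs) (space (seq_space Y (length xs))) * emeasure (\<kappa> x) (space Y)"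
    using s_finite_kernelD(3)[OF \<kappa> x] by (simp add: space_kernel_pow)
  also have "\<dots> \<le> b ^ length xs * b"
    using Cons.IH[OF xs] b[OF x] by (rule mult_mono) simp_all
  finally show ?case by (simp add: mult.commute)
qed

lemma s_finite_kernel_finite: "finite_kernel X Y \<kappa> \<Longrightarrow> s_finite_kernel X Y \<kappa>"
  by (rule s_finite_kernelI[where \<kappa>'="\<lambda>n. \<kappa>"])
    (simp_all add: approximates_def transition_kernelD(1)[OF finite_kernelD(1)])

lemma approximates_kernel_pow:
  assumes fin: "\<And>n. finite_kernel X Y (\<kappa>' n)" and appr: "\<And>x. x \<in> space X \<Longrightarrow> approximates (\<lambda>n. \<kappa>' n x) (\<kappa> x)"
    and "set xs \<subseteq> space X"
  shows "approximates (\<lambda>n. kernel_pow Y (\<kappa>' n) xs) (kernel_pow Y \<kappa> xs)"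
  using assms(3)
proof (induction xs)
  case Nil
  then show ?case by (simp add: approximates_def)
next
  case (Cons x xs)
  then have x: "x \<in> space X" and xs: "set xs \<subseteq> space X" by auto
  \<comment> \<open>\<open>approximates_pair\<close> asks for finite approximants in its second
    factor.\<close>
  have "finite_measure (kernel_pow Y (\<kappa>' n) xs)" for n
  proof
    obtain b where "\<forall>x\<in>space X. emeasure (\<kappa>' n x) (space Y) \<le> ennreal b"
      using finite_kernelD(2)[OF fin[of n]] by auto
    then have "emeasure (kernel_pow Y (\<kappa>' n) xs) (space (seq_space Y (length xs))) \<le> ennreal b ^ length xs"
      by (intro kernel_pow_finite_bound[OF s_finite_kernel_finite[OF fin] _ xs]) simp
    also have "\<dots> < top" by (simp add: power_less_top_ennreal)
    finally show "emeasure (kernel_pow Y (\<kappa>' n) xs) (space (kernel_pow Y (\<kappa>' n) xs)) \<noteq> \<infinity>"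
      by (simp add: space_kernel_pow)
  qed
  note pair = approximates_pair[OF appr[OF x] Cons.IH[OF xs] this]
  have "sets (\<kappa> x) = sets Y"
    using transition_kernelD(1)[OF finite_kernelD(1)[OF fin] x] approximatesD(1)[OF appr[OF x]] by metis
  note [measurable_cong] = this sets_kernel_pow
  show ?case unfolding kernel_pow.simps by (rule approximates_distr[OF pair]) measurable
qed

lemma exp_kernel_app:
  "z \<in> space (exp_space (src K)) \<Longrightarrow>
    app (exp_kernel K) z = distr (kernel_pow (tgt K) (app K) (enum_mset (bag z))) (exp_space (tgt K)) (\<lambda>ys. Ms (mset ys))"
  by (simp add: exp_kernel_def)

lemma set_enum_mset: "set (enum_mset M) = set_mset M"
  by (metis mset_enum_mset set_mset_mset)

text \<open>The chosen ordering is not visibly measurable in z. Pulled back to sequences it may be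
  replaced by the given list, since the integrand is symmetric, and powers are kernels
  there.\<close>

lemma emeasure_exp_kernel_measurable:
  assumes \<kappa>: "s_finite_kernel X Y \<kappa>" and B: "B \<in> sets (exp_space Y)"
  shows "(\<lambda>z. emeasure (distr (kernel_pow Y \<kappa> (enum_mset (bag z))) (exp_space Y) (\<lambda>ys. Ms (mset ys))) B)
    \<in> borel_measurable (exp_space X)" (is "(\<lambda>z. ?f z) \<in> _")
proof (rule measurable_from_exp_space)
  fix n
  note [measurable] = B
  have "(\<lambda>xs. \<integral>\<^sup>+ ys. indicator B (Ms (mset ys)) \<partial>kernel_pow Y \<kappa> xs) \<in> borel_measurable (seq_space X n)"
    by (intro s_finite_kernel_measurable_nn_integral[OF s_finite_kernel_pow[OF \<kappa>, of n]]) simp_all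
  moreover have "?f (Ms (mset xs)) = (\<integral>\<^sup>+ ys. indicator B (Ms (mset ys)) \<partial>kernel_pow Y \<kappa> xs)"
    if "xs \<in> space (seq_space X n)" for xs
  proof -
    have "?f (Ms (mset xs)) = (\<integral>\<^sup>+ z. indicator B z \<partial>distr (kernel_pow Y \<kappa> (enum_mset (mset xs))) (exp_space Y) (\<lambda>ys. Ms (mset ys)))"
      using B by simp
    also have "\<dots> = (\<integral>\<^sup>+ ys. indicator B (Ms (mset ys)) \<partial>kernel_pow Y \<kappa> (enum_mset (mset xs)))"
      by (rule nn_integral_distr_mset) simp
    also have "\<dots> = (\<integral>\<^sup>+ ys. indicator B (Ms (mset ys)) \<partial>kernel_pow Y \<kappa> xs)"
      using that by (intro nn_integral_kernel_pow_mset_eq[OF \<kappa>])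
        (simp_all add: mset_enum_mset set_enum_mset space_seq_space)
    finally show ?thesis .
  qed
  ultimately show "(\<lambda>xs. ?f (Ms (mset xs))) \<in> borel_measurable (seq_space X n)" by (simp cong: measurable_cong)
qed

lemma measurable_size_bag: "(\<lambda>z. size (bag z)) \<in> exp_space X \<rightarrow>\<^sub>M count_space UNIV"
proof (rule measurable_from_exp_space)
  fix n
  have "(\<lambda>xs. size (bag (Ms (mset xs)))) \<in> seq_space X n \<rightarrow>\<^sub>M count_space UNIV
    \<longleftrightarrow> (\<lambda>xs. n) \<in> seq_space X n \<rightarrow>\<^sub>M count_space UNIV"
    by (rule measurable_cong) (simp add: space_seq_space)
  then show "(\<lambda>xs. size (bag (Ms (mset xs)))) \<in> seq_space X n \<rightarrow>\<^sub>M count_space UNIV" by simp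
qed

text \<open>The approximating finite kernels of \<open>\<kappa>\<^sub>e\<close> are the exponentials of those of \<open>\<kappa>\<close>, cut off at
  multisets of size \<open>n\<close> because the bound \<open>b ^ m\<close> on the mass at size \<open>m\<close> is not uniform in \<open>m\<close>.\<close>

lemma s_finite_kernel_exp:
  assumes \<kappa>: "s_finite_kernel X Y \<kappa>"
  shows "s_finite_kernel (exp_space X) (exp_space Y)
    (\<lambda>z. distr (kernel_pow Y \<kappa> (enum_mset (bag z))) (exp_space Y) (\<lambda>ys. Ms (mset ys)))"
proof -
  obtain p where p: "\<And>n. finite_kernel X Y (p n)"
    and appr: "\<And>x. x \<in> space X \<Longrightarrow> approximates (\<lambda>n. p n x) (\<kappa> x)"
    using s_finite_kernel_approx[OF \<kappa>] by blast
  note [measurable_cong] = sets_kernel_pow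
  let ?d = "\<lambda>\<kappa> z. distr (kernel_pow Y \<kappa> (enum_mset (bag z))) (exp_space Y) (\<lambda>ys. Ms (mset ys))"
  define e where "e n z = (if size (bag z) \<le> n then ?d (p n) z else null_measure (exp_space Y))" for n z
  have sets_e: "sets (e n z) = sets (exp_space Y)" for n z by (simp add: e_def)
  have "finite_kernel (exp_space X) (exp_space Y) (e n)" for n
  proof -
    obtain b where b: "\<And>x. x \<in> space X \<Longrightarrow> emeasure (p n x) (space Y) \<le> ennreal b"
      using finite_kernelD(2)[OF p[of n]] by auto
    note [measurable] = emeasure_exp_kernel_measurable[OF s_finite_kernel_finite[OF p]] measurable_size_bag
    have "(\<lambda>z. emeasure (e n z) B) \<in> borel_measurable (exp_space X)" if [measurable]: "B \<in> sets (exp_space Y)" for B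
    proof -
      have "(\<lambda>z. if size (bag z) \<le> n then emeasure (?d (p n) z) B else 0) \<in> borel_measurable (exp_space X)"
        by measurable
      moreover have "emeasure (e n z) B = (if size (bag z) \<le> n then emeasure (?d (p n) z) B else 0)" for z
        by (simp add: e_def)
      ultimately show ?thesis by (simp only:)
    qed
    then have "transition_kernel (exp_space X) (exp_space Y) (e n)" by (simp add: transition_kernel_def sets_e)
    moreover have "emeasure (e n z) (space (exp_space Y)) \<le> max 1 (ennreal b) ^ n" if "z \<in> space (exp_space X)" for z
    proof (cases "size (bag z) \<le> n")
      case True
      let ?xs = "enum_mset (bag z)"
      have xs: "set ?xs \<subseteq> space X" using that by (auto simp: set_enum_mset space_exp_space)
      have "emeasure (e n z) (space (exp_space Y)) = emeasure (kernel_pow Y (p n) ?xs) (space (seq_space Y (length ?xs)))"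
      proof -
        have "(\<lambda>ys. Ms (mset ys)) -` space (exp_space Y) \<inter> space (kernel_pow Y (p n) ?xs) = space (seq_space Y (length ?xs))"
          by (auto simp: space_kernel_pow space_seq_space)
        then show ?thesis using True by (simp add: e_def emeasure_distr)
      qed
      also have "\<dots> \<le> ennreal b ^ length ?xs"
        by (rule kernel_pow_finite_bound[OF s_finite_kernel_finite[OF p] b xs])
      \<comment> \<open>Powers of b may decrease with the exponent; replacing b by its maximum with
        1 makes the bound at size n valid for all smaller sizes.\<close>
      also have "\<dots> \<le> max 1 (ennreal b) ^ length ?xs" by (intro power_mono) simp_all
      also have "\<dots> \<le> max 1 (ennreal b) ^ n"
        using True by (intro power_increasing) (simp_all add: length_enum_mset)
      finally show ?thesis .
    qed (simp add: e_def)
    ultimately show ?thesis by (rule finite_kernelI) (simp_all add: power_less_top_ennreal)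
  qed
  moreover have "approximates (\<lambda>n. e n z) (?d \<kappa> z)" if z: "z \<in> space (exp_space X)" for z
  proof -
    have "set (enum_mset (bag z)) \<subseteq> space X" using z by (auto simp: set_enum_mset space_exp_space)
    then have *: "approximates (\<lambda>n. ?d (p n) z) (?d \<kappa> z)"
      by (intro approximates_distr approximates_kernel_pow[OF p appr]) simp_all
    have "incseq (\<lambda>n. emeasure (e n z) B)" "(SUP n. emeasure (e n z) B) = emeasure (?d \<kappa> z) B"
      if B: "B \<in> sets (exp_space Y)" for B
    proof -
      have inc: "incseq (\<lambda>n. emeasure (?d (p n) z) B)" and sup: "(SUP n. emeasure (?d (p n) z) B) = emeasure (?d \<kappa> z) B"
        using approximatesD(3,4)[OF *, of B] B by simp_all
      have le: "emeasure (e n z) B \<le> emeasure (?d (p n) z) B" for n by (simp add: e_def)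
      show "incseq (\<lambda>n. emeasure (e n z) B)"
        using inc by (auto simp: incseq_def e_def)
      \<comment> \<open>Once the index reaches the size of the multiset, the cut-off no longer
        acts.\<close>
      have "emeasure (?d (p n) z) B \<le> emeasure (e (max n (size (bag z))) z) B" for n
        using incseqD[OF inc, of n "max n (size (bag z))"] by (simp add: e_def)
      then have "(SUP n. emeasure (?d (p n) z) B) \<le> (SUP n. emeasure (e n z) B)"
        by (intro SUP_mono) blast
      moreover have "(SUP n. emeasure (e n z) B) \<le> (SUP n. emeasure (?d (p n) z) B)"
        by (rule SUP_mono'[OF le])
      ultimately show "(SUP n. emeasure (e n z) B) = emeasure (?d \<kappa> z) B"
        unfolding sup[symmetric] by (rule order.antisym[rotated])
    qed
    then show ?thesis unfolding approximates_def by (simp add: sets_e)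
  qed
  ultimately show ?thesis by (intro s_finite_kernelI[where \<kappa>'=e]) simp_all
qed

lemma exp_kernel_hom [intro]:
  assumes "K \<in> hom X Y"
  shows "exp_kernel K \<in> hom (exp_space X) (exp_space Y)"
  using homD(1-4)[OF assms] s_finite_kernel_exp[OF homD(6)[OF assms]]
  by (auto simp: hom_iff exp_kernel_def intro: s_finite_kernel_cong)

text \<open>Releases the choice made in \<open>exp_kernel\<close>: any ordering of the multiset may
  be used, so that inductions can run on a convenient list.\<close>

lemma nn_integral_exp_kernel:
  assumes K: "K \<in> hom X Y" and xs: "set xs \<subseteq> space X" and f: "f \<in> borel_measurable (exp_space Y)"
  shows "(\<integral>\<^sup>+ z. f z \<partial>app (exp_kernel K) (Ms (mset xs))) = (\<integral>\<^sup>+ ys. f (Ms (mset ys)) \<partial>kernel_pow Y (app K) xs)"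
proof -
  have "(\<integral>\<^sup>+ z. f z \<partial>app (exp_kernel K) (Ms (mset xs)))
    = (\<integral>\<^sup>+ ys. f (Ms (mset ys)) \<partial>kernel_pow Y (app K) (enum_mset (mset xs)))"
    using homD(1,2)[OF K] xs f by (simp add: exp_kernel_app nn_integral_distr_mset)
  also have "\<dots> = (\<integral>\<^sup>+ ys. f (Ms (mset ys)) \<partial>kernel_pow Y (app K) xs)"
    using xs by (intro nn_integral_kernel_pow_mset_eq[OF homD(6)[OF K] _ _ f]) (simp_all add: mset_enum_mset set_enum_mset)
  finally show ?thesis .
qed

lemma kernel_pow_cong:
  "(\<And>x. x \<in> set xs \<Longrightarrow> \<kappa> x = \<kappa>' x) \<Longrightarrow> kernel_pow Y \<kappa> xs = kernel_pow Y \<kappa>' xs"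
  by (induction xs) simp_all

text \<open>Both sides reduce to iterated integrals along a list, where the claim is functoriality
  of powers.\<close>

lemma exp_kernel_comp:
  assumes K: "K \<in> hom X Y" and L: "L \<in> hom Y Z"
  shows "exp_kernel (kernel_comp L K) = kernel_comp (exp_kernel L) (exp_kernel K)"
proof (rule hom_eqI)
  show "exp_kernel (kernel_comp L K) \<in> hom (exp_space X) (exp_space Z)"
    "kernel_comp (exp_kernel L) (exp_kernel K) \<in> hom (exp_space X) (exp_space Z)" using K L by blast+
  fix z and f :: "_ \<Rightarrow> ennreal" assume z: "z \<in> space (exp_space X)" and f[measurable]: "f \<in> borel_measurable (exp_space Z)"
  obtain xs where xs: "z = Ms (mset xs)" "set xs \<subseteq> space X" using z by (rule exp_spaceE)
  note [measurable_cong] = sets_kernel_pow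
  have "(\<integral>\<^sup>+ z. f z \<partial>app (exp_kernel (kernel_comp L K)) z)
      = (\<integral>\<^sup>+ zs. f (Ms (mset zs)) \<partial>kernel_pow Z (app (kernel_comp L K)) xs)"
    unfolding xs(1) using K L by (intro nn_integral_exp_kernel[OF _ xs(2) f]) blast
  also have "kernel_pow Z (app (kernel_comp L K)) xs = kernel_pow Z (\<lambda>x. mixture (app K x) Z (app L)) xs"
    using xs(2) homD(1,2)[OF K] homD(1,2)[OF L] by (intro kernel_pow_cong) (auto simp: kernel_comp_def)
  also have "(\<integral>\<^sup>+ zs. f (Ms (mset zs)) \<partial>kernel_pow Z (\<lambda>x. mixture (app K x) Z (app L)) xs)
    = (\<integral>\<^sup>+ ys. \<integral>\<^sup>+ zs. f (Ms (mset zs)) \<partial>kernel_pow Z (app L) ys \<partial>kernel_pow Y (app K) xs)"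
    by (intro nn_integral_kernel_pow_mixture[OF homD(6)[OF K] homD(6)[OF L] xs(2)]) measurable
  also have "\<dots> = (\<integral>\<^sup>+ ys. \<integral>\<^sup>+ z. f z \<partial>app (exp_kernel L) (Ms (mset ys)) \<partial>kernel_pow Y (app K) xs)"
    by (intro nn_integral_cong nn_integral_exp_kernel[OF L _ f, symmetric]) (simp add: space_kernel_pow space_seq_space)
  also have "\<dots> = (\<integral>\<^sup>+ y. \<integral>\<^sup>+ z. f z \<partial>app (exp_kernel L) y \<partial>app (exp_kernel K) z)"
    unfolding xs(1) using L by (intro nn_integral_exp_kernel[OF K xs(2), symmetric] hom_measurable_nn_integral) auto
  also have "\<dots> = (\<integral>\<^sup>+ z. f z \<partial>app (kernel_comp (exp_kernel L) (exp_kernel K)) z)"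
    using K L z by (intro nn_integral_kernel_comp[symmetric]) auto
  finally show "(\<integral>\<^sup>+ z. f z \<partial>app (exp_kernel (kernel_comp L K)) z) = (\<integral>\<^sup>+ z. f z \<partial>app (kernel_comp (exp_kernel L) (exp_kernel K)) z)" .
qed

lemma exp_kernel_dirac:
  fixes X Y :: "'u univ measure"
  assumes "X \<in> measurable_spaces" "Y \<in> measurable_spaces" and h: "h \<in> X \<rightarrow>\<^sub>M Y"
  shows "exp_kernel (dirac_kernel X Y h) = dirac_kernel (exp_space X) (exp_space Y) (\<lambda>z. Ms (image_mset h (bag z)))"
proof (rule hom_eqI)
  have m: "(\<lambda>z. Ms (image_mset h (bag z))) \<in> exp_space X \<rightarrow>\<^sub>M exp_space Y" by (rule measurable_Ms_image[OF h]) simp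
  show "exp_kernel (dirac_kernel X Y h) \<in> hom (exp_space X) (exp_space Y)"
    "dirac_kernel (exp_space X) (exp_space Y) (\<lambda>z. Ms (image_mset h (bag z))) \<in> hom (exp_space X) (exp_space Y)"
    using assms m by auto
  fix z and f :: "_ \<Rightarrow> ennreal" assume z: "z \<in> space (exp_space X)" and f[measurable]: "f \<in> borel_measurable (exp_space Y)"
  obtain xs where xs: "z = Ms (mset xs)" "set xs \<subseteq> space X" using z by (rule exp_spaceE)
  have "(\<integral>\<^sup>+ z. f z \<partial>app (exp_kernel (dirac_kernel X Y h)) z)
      = (\<integral>\<^sup>+ zs. f (Ms (mset zs)) \<partial>kernel_pow Y (app (dirac_kernel X Y h)) xs)"
    unfolding xs(1) using assms by (intro nn_integral_exp_kernel[OF _ xs(2) f]) blast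
  also have "kernel_pow Y (app (dirac_kernel X Y h)) xs = kernel_pow Y (\<lambda>x. return Y (h x)) xs"
    using xs(2) by (intro kernel_pow_cong) (auto simp: dirac_kernel_def)
  also have "(\<integral>\<^sup>+ zs. f (Ms (mset zs)) \<partial>kernel_pow Y (\<lambda>x. return Y (h x)) xs) = f (Ms (mset (map h xs)))"
    by (rule nn_integral_kernel_pow_return[OF h xs(2)]) measurable
  also have "\<dots> = (\<integral>\<^sup>+ y. f y \<partial>app (dirac_kernel (exp_space X) (exp_space Y) (\<lambda>z. Ms (image_mset h (bag z)))) z)"
    using z by (simp add: nn_integral_dirac_kernel[OF m] xs(1))
  finally show "(\<integral>\<^sup>+ z. f z \<partial>app (exp_kernel (dirac_kernel X Y h)) z)
    = (\<integral>\<^sup>+ y. f y \<partial>app (dirac_kernel (exp_space X) (exp_space Y) (\<lambda>z. Ms (image_mset h (bag z)))) z)" .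
qed

text \<open>With \<open>ms_single\<close> and \<open>ms_flat\<close> this is the finite multiset
  monad on points, and \<open>ms_plus\<close> with the empty multiset is the free commutative
  monoid. The operations are kept opaque so that the axioms become rewriting in this
  algebra.\<close>

definition ms_map :: "('u univ \<Rightarrow> 'u univ) \<Rightarrow> 'u univ \<Rightarrow> 'u univ" where
  "ms_map h z = Ms (image_mset h (bag z))"

definition ms_flat :: "'u univ \<Rightarrow> 'u univ" where
  "ms_flat z = Ms (sum_mset (image_mset bag (bag z)))"

definition ms_single :: "'u univ \<Rightarrow> 'u univ" where
  "ms_single x = Ms {#x#}"

definition ms_plus :: "'u univ \<Rightarrow> 'u univ \<Rightarrow> 'u univ" where
  "ms_plus z w = Ms (bag z + bag w)"

lemmas ms_defs = ms_map_def ms_flat_def ms_single_def ms_plus_def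

lemma measurable_ms_map [measurable (raw)]:
  "h \<in> X \<rightarrow>\<^sub>M Y \<Longrightarrow> f \<in> M \<rightarrow>\<^sub>M exp_space X \<Longrightarrow> (\<lambda>z. ms_map h (f z)) \<in> M \<rightarrow>\<^sub>M exp_space Y"
  unfolding ms_map_def by (rule measurable_Ms_image)

lemma measurable_ms_map' [measurable (raw)]: "h \<in> X \<rightarrow>\<^sub>M Y \<Longrightarrow> ms_map h \<in> exp_space X \<rightarrow>\<^sub>M exp_space Y"
  using measurable_ms_map[of h X Y "\<lambda>z. z"] by simp

lemma measurable_ms_flat [measurable]: "ms_flat \<in> exp_space (exp_space X) \<rightarrow>\<^sub>M exp_space X"
  using measurable_flatten by (simp add: ms_flat_def[abs_def])

lemma measurable_ms_single [measurable]: "ms_single \<in> X \<rightarrow>\<^sub>M exp_space X"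
proof -
  have "(\<lambda>x. Ms (add_mset x (bag (Ms {#})))) \<in> X \<rightarrow>\<^sub>M exp_space X" by measurable
  then show ?thesis by (simp add: ms_single_def[abs_def])
qed

lemma measurable_ms_plus [measurable (raw)]:
  "f \<in> M \<rightarrow>\<^sub>M exp_space X \<Longrightarrow> g \<in> M \<rightarrow>\<^sub>M exp_space X \<Longrightarrow> (\<lambda>z. ms_plus (f z) (g z)) \<in> M \<rightarrow>\<^sub>M exp_space X"
  unfolding ms_plus_def by (rule measurable_Ms_plus)

section \<open>Structure maps as Dirac kernels of point maps\<close>

lemma storage_eq: "storage X = dirac_kernel (exp_space (exp_space X)) (exp_space X) ms_flat"
  by (simp add: storage_def ms_flat_def[abs_def])

lemma dereliction_eq: "dereliction X = dirac_kernel X (exp_space X) ms_single"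
  by (simp add: dereliction_def ms_single_def[abs_def])

lemma contraction_eq:
  "contraction X = dirac_kernel (prod_space (exp_space X) (exp_space X)) (exp_space X) (\<lambda>z. ms_plus (pfst z) (psnd z))"
  by (simp add: contraction_def ms_plus_def[abs_def])

lemma monoidal_map_eq:
  "monoidal_map X Y = dirac_kernel (exp_space (prod_space X Y)) (prod_space (exp_space X) (exp_space Y))
     (\<lambda>z. Pr (ms_map pfst z) (ms_map psnd z))"
  by (simp add: monoidal_map_def ms_map_def)

lemmas structure_maps = storage_eq dereliction_eq contraction_eq monoidal_map_eq weakening_def monoidal_unit_map_def

lemma exp_kernel_dirac_kernel:
  fixes X Y :: "'u univ measure"
  assumes "X \<in> measurable_spaces" "Y \<in> measurable_spaces" "h \<in> X \<rightarrow>\<^sub>M Y"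
  shows "exp_kernel (dirac_kernel X Y h) = dirac_kernel (exp_space X) (exp_space Y) (ms_map h)"
  using exp_kernel_dirac[OF assms] by (simp add: ms_map_def[abs_def])

section \<open>Laws of composition and tensor\<close>

lemma hom_measurable_nn_integral_const:
  assumes "K \<in> hom X Y" "f \<in> borel_measurable Y"
  shows "(\<lambda>x. \<integral>\<^sup>+ y. f y \<partial>app K x) \<in> borel_measurable X"
  using assms(2) by (intro hom_measurable_nn_integral[OF assms(1)]) simp_all

lemma kernel_comp_assoc:
  assumes K: "K \<in> hom X Y" and L: "L \<in> hom Y Z" and M: "M \<in> hom Z W"
  shows "kernel_comp (kernel_comp M L) K = kernel_comp M (kernel_comp L K)"
proof (rule hom_eqI)
  show "kernel_comp (kernel_comp M L) K \<in> hom X W" "kernel_comp M (kernel_comp L K) \<in> hom X W"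
    using K L M by blast+
  fix x and f :: "_ \<Rightarrow> ennreal" assume x: "x \<in> space X" and f: "f \<in> borel_measurable W"
  have "(\<integral>\<^sup>+ w. f w \<partial>app (kernel_comp (kernel_comp M L) K) x) = (\<integral>\<^sup>+ y. \<integral>\<^sup>+ w. f w \<partial>app (kernel_comp M L) y \<partial>app K x)"
    by (rule nn_integral_kernel_comp[OF K kernel_comp_hom[OF L M] x f])
  also have "\<dots> = (\<integral>\<^sup>+ y. \<integral>\<^sup>+ z. \<integral>\<^sup>+ w. f w \<partial>app M z \<partial>app L y \<partial>app K x)"
    by (rule nn_integral_hom_cong[OF K x nn_integral_kernel_comp[OF L M _ f]])
  also have "\<dots> = (\<integral>\<^sup>+ w. f w \<partial>app (kernel_comp M (kernel_comp L K)) x)"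
    by (simp add: nn_integral_kernel_comp[OF kernel_comp_hom[OF K L] M x f]
        nn_integral_kernel_comp[OF K L x hom_measurable_nn_integral_const[OF M f]])
  finally show "(\<integral>\<^sup>+ w. f w \<partial>app (kernel_comp (kernel_comp M L) K) x)
    = (\<integral>\<^sup>+ w. f w \<partial>app (kernel_comp M (kernel_comp L K)) x)" .
qed

lemma kernel_comp_idn_left: "K \<in> hom X Y \<Longrightarrow> kernel_comp (dirac_kernel Y Y (\<lambda>y. y)) K = K"
  by (rule hom_eqI[of _ X Y])
    (auto simp: nn_integral_dirac_comp homD(3,4) intro!: kernel_comp_hom dirac_kernel_hom)

lemma kernel_comp_idn_right: "K \<in> hom X Y \<Longrightarrow> kernel_comp K (dirac_kernel X X (\<lambda>y. y)) = K"
  by (rule hom_eqI[of _ X Y])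
    (auto simp: nn_integral_comp_dirac homD(3,4) intro!: kernel_comp_hom dirac_kernel_hom)

lemma nn_integral_kernel_prod_measurable:
  assumes L: "L \<in> hom X' Y'" and f[measurable]: "f \<in> borel_measurable (prod_space Y Y')"
    and x': "x' \<in> space X'"
  shows "(\<lambda>y. \<integral>\<^sup>+ y'. f (Pr y y') \<partial>app L x') \<in> borel_measurable Y"
  using x' by (intro hom_measurable_nn_integral[OF L, of "\<lambda>_. x'"]) simp_all

text \<open>One side integrates over the first component completely before the second, the other
  performs both first stages before both second stages. The difference is a single exchange of
  integrals.\<close>

lemma kernel_prod_comp:
  assumes K: "K \<in> hom X Y" and K': "K' \<in> hom X' Y'" and L: "L \<in> hom Y Z" and L': "L' \<in> hom Y' Z'"
  shows "kernel_prod (kernel_comp L K) (kernel_comp L' K') = kernel_comp (kernel_prod L L') (kernel_prod K K')"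
proof (rule hom_eqI)
  show "kernel_prod (kernel_comp L K) (kernel_comp L' K') \<in> hom (prod_space X X') (prod_space Z Z')"
    "kernel_comp (kernel_prod L L') (kernel_prod K K') \<in> hom (prod_space X X') (prod_space Z Z')"
    using K K' L L' by blast+
  fix x and f :: "_ \<Rightarrow> ennreal"
  assume "x \<in> space (prod_space X X')" and f[measurable]: "f \<in> borel_measurable (prod_space Z Z')"
  then obtain a b where x: "x = Pr a b" and a: "a \<in> space X" and b: "b \<in> space X'" by (elim prod_spaceE)
  let ?g = "\<lambda>z y'. \<integral>\<^sup>+ z'. f (Pr z z') \<partial>app L' y'"
  have g: "(\<lambda>(z, y'). ?g z y') \<in> borel_measurable (Z \<Otimes>\<^sub>M Y')"
    unfolding case_prod_unfold by (rule hom_measurable_nn_integral[OF L']) (simp_all add: case_prod_unfold)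
  have "(\<integral>\<^sup>+ w. f w \<partial>app (kernel_prod (kernel_comp L K) (kernel_comp L' K')) x)
    = (\<integral>\<^sup>+ z. \<integral>\<^sup>+ z'. f (Pr z z') \<partial>app (kernel_comp L' K') b \<partial>app (kernel_comp L K) a)"
    unfolding x by (rule nn_integral_kernel_prod[OF kernel_comp_hom[OF K L] kernel_comp_hom[OF K' L'] a b f])
  also have "\<dots> = (\<integral>\<^sup>+ y. \<integral>\<^sup>+ z. \<integral>\<^sup>+ z'. f (Pr z z') \<partial>app (kernel_comp L' K') b \<partial>app L y \<partial>app K a)"
    by (rule nn_integral_kernel_comp[OF K L a nn_integral_kernel_prod_measurable[OF kernel_comp_hom[OF K' L'] f b]])
  also have "\<dots> = (\<integral>\<^sup>+ y. \<integral>\<^sup>+ z. \<integral>\<^sup>+ y'. ?g z y' \<partial>app K' b \<partial>app L y \<partial>app K a)"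
    by (intro nn_integral_hom_cong[OF K a] nn_integral_hom_cong[OF L] nn_integral_kernel_comp[OF K' L' b]) simp_all
  \<comment> \<open>The second stage of the first component moves past the first stage of the second
    component.\<close>
  also have "\<dots> = (\<integral>\<^sup>+ y. \<integral>\<^sup>+ y'. \<integral>\<^sup>+ z. ?g z y' \<partial>app L y \<partial>app K' b \<partial>app K a)"
    by (intro nn_integral_hom_cong[OF K a] hom_Fubini[OF L _ K' b g])
  also have "\<dots> = (\<integral>\<^sup>+ y. \<integral>\<^sup>+ y'. \<integral>\<^sup>+ w. f w \<partial>app (kernel_prod L L') (Pr y y') \<partial>app K' b \<partial>app K a)"
    by (intro nn_integral_hom_cong[OF K a] nn_integral_hom_cong[OF K' b] nn_integral_kernel_prod[OF L L' _ _ f, symmetric])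
  also have "\<dots> = (\<integral>\<^sup>+ y. \<integral>\<^sup>+ w. f w \<partial>app (kernel_prod L L') y \<partial>app (kernel_prod K K') x)"
    unfolding x by (rule nn_integral_kernel_prod[OF K K' a b hom_measurable_nn_integral_const[OF kernel_prod_hom[OF L L'] f], symmetric])
  also have "\<dots> = (\<integral>\<^sup>+ w. f w \<partial>app (kernel_comp (kernel_prod L L') (kernel_prod K K')) x)"
    unfolding x using a b by (intro nn_integral_kernel_comp[OF kernel_prod_hom[OF K K'] kernel_prod_hom[OF L L'] _ f, symmetric]) simp
  finally show "(\<integral>\<^sup>+ w. f w \<partial>app (kernel_prod (kernel_comp L K) (kernel_comp L' K')) x)
    = (\<integral>\<^sup>+ w. f w \<partial>app (kernel_comp (kernel_prod L L') (kernel_prod K K')) x)" .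
qed

section \<open>Naturality of the inverse structure isomorphisms\<close>

abbreviation assoc_map :: "'u univ \<Rightarrow> 'u univ" where
  "assoc_map z \<equiv> Pr (pfst (pfst z)) (Pr (psnd (pfst z)) (psnd z))"

abbreviation unassoc_map :: "'u univ \<Rightarrow> 'u univ" where
  "unassoc_map z \<equiv> Pr (Pr (pfst z) (pfst (psnd z))) (psnd (psnd z))"

abbreviation swap_map :: "'u univ \<Rightarrow> 'u univ" where
  "swap_map z \<equiv> Pr (psnd z) (pfst z)"

text \<open>Stated for the inverse reassociation because this is the associator of the opposite
  category. Both sides are the same triple integral, so no exchange occurs.\<close>

lemma unassoc_natural:
  assumes K: "K \<in> hom X X'" and L: "L \<in> hom Y Y'" and M: "M \<in> hom Z Z'"
  shows "kernel_comp (kernel_prod (kernel_prod K L) M)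
      (dirac_kernel (prod_space X (prod_space Y Z)) (prod_space (prod_space X Y) Z) unassoc_map)
    = kernel_comp (dirac_kernel (prod_space X' (prod_space Y' Z')) (prod_space (prod_space X' Y') Z') unassoc_map)
      (kernel_prod K (kernel_prod L M))" (is "kernel_comp ?P ?a = kernel_comp ?a' ?Q")
proof (rule hom_eqI)
  let ?X = "prod_space X (prod_space Y Z)" and ?X' = "prod_space (prod_space X' Y') Z'"
  have P: "?P \<in> hom (prod_space (prod_space X Y) Z) ?X'" and Q: "?Q \<in> hom ?X (prod_space X' (prod_space Y' Z'))"
    using K L M by blast+
  show "kernel_comp ?P ?a \<in> hom ?X ?X'" "kernel_comp ?a' ?Q \<in> hom ?X ?X'"
    by (rule kernel_comp_hom[OF _ P] kernel_comp_hom[OF Q]; rule dirac_kernel_hom; simp)+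
  fix w and f :: "_ \<Rightarrow> ennreal"
  assume w: "w \<in> space ?X" and f[measurable]: "f \<in> borel_measurable ?X'"
  then obtain x y z where w_eq: "w = Pr x (Pr y z)" and x: "x \<in> space X" and y: "y \<in> space Y" and z: "z \<in> space Z"
    by (auto elim!: prod_spaceE)
  have xy: "Pr x y \<in> space (prod_space X Y)" and yz: "Pr y z \<in> space (prod_space Y Z)" using x y z by simp_all
  have "(\<integral>\<^sup>+ u. f u \<partial>app (kernel_comp ?P ?a) w) = (\<integral>\<^sup>+ u. f u \<partial>app ?P (Pr (Pr x y) z))"
    by (subst nn_integral_comp_dirac[OF P _ _ w f]) (simp_all add: w_eq)
  also have "\<dots> = (\<integral>\<^sup>+ v. \<integral>\<^sup>+ z'. f (Pr v z') \<partial>app M z \<partial>app (kernel_prod K L) (Pr x y))"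
    by (rule nn_integral_kernel_prod[OF kernel_prod_hom[OF K L] M xy z f])
  also have "\<dots> = (\<integral>\<^sup>+ x'. \<integral>\<^sup>+ y'. \<integral>\<^sup>+ z'. f (Pr (Pr x' y') z') \<partial>app M z \<partial>app L y \<partial>app K x)"
    by (rule nn_integral_kernel_prod[OF K L x y nn_integral_kernel_prod_measurable[OF M f z]])
  also have "\<dots> = (\<integral>\<^sup>+ x'. \<integral>\<^sup>+ v. f (unassoc_map (Pr x' v)) \<partial>app (kernel_prod L M) (Pr y z) \<partial>app K x)"
    by (intro nn_integral_hom_cong[OF K x]) (subst nn_integral_kernel_prod[OF L M y z]; simp)
  also have "\<dots> = (\<integral>\<^sup>+ u. f (unassoc_map u) \<partial>app ?Q w)"
    unfolding w_eq by (rule nn_integral_kernel_prod[OF K kernel_prod_hom[OF L M] x yz, symmetric]) simp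
  also have "\<dots> = (\<integral>\<^sup>+ u. f u \<partial>app (kernel_comp ?a' ?Q) w)"
    by (subst nn_integral_dirac_comp[OF Q _ _ w f]) simp_all
  finally show "(\<integral>\<^sup>+ u. f u \<partial>app (kernel_comp ?P ?a) w) = (\<integral>\<^sup>+ u. f u \<partial>app (kernel_comp ?a' ?Q) w)" .
qed

text \<open>The symmetry reverses the order of integration, so its naturality is Fubini's
  theorem.\<close>

lemma swap_natural:
  assumes K: "K \<in> hom X X'" and L: "L \<in> hom Y Y'"
  shows "kernel_comp (kernel_prod K L) (dirac_kernel (prod_space Y X) (prod_space X Y) swap_map)
    = kernel_comp (dirac_kernel (prod_space Y' X') (prod_space X' Y') swap_map) (kernel_prod L K)"
    (is "kernel_comp ?P ?a = kernel_comp ?a' ?Q")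
proof (rule hom_eqI)
  note P = kernel_prod_hom[OF K L] and Q = kernel_prod_hom[OF L K]
  show "kernel_comp ?P ?a \<in> hom (prod_space Y X) (prod_space X' Y')"
    "kernel_comp ?a' ?Q \<in> hom (prod_space Y X) (prod_space X' Y')"
    by (rule kernel_comp_hom[OF _ P] kernel_comp_hom[OF Q]; rule dirac_kernel_hom; simp)+
  fix w and f :: "_ \<Rightarrow> ennreal"
  assume w: "w \<in> space (prod_space Y X)" and f[measurable]: "f \<in> borel_measurable (prod_space X' Y')"
  then obtain x y where w_eq: "w = Pr y x" and x: "x \<in> space X" and y: "y \<in> space Y"
    by (auto elim!: prod_spaceE)
  have "(\<integral>\<^sup>+ u. f u \<partial>app (kernel_comp ?P ?a) w) = (\<integral>\<^sup>+ u. f u \<partial>app ?P (Pr x y))"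
    by (subst nn_integral_comp_dirac[OF P _ _ w f]) (simp_all add: w_eq)
  also have "\<dots> = (\<integral>\<^sup>+ x'. \<integral>\<^sup>+ y'. f (Pr x' y') \<partial>app L y \<partial>app K x)"
    by (rule nn_integral_kernel_prod[OF K L x y f])
  also have "\<dots> = (\<integral>\<^sup>+ y'. \<integral>\<^sup>+ x'. f (Pr x' y') \<partial>app K x \<partial>app L y)"
    by (rule hom_Fubini[OF K x L y]) simp
  also have "\<dots> = (\<integral>\<^sup>+ u. f (swap_map u) \<partial>app ?Q w)"
    unfolding w_eq by (subst nn_integral_kernel_prod[OF L K y x]) simp_all
  also have "\<dots> = (\<integral>\<^sup>+ u. f u \<partial>app (kernel_comp ?a' ?Q) w)"
    by (subst nn_integral_dirac_comp[OF Q _ _ w f]) simp_all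
  finally show "(\<integral>\<^sup>+ u. f u \<partial>app (kernel_comp ?P ?a) w) = (\<integral>\<^sup>+ u. f u \<partial>app (kernel_comp ?a' ?Q) w)" .
qed

abbreviation idn :: "'u univ measure \<Rightarrow> ('u univ, 'u univ) kernel" where
  "idn X \<equiv> dirac_kernel X X (\<lambda>x. x)"

text \<open>The unitor of the opposite category inserts the point \<open>Star\<close> instead of
  deleting it.\<close>

lemma lunit_natural:
  assumes K: "K \<in> hom X X'"
  shows "kernel_comp (kernel_prod (idn one_space) K) (dirac_kernel X (prod_space one_space X) (Pr Star))
    = kernel_comp (dirac_kernel X' (prod_space one_space X') (Pr Star)) K" (is "kernel_comp ?P ?a = kernel_comp ?a' K")
proof (rule hom_eqI)
  have I: "idn one_space \<in> hom one_space one_space" by (rule dirac_kernel_hom) simp_all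
  note P = kernel_prod_hom[OF I K]
  show "kernel_comp ?P ?a \<in> hom X (prod_space one_space X')" "kernel_comp ?a' K \<in> hom X (prod_space one_space X')"
    by (rule kernel_comp_hom[OF _ P] kernel_comp_hom[OF K]; rule dirac_kernel_hom; simp add: homD(3,4)[OF K])+
  fix x and f :: "_ \<Rightarrow> ennreal"
  assume x: "x \<in> space X" and f[measurable]: "f \<in> borel_measurable (prod_space one_space X')"
  have "(\<integral>\<^sup>+ u. f u \<partial>app (kernel_comp ?P ?a) x) = (\<integral>\<^sup>+ u. f u \<partial>app ?P (Pr Star x))"
    by (subst nn_integral_comp_dirac[OF P _ homD(3)[OF K] x f]) simp_all
  also have "\<dots> = (\<integral>\<^sup>+ i. \<integral>\<^sup>+ y. f (Pr i y) \<partial>app K x \<partial>app (idn one_space) Star)"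
    using x by (intro nn_integral_kernel_prod[OF I K _ _ f]) simp_all
  also have "\<dots> = (\<integral>\<^sup>+ y. f (Pr Star y) \<partial>app K x)"
    by (rule nn_integral_dirac_kernel) (simp_all add: nn_integral_kernel_prod_measurable[OF K f x])
  also have "\<dots> = (\<integral>\<^sup>+ u. f u \<partial>app (kernel_comp ?a' K) x)"
    by (subst nn_integral_dirac_comp[OF K _ _ x f]) simp_all
  finally show "(\<integral>\<^sup>+ u. f u \<partial>app (kernel_comp ?P ?a) x) = (\<integral>\<^sup>+ u. f u \<partial>app (kernel_comp ?a' K) x)" .
qed

lemma runit_natural:
  assumes K: "K \<in> hom X X'"
  shows "kernel_comp (kernel_prod K (idn one_space)) (dirac_kernel X (prod_space X one_space) (\<lambda>x. Pr x Star))
    = kernel_comp (dirac_kernel X' (prod_space X' one_space) (\<lambda>x. Pr x Star)) K" (is "kernel_comp ?P ?a = kernel_comp ?a' K")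
proof (rule hom_eqI)
  have I: "idn one_space \<in> hom one_space one_space" by (rule dirac_kernel_hom) simp_all
  note P = kernel_prod_hom[OF K I]
  show "kernel_comp ?P ?a \<in> hom X (prod_space X' one_space)" "kernel_comp ?a' K \<in> hom X (prod_space X' one_space)"
    by (rule kernel_comp_hom[OF _ P] kernel_comp_hom[OF K]; rule dirac_kernel_hom; simp add: homD(3,4)[OF K])+
  fix x and f :: "_ \<Rightarrow> ennreal"
  assume x: "x \<in> space X" and f[measurable]: "f \<in> borel_measurable (prod_space X' one_space)"
  have "(\<integral>\<^sup>+ u. f u \<partial>app (kernel_comp ?P ?a) x) = (\<integral>\<^sup>+ u. f u \<partial>app ?P (Pr x Star))"
    by (subst nn_integral_comp_dirac[OF P _ homD(3)[OF K] x f]) simp_all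
  also have "\<dots> = (\<integral>\<^sup>+ y. \<integral>\<^sup>+ i. f (Pr y i) \<partial>app (idn one_space) Star \<partial>app K x)"
    using x by (intro nn_integral_kernel_prod[OF K I _ _ f]) simp_all
  also have "\<dots> = (\<integral>\<^sup>+ y. f (Pr y Star) \<partial>app K x)"
    by (intro nn_integral_hom_cong[OF K x] nn_integral_dirac_kernel) simp_all
  also have "\<dots> = (\<integral>\<^sup>+ u. f u \<partial>app (kernel_comp ?a' K) x)"
    by (subst nn_integral_dirac_comp[OF K _ _ x f]) simp_all
  finally show "(\<integral>\<^sup>+ u. f u \<partial>app (kernel_comp ?P ?a) x) = (\<integral>\<^sup>+ u. f u \<partial>app (kernel_comp ?a' K) x)" .
qed

section \<open>Naturality of the structure maps of the exponential\<close>

lemma structure_homs: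
  assumes "X \<in> measurable_spaces"
  shows "storage X \<in> hom (exp_space (exp_space X)) (exp_space X)"
    "dereliction X \<in> hom X (exp_space X)"
    "contraction X \<in> hom (prod_space (exp_space X) (exp_space X)) (exp_space X)"
    "weakening X \<in> hom one_space (exp_space X)"
    "monoidal_map X Y \<in> hom (exp_space (prod_space X Y)) (prod_space (exp_space X) (exp_space Y))"
  unfolding structure_maps by (rule dirac_kernel_hom; simp add: assms)+

lemma monoidal_unit_map_hom: "monoidal_unit_map \<in> hom (exp_space one_space) one_space"
  unfolding structure_maps by (rule dirac_kernel_hom) simp_all

text \<open>The empty power of a kernel is the Dirac measure at the empty list.\<close>

lemma weakening_natural:
  assumes K: "K \<in> hom X Y"
  shows "kernel_comp (exp_kernel K) (weakening X) = weakening Y"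
proof (rule hom_eqI)
  note W = structure_homs(4)[OF homD(4)[OF K]]
  show "kernel_comp (exp_kernel K) (weakening X) \<in> hom one_space (exp_space Y)" "weakening Y \<in> hom one_space (exp_space Y)"
    using kernel_comp_hom[OF structure_homs(4)[OF homD(3)[OF K]] exp_kernel_hom[OF K]] W by auto
  fix x :: "'a univ" and f :: "_ \<Rightarrow> ennreal" assume x: "x \<in> space one_space" and f[measurable]: "f \<in> borel_measurable (exp_space Y)"
  have "(\<integral>\<^sup>+ z. f z \<partial>app (kernel_comp (exp_kernel K) (weakening X)) x) = (\<integral>\<^sup>+ z. f z \<partial>app (exp_kernel K) (Ms (mset [])))"
    unfolding weakening_def by (subst nn_integral_comp_dirac[OF exp_kernel_hom[OF K] _ _ x f]) simp_all
  also have "\<dots> = (\<integral>\<^sup>+ ys. f (Ms (mset ys)) \<partial>kernel_pow Y (app K) [])"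
    by (rule nn_integral_exp_kernel[OF K _ f]) simp
  also have "\<dots> = f (Ms (mset []))"
    by (rule nn_integral_kernel_pow_Nil) simp
  also have "\<dots> = (\<integral>\<^sup>+ z. f z \<partial>app (weakening Y) x)"
    unfolding weakening_def using x by (subst nn_integral_dirac_kernel) simp_all
  finally show "(\<integral>\<^sup>+ z. f z \<partial>app (kernel_comp (exp_kernel K) (weakening X)) x) = (\<integral>\<^sup>+ z. f z \<partial>app (weakening Y) x)" .
qed

text \<open>Powers along a one-element list reproduce the kernel itself.\<close>

lemma dereliction_natural:
  assumes K: "K \<in> hom X Y"
  shows "kernel_comp (exp_kernel K) (dereliction X) = kernel_comp (dereliction Y) K"
proof (rule hom_eqI)
  show "kernel_comp (exp_kernel K) (dereliction X) \<in> hom X (exp_space Y)" "kernel_comp (dereliction Y) K \<in> hom X (exp_space Y)"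
    using kernel_comp_hom[OF structure_homs(2)[OF homD(3)[OF K]] exp_kernel_hom[OF K]]
      kernel_comp_hom[OF K structure_homs(2)[OF homD(4)[OF K]]] by auto
  fix x and f :: "_ \<Rightarrow> ennreal" assume x: "x \<in> space X" and f[measurable]: "f \<in> borel_measurable (exp_space Y)"
  note [measurable_cong] = homD(7)[OF K x]
  have "(\<integral>\<^sup>+ z. f z \<partial>app (kernel_comp (exp_kernel K) (dereliction X)) x) = (\<integral>\<^sup>+ z. f z \<partial>app (exp_kernel K) (Ms (mset [x])))"
    unfolding dereliction_eq
    by (subst nn_integral_comp_dirac[OF exp_kernel_hom[OF K] _ homD(3)[OF K] x f]) (simp_all add: ms_single_def)
  also have "\<dots> = (\<integral>\<^sup>+ ys. f (Ms (mset ys)) \<partial>kernel_pow Y (app K) [x])"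
    using x by (intro nn_integral_exp_kernel[OF K _ f]) simp
  also have "\<dots> = (\<integral>\<^sup>+ y. \<integral>\<^sup>+ ys. f (Ms (mset (y # ys))) \<partial>kernel_pow Y (app K) [] \<partial>app K x)"
    using x by (intro nn_integral_kernel_pow_Cons[OF homD(6)[OF K]]) simp_all
  also have "\<dots> = (\<integral>\<^sup>+ y. f (ms_single y) \<partial>app K x)"
  proof (rule nn_integral_hom_cong[OF K x])
    fix y assume [measurable]: "y \<in> space Y"
    show "(\<integral>\<^sup>+ ys. f (Ms (mset (y # ys))) \<partial>kernel_pow Y (app K) []) = f (ms_single y)"
    proof (subst nn_integral_kernel_pow_Nil)
      show "(\<lambda>ys. f (Ms (mset (y # ys)))) \<in> borel_measurable (seq_space Y 0)" by measurable
    qed (simp add: ms_single_def)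
  qed
  also have "\<dots> = (\<integral>\<^sup>+ z. f z \<partial>app (kernel_comp (dereliction Y) K) x)"
    unfolding dereliction_eq by (subst nn_integral_dirac_comp[OF K _ _ x f]) simp_all
  finally show "(\<integral>\<^sup>+ z. f z \<partial>app (kernel_comp (exp_kernel K) (dereliction X)) x)
    = (\<integral>\<^sup>+ z. f z \<partial>app (kernel_comp (dereliction Y) K) x)" .
qed

text \<open>The exponential kernel sends a sum of multisets to the convolution of the two measures
  with respect to multiset addition. Both the contraction and, by iteration, the storage rely on
  this.\<close>

lemma nn_integral_exp_kernel_plus:
  assumes K: "K \<in> hom X Y" and us: "set us \<subseteq> space X" and vs: "set vs \<subseteq> space X"
    and f[measurable]: "f \<in> borel_measurable (exp_space Y)"
  shows "(\<integral>\<^sup>+ a. \<integral>\<^sup>+ b. f (ms_plus a b) \<partial>app (exp_kernel K) (Ms (mset vs)) \<partial>app (exp_kernel K) (Ms (mset us)))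
    = (\<integral>\<^sup>+ ys. f (Ms (mset ys)) \<partial>kernel_pow Y (app K) (us @ vs))"
proof -
  note E = exp_kernel_hom[OF K]
  have "(\<integral>\<^sup>+ a. \<integral>\<^sup>+ b. f (ms_plus a b) \<partial>app (exp_kernel K) (Ms (mset vs)) \<partial>app (exp_kernel K) (Ms (mset us)))
    = (\<integral>\<^sup>+ a. \<integral>\<^sup>+ zs. f (ms_plus a (Ms (mset zs))) \<partial>kernel_pow Y (app K) vs \<partial>app (exp_kernel K) (Ms (mset us)))"
    using us by (intro nn_integral_hom_cong[OF E] nn_integral_exp_kernel[OF K vs]) simp_all
  also have "\<dots> = (\<integral>\<^sup>+ ys. \<integral>\<^sup>+ zs. f (ms_plus (Ms (mset ys)) (Ms (mset zs))) \<partial>kernel_pow Y (app K) vs \<partial>kernel_pow Y (app K) us)"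
    by (intro nn_integral_exp_kernel[OF K us] kernel_pow_measurable_nn_integral[OF homD(6)[OF K] vs])
      (simp add: case_prod_unfold)
  also have "\<dots> = (\<integral>\<^sup>+ ys. f (Ms (mset ys)) \<partial>kernel_pow Y (app K) (us @ vs))"
    using nn_integral_kernel_pow_append[OF homD(6)[OF K] us vs f] by (simp add: ms_plus_def)
  finally show ?thesis .
qed

lemma contraction_natural:
  assumes K: "K \<in> hom X Y"
  shows "kernel_comp (exp_kernel K) (contraction X) = kernel_comp (contraction Y) (kernel_prod (exp_kernel K) (exp_kernel K))"
proof (rule hom_eqI)
  note E = exp_kernel_hom[OF K]
  note P = kernel_prod_hom[OF E E]
  let ?X = "prod_space (exp_space X) (exp_space X)"
  show "kernel_comp (exp_kernel K) (contraction X) \<in> hom ?X (exp_space Y)"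
    "kernel_comp (contraction Y) (kernel_prod (exp_kernel K) (exp_kernel K)) \<in> hom ?X (exp_space Y)"
    using kernel_comp_hom[OF structure_homs(3)[OF homD(3)[OF K]] E] kernel_comp_hom[OF P structure_homs(3)[OF homD(4)[OF K]]] by auto
  fix z and f :: "_ \<Rightarrow> ennreal" assume z: "z \<in> space ?X" and f[measurable]: "f \<in> borel_measurable (exp_space Y)"
  then obtain us vs where zeq: "z = Pr (Ms (mset us)) (Ms (mset vs))" and us: "set us \<subseteq> space X" and vs: "set vs \<subseteq> space X"
    by (auto elim!: prod_spaceE exp_spaceE)
  have "(\<integral>\<^sup>+ y. f y \<partial>app (kernel_comp (exp_kernel K) (contraction X)) z) = (\<integral>\<^sup>+ y. f y \<partial>app (exp_kernel K) (Ms (mset (us @ vs))))"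
    unfolding contraction_eq by (subst nn_integral_comp_dirac[OF E _ _ z f]) (simp_all add: zeq ms_plus_def)
  also have "\<dots> = (\<integral>\<^sup>+ ys. f (Ms (mset ys)) \<partial>kernel_pow Y (app K) (us @ vs))"
    using us vs by (intro nn_integral_exp_kernel[OF K _ f]) simp
  also have "\<dots> = (\<integral>\<^sup>+ a. \<integral>\<^sup>+ b. f (ms_plus a b) \<partial>app (exp_kernel K) (Ms (mset vs)) \<partial>app (exp_kernel K) (Ms (mset us)))"
    by (rule nn_integral_exp_kernel_plus[OF K us vs f, symmetric])
  also have "\<dots> = (\<integral>\<^sup>+ u. f (ms_plus (pfst u) (psnd u)) \<partial>app (kernel_prod (exp_kernel K) (exp_kernel K)) z)"
    unfolding zeq using us vs by (subst nn_integral_kernel_prod[OF E E]) simp_all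
  also have "\<dots> = (\<integral>\<^sup>+ y. f y \<partial>app (kernel_comp (contraction Y) (kernel_prod (exp_kernel K) (exp_kernel K))) z)"
    unfolding contraction_eq by (subst nn_integral_dirac_comp[OF P _ _ z f]) simp_all
  finally show "(\<integral>\<^sup>+ y. f y \<partial>app (kernel_comp (exp_kernel K) (contraction X)) z)
    = (\<integral>\<^sup>+ y. f y \<partial>app (kernel_comp (contraction Y) (kernel_prod (exp_kernel K) (exp_kernel K))) z)" .
qed

text \<open>Induction on the list of lists: each inner list contributes one convolution
  factor.\<close>

lemma nn_integral_kernel_pow_flat:
  assumes K: "K \<in> hom X Y" and "\<And>xs. xs \<in> set xss \<Longrightarrow> set xs \<subseteq> space X" and "f \<in> borel_measurable (exp_space Y)"
  shows "(\<integral>\<^sup>+ zs. f (ms_flat (Ms (mset zs))) \<partial>kernel_pow (exp_space Y) (app (exp_kernel K)) (map (\<lambda>xs. Ms (mset xs)) xss))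
    = (\<integral>\<^sup>+ ys. f (Ms (mset ys)) \<partial>kernel_pow Y (app K) (concat xss))"
  using assms(2-)
proof (induction xss arbitrary: f)
  case Nil
  note [measurable] = Nil.prems(2)
  show ?case by (simp only: list.map concat.simps nn_integral_kernel_pow_Nil, subst (1 2) nn_integral_kernel_pow_Nil)
      (simp_all add: ms_flat_def[of "Ms {#}"])
next
  case (Cons us xss)
  note [measurable] = Cons.prems(2)
  have us: "set us \<subseteq> space X" and xss: "\<And>xs. xs \<in> set xss \<Longrightarrow> set xs \<subseteq> space X" using Cons.prems by auto
  then have xss': "set (concat xss) \<subseteq> space X" by auto
  note E = exp_kernel_hom[OF K]
  have us': "Ms (mset us) \<in> space (exp_space X)" using us by simp
  have "(\<integral>\<^sup>+ zs. f (ms_flat (Ms (mset zs))) \<partial>kernel_pow (exp_space Y) (app (exp_kernel K)) (map (\<lambda>xs. Ms (mset xs)) (us # xss)))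
    = (\<integral>\<^sup>+ a. \<integral>\<^sup>+ zs. f (ms_flat (Ms (mset (a # zs)))) \<partial>kernel_pow (exp_space Y) (app (exp_kernel K)) (map (\<lambda>xs. Ms (mset xs)) xss)
        \<partial>app (exp_kernel K) (Ms (mset us)))"
    using us xss unfolding list.map by (intro nn_integral_kernel_pow_Cons[OF homD(6)[OF E]]) auto
  also have "\<dots> = (\<integral>\<^sup>+ a. \<integral>\<^sup>+ zs. f (ms_plus a (ms_flat (Ms (mset zs)))) \<partial>kernel_pow (exp_space Y) (app (exp_kernel K)) (map (\<lambda>xs. Ms (mset xs)) xss)
        \<partial>app (exp_kernel K) (Ms (mset us)))"
    by (simp add: ms_flat_def ms_plus_def)
  also have "\<dots> = (\<integral>\<^sup>+ a. \<integral>\<^sup>+ b. f (ms_plus a b) \<partial>app (exp_kernel K) (Ms (mset (concat xss))) \<partial>app (exp_kernel K) (Ms (mset us)))"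
  proof (rule nn_integral_hom_cong[OF E us'])
    fix a assume [measurable]: "a \<in> space (exp_space Y)"
    have g: "(\<lambda>b. f (ms_plus a b)) \<in> borel_measurable (exp_space Y)" by measurable
    show "(\<integral>\<^sup>+ zs. f (ms_plus a (ms_flat (Ms (mset zs)))) \<partial>kernel_pow (exp_space Y) (app (exp_kernel K)) (map (\<lambda>xs. Ms (mset xs)) xss))
      = (\<integral>\<^sup>+ b. f (ms_plus a b) \<partial>app (exp_kernel K) (Ms (mset (concat xss))))"
      unfolding nn_integral_exp_kernel[OF K xss' g] using xss by (intro Cons.IH[OF _ g])
  qed
  also have "\<dots> = (\<integral>\<^sup>+ ys. f (Ms (mset ys)) \<partial>kernel_pow Y (app K) (us @ concat xss))"
    by (rule nn_integral_exp_kernel_plus[OF K us xss' Cons.prems(2)])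
  finally show ?case by simp
qed

text \<open>Orders the outer multiset and each inner one, so that flattening becomes
  \<open>concat\<close>.\<close>

lemma exp_exp_spaceE:
  assumes "z \<in> space (exp_space (exp_space X))"
  obtains xss where "z = Ms (mset (map (\<lambda>xs. Ms (mset xs)) xss))" "\<forall>xs\<in>set xss. set xs \<subseteq> space X"
proof -
  obtain zs where z: "z = Ms (mset zs)" and zs: "set zs \<subseteq> space (exp_space X)"
    using assms by (rule exp_spaceE)
  have "\<exists>xss. zs = map (\<lambda>xs. Ms (mset xs)) xss \<and> (\<forall>xs\<in>set xss. set xs \<subseteq> space X)"
    using zs
  proof (induction zs)
    case (Cons a zs)
    obtain xs where "a = Ms (mset xs)" "set xs \<subseteq> space X" using Cons.prems by (auto elim!: exp_spaceE)
    moreover obtain xss where "zs = map (\<lambda>xs. Ms (mset xs)) xss \<and> (\<forall>xs\<in>set xss. set xs \<subseteq> space X)"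
      using Cons by auto
    ultimately show ?case by (intro exI[of _ "xs # xss"]) simp
  qed simp
  then show thesis using that z by blast
qed

lemma storage_natural:
  assumes K: "K \<in> hom X Y"
  shows "kernel_comp (exp_kernel K) (storage X) = kernel_comp (storage Y) (exp_kernel (exp_kernel K))"
proof (rule hom_eqI)
  note E = exp_kernel_hom[OF K]
  note EE = exp_kernel_hom[OF E]
  let ?X = "exp_space (exp_space X)"
  show "kernel_comp (exp_kernel K) (storage X) \<in> hom ?X (exp_space Y)"
    "kernel_comp (storage Y) (exp_kernel (exp_kernel K)) \<in> hom ?X (exp_space Y)"
    using kernel_comp_hom[OF structure_homs(1)[OF homD(3)[OF K]] E] kernel_comp_hom[OF EE structure_homs(1)[OF homD(4)[OF K]]] by auto
  fix z and f :: "_ \<Rightarrow> ennreal" assume z: "z \<in> space ?X" and f[measurable]: "f \<in> borel_measurable (exp_space Y)"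
  obtain xss where zeq: "z = Ms (mset (map (\<lambda>xs. Ms (mset xs)) xss))" and xss: "\<forall>xs\<in>set xss. set xs \<subseteq> space X"
    using exp_exp_spaceE[OF z] .
  have "ms_flat z = Ms (mset (concat xss))"
    unfolding zeq ms_flat_def by (induction xss) simp_all
  then have "(\<integral>\<^sup>+ y. f y \<partial>app (kernel_comp (exp_kernel K) (storage X)) z) = (\<integral>\<^sup>+ y. f y \<partial>app (exp_kernel K) (Ms (mset (concat xss))))"
    unfolding storage_eq by (subst nn_integral_comp_dirac[OF E _ _ z f]) simp_all
  also have "\<dots> = (\<integral>\<^sup>+ ys. f (Ms (mset ys)) \<partial>kernel_pow Y (app K) (concat xss))"
    using xss by (intro nn_integral_exp_kernel[OF K _ f]) auto
  also have "\<dots> = (\<integral>\<^sup>+ zs. f (ms_flat (Ms (mset zs))) \<partial>kernel_pow (exp_space Y) (app (exp_kernel K)) (map (\<lambda>xs. Ms (mset xs)) xss))"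
    using xss by (intro nn_integral_kernel_pow_flat[OF K _ f, symmetric]) simp
  also have "\<dots> = (\<integral>\<^sup>+ u. f (ms_flat u) \<partial>app (exp_kernel (exp_kernel K)) z)"
    unfolding zeq using xss by (intro nn_integral_exp_kernel[OF E, symmetric]) auto
  also have "\<dots> = (\<integral>\<^sup>+ y. f y \<partial>app (kernel_comp (storage Y) (exp_kernel (exp_kernel K))) z)"
    unfolding storage_eq by (subst nn_integral_dirac_comp[OF EE _ _ z f]) simp_all
  finally show "(\<integral>\<^sup>+ y. f y \<partial>app (kernel_comp (exp_kernel K) (storage X)) z)
    = (\<integral>\<^sup>+ y. f y \<partial>app (kernel_comp (storage Y) (exp_kernel (exp_kernel K))) z)" .
qed

text \<open>Drawing pairs entry by entry amounts to drawing the first components along one list and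
  the second ones along the other. Arbitrary f keeps the induction going when the drawn head is
  absorbed into the integrand.\<close>

lemma nn_integral_kernel_pow_unzip:
  assumes K: "K \<in> hom X Y" and L: "L \<in> hom X' Y'" and "set zs \<subseteq> space (prod_space X X')"
    and "(\<lambda>(a, b). f a b) \<in> borel_measurable (exp_space Y \<Otimes>\<^sub>M exp_space Y')"
  shows "(\<integral>\<^sup>+ ws. f (Ms (mset (map pfst ws))) (Ms (mset (map psnd ws))) \<partial>kernel_pow (prod_space Y Y') (app (kernel_prod K L)) zs)
    = (\<integral>\<^sup>+ us. \<integral>\<^sup>+ vs. f (Ms (mset us)) (Ms (mset vs)) \<partial>kernel_pow Y' (app L) (map psnd zs) \<partial>kernel_pow Y (app K) (map pfst zs))"
  using assms(3-)
proof (induction zs arbitrary: f)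
  case Nil
  note [measurable] = Nil.prems(2)
  have "(\<lambda>ws. f (ms_map pfst (Ms (mset ws))) (ms_map psnd (Ms (mset ws)))) \<in> borel_measurable (seq_space (prod_space Y Y') 0)"
    by measurable
  then have "(\<lambda>ws. f (Ms (mset (map pfst ws))) (Ms (mset (map psnd ws)))) \<in> borel_measurable (seq_space (prod_space Y Y') 0)"
    by (simp add: ms_map_def)
  moreover have "(\<lambda>us. \<integral>\<^sup>+ vs. f (Ms (mset us)) (Ms (mset vs)) \<partial>kernel_pow Y' (app L) []) \<in> borel_measurable (seq_space Y 0)"
    by (intro kernel_pow_measurable_nn_integral[OF homD(6)[OF L]]) (simp_all add: case_prod_unfold)
  moreover have "(\<lambda>vs. f (Ms (mset [])) (Ms (mset vs))) \<in> borel_measurable (seq_space Y' 0)" by simp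
  ultimately show ?case by (simp only: list.map nn_integral_kernel_pow_Nil)
next
  case (Cons z zs)
  note [measurable] = Cons.prems(2)
  obtain x x' where z: "z = Pr x x'" and x: "x \<in> space X" and x': "x' \<in> space X'" using Cons.prems(1) by (auto elim: prod_spaceE)
  have zs: "set zs \<subseteq> space (prod_space X X')" using Cons.prems by auto
  then have zs1: "set (map pfst zs) \<subseteq> space X" and zs2: "set (map psnd zs) \<subseteq> space X'" by (auto elim!: prod_spaceE dest!: subsetD)
  note P = kernel_prod_hom[OF K L]
  note K' = homD(6)[OF K] and L' = homD(6)[OF L]
  let ?P = "kernel_pow (prod_space Y Y') (app (kernel_prod K L))" and ?K = "kernel_pow Y (app K)" and ?L = "kernel_pow Y' (app L)"
  let ?n = "length zs"
  let ?f = "\<lambda>y y' us vs. f (Ms (add_mset y (mset us))) (Ms (add_mset y' (mset vs)))"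
  \<comment> \<open>Generic in the source space M, since the same integrand is needed over different
    nested products.\<close>
  have f_meas: "(\<lambda>z. ?f (a z) (b z) (c z) (d z)) \<in> borel_measurable M"
    if "a \<in> M \<rightarrow>\<^sub>M Y" "b \<in> M \<rightarrow>\<^sub>M Y'" "c \<in> M \<rightarrow>\<^sub>M seq_space Y n" "d \<in> M \<rightarrow>\<^sub>M seq_space Y' m" for a b c d n m and M :: "'z measure"
  proof -
    note [measurable] = that
    have "(\<lambda>z. f (Ms (mset (a z # c z))) (Ms (mset (b z # d z)))) \<in> borel_measurable M" by measurable
    then show ?thesis by simp
  qed
  have ws_meas: "(\<lambda>ws. f (Ms (mset (map pfst ws))) (Ms (mset (map psnd ws)))) \<in> borel_measurable (seq_space (prod_space Y Y') n)" for n
  proof -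
    have "(\<lambda>ws. f (ms_map pfst (Ms (mset ws))) (ms_map psnd (Ms (mset ws)))) \<in> borel_measurable (seq_space (prod_space Y Y') n)"
      by measurable
    then show ?thesis by (simp add: ms_map_def)
  qed
  have "(\<integral>\<^sup>+ ws. f (Ms (mset (map pfst ws))) (Ms (mset (map psnd ws))) \<partial>?P (z # zs))
    = (\<integral>\<^sup>+ w. \<integral>\<^sup>+ ws. ?f (pfst w) (psnd w) (map pfst ws) (map psnd ws) \<partial>?P zs \<partial>app (kernel_prod K L) z)"
    using Cons.prems(1) by (subst nn_integral_kernel_pow_Cons[OF homD(6)[OF P] _ zs ws_meas]) simp_all
  also have "\<dots> = (\<integral>\<^sup>+ w. \<integral>\<^sup>+ us. \<integral>\<^sup>+ vs. ?f (pfst w) (psnd w) us vs \<partial>?L (map psnd zs) \<partial>?K (map pfst zs) \<partial>app (kernel_prod K L) z)"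
  proof (rule nn_integral_hom_cong[OF P])
    fix w assume "w \<in> space (prod_space Y Y')"
    then have [measurable]: "pfst w \<in> space Y" "psnd w \<in> space Y'" by (auto elim: prod_spaceE)
    have "(\<lambda>(a, b). f (Ms (add_mset (pfst w) (bag a))) (Ms (add_mset (psnd w) (bag b)))) \<in> borel_measurable (exp_space Y \<Otimes>\<^sub>M exp_space Y')"
      by measurable
    from Cons.IH[OF zs this]
    show "(\<integral>\<^sup>+ ws. ?f (pfst w) (psnd w) (map pfst ws) (map psnd ws) \<partial>?P zs)
      = (\<integral>\<^sup>+ us. \<integral>\<^sup>+ vs. ?f (pfst w) (psnd w) us vs \<partial>?L (map psnd zs) \<partial>?K (map pfst zs))" by simp
  qed (use Cons.prems(1) in simp)
  also have "\<dots> = (\<integral>\<^sup>+ y. \<integral>\<^sup>+ y'. \<integral>\<^sup>+ us. \<integral>\<^sup>+ vs. ?f y y' us vs \<partial>?L (map psnd zs) \<partial>?K (map pfst zs) \<partial>app L x' \<partial>app K x)"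
  proof -
    have "(\<lambda>w. \<integral>\<^sup>+ us. \<integral>\<^sup>+ vs. ?f (pfst w) (psnd w) us vs \<partial>?L (map psnd zs) \<partial>?K (map pfst zs)) \<in> borel_measurable (prod_space Y Y')"
      by (intro kernel_pow_measurable_nn_integral[OF K' zs1], unfold case_prod_unfold,
          intro kernel_pow_measurable_nn_integral[OF L' zs2], unfold case_prod_unfold,
          intro f_meas) measurable
    then show ?thesis unfolding z by (subst nn_integral_kernel_prod[OF K L x x']) simp_all
  qed
  \<comment> \<open>The second component of the head moves past the first components of the tail,
    which separates the two lists.\<close>
  also have "\<dots> = (\<integral>\<^sup>+ y. \<integral>\<^sup>+ us. \<integral>\<^sup>+ y'. \<integral>\<^sup>+ vs. ?f y y' us vs \<partial>?L (map psnd zs) \<partial>app L x' \<partial>?K (map pfst zs) \<partial>app K x)"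
  proof (rule nn_integral_hom_cong[OF K x])
    fix y assume y[measurable]: "y \<in> space Y"
    have "(\<lambda>(y', us). \<integral>\<^sup>+ vs. ?f y y' us vs \<partial>?L (map psnd zs)) \<in> borel_measurable (Y' \<Otimes>\<^sub>M seq_space Y (length (map pfst zs)))"
      by (unfold case_prod_unfold, intro kernel_pow_measurable_nn_integral[OF L' zs2], unfold case_prod_unfold, intro f_meas) measurable
    then show "(\<integral>\<^sup>+ y'. \<integral>\<^sup>+ us. \<integral>\<^sup>+ vs. ?f y y' us vs \<partial>?L (map psnd zs) \<partial>?K (map pfst zs) \<partial>app L x')
      = (\<integral>\<^sup>+ us. \<integral>\<^sup>+ y'. \<integral>\<^sup>+ vs. ?f y y' us vs \<partial>?L (map psnd zs) \<partial>app L x' \<partial>?K (map pfst zs))"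
      by (rule Fubini_s_finite_sets[OF homD(9)[OF L x'] s_finite_measure_kernel_pow[OF K' zs1] homD(7)[OF L x'] sets_kernel_pow])
  qed
  also have "\<dots> = (\<integral>\<^sup>+ y. \<integral>\<^sup>+ us. \<integral>\<^sup>+ vs. f (Ms (add_mset y (mset us))) (Ms (mset vs)) \<partial>?L (x' # map psnd zs) \<partial>?K (map pfst zs) \<partial>app K x)"
  proof (intro nn_integral_hom_cong[OF K x] nn_integral_cong)
    fix y us assume [measurable]: "y \<in> space Y" and "us \<in> space (?K (map pfst zs))"
    then have [measurable]: "us \<in> space (seq_space Y ?n)" by (simp add: space_kernel_pow)
    have "(\<lambda>vs. f (Ms (mset (y # us))) (Ms (mset vs))) \<in> borel_measurable (seq_space Y' (Suc (length (map psnd zs))))" by measurable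
    then show "(\<integral>\<^sup>+ y'. \<integral>\<^sup>+ vs. ?f y y' us vs \<partial>?L (map psnd zs) \<partial>app L x') = (\<integral>\<^sup>+ vs. f (Ms (add_mset y (mset us))) (Ms (mset vs)) \<partial>?L (x' # map psnd zs))"
      by (subst nn_integral_kernel_pow_Cons[OF L' x' zs2]) simp_all
  qed
  also have "\<dots> = (\<integral>\<^sup>+ us. \<integral>\<^sup>+ vs. f (Ms (mset us)) (Ms (mset vs)) \<partial>?L (x' # map psnd zs) \<partial>?K (x # map pfst zs))"
  proof -
    have "(\<lambda>us. \<integral>\<^sup>+ vs. f (Ms (mset us)) (Ms (mset vs)) \<partial>?L (x' # map psnd zs)) \<in> borel_measurable (seq_space Y (Suc (length (map pfst zs))))"
      using x' zs2 by (intro kernel_pow_measurable_nn_integral[OF L']) (simp_all add: case_prod_unfold)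
    then show ?thesis by (subst nn_integral_kernel_pow_Cons[OF K' x zs1]) simp_all
  qed
  finally show ?case by (simp add: z)
qed

lemma monoidal_map_natural:
  assumes K: "K \<in> hom X Y" and L: "L \<in> hom X' Y'"
  shows "kernel_comp (kernel_prod (exp_kernel K) (exp_kernel L)) (monoidal_map X X')
    = kernel_comp (monoidal_map Y Y') (exp_kernel (kernel_prod K L))"
proof (rule hom_eqI)
  note EK = exp_kernel_hom[OF K] and EL = exp_kernel_hom[OF L] and KL = kernel_prod_hom[OF K L]
  note P = kernel_prod_hom[OF EK EL] and E = exp_kernel_hom[OF KL]
  let ?X = "exp_space (prod_space X X')" and ?Y = "prod_space (exp_space Y) (exp_space Y')"
  show "kernel_comp (kernel_prod (exp_kernel K) (exp_kernel L)) (monoidal_map X X') \<in> hom ?X ?Y"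
    "kernel_comp (monoidal_map Y Y') (exp_kernel (kernel_prod K L)) \<in> hom ?X ?Y"
    using kernel_comp_hom[OF structure_homs(5)[OF homD(3)[OF K]] P] kernel_comp_hom[OF E structure_homs(5)[OF homD(4)[OF K]]] by auto
  fix z and f :: "_ \<Rightarrow> ennreal" assume z: "z \<in> space ?X" and f[measurable]: "f \<in> borel_measurable ?Y"
  then obtain zs where zeq: "z = Ms (mset zs)" and zs: "set zs \<subseteq> space (prod_space X X')" by (elim exp_spaceE)
  then have zs1: "set (map pfst zs) \<subseteq> space X" and zs2: "set (map psnd zs) \<subseteq> space X'" by (auto elim!: prod_spaceE dest!: subsetD)
  have "(\<integral>\<^sup>+ y. f y \<partial>app (kernel_comp (kernel_prod (exp_kernel K) (exp_kernel L)) (monoidal_map X X')) z)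
    = (\<integral>\<^sup>+ y. f y \<partial>app (kernel_prod (exp_kernel K) (exp_kernel L)) (Pr (Ms (mset (map pfst zs))) (Ms (mset (map psnd zs)))))"
    unfolding monoidal_map_eq by (subst nn_integral_comp_dirac[OF P _ _ z f]) (simp_all add: zeq ms_map_def[of _ "Ms _"])
  also have "\<dots> = (\<integral>\<^sup>+ a. \<integral>\<^sup>+ b. f (Pr a b) \<partial>app (exp_kernel L) (Ms (mset (map psnd zs))) \<partial>app (exp_kernel K) (Ms (mset (map pfst zs))))"
    using zs1 zs2 by (intro nn_integral_kernel_prod[OF EK EL _ _ f]) simp_all
  also have "\<dots> = (\<integral>\<^sup>+ a. \<integral>\<^sup>+ vs. f (Pr a (Ms (mset vs))) \<partial>kernel_pow Y' (app L) (map psnd zs) \<partial>app (exp_kernel K) (Ms (mset (map pfst zs))))"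
    using zs1 by (intro nn_integral_hom_cong[OF EK] nn_integral_exp_kernel[OF L zs2]) simp_all
  also have "\<dots> = (\<integral>\<^sup>+ us. \<integral>\<^sup>+ vs. f (Pr (Ms (mset us)) (Ms (mset vs))) \<partial>kernel_pow Y' (app L) (map psnd zs) \<partial>kernel_pow Y (app K) (map pfst zs))"
    by (intro nn_integral_exp_kernel[OF K zs1] kernel_pow_measurable_nn_integral[OF homD(6)[OF L] zs2]) (simp add: case_prod_unfold)
  also have "\<dots> = (\<integral>\<^sup>+ ws. f (Pr (Ms (mset (map pfst ws))) (Ms (mset (map psnd ws)))) \<partial>kernel_pow (prod_space Y Y') (app (kernel_prod K L)) zs)"
    by (rule nn_integral_kernel_pow_unzip[OF K L zs, symmetric]) simp
  also have "\<dots> = (\<integral>\<^sup>+ u. f (Pr (ms_map pfst u) (ms_map psnd u)) \<partial>app (exp_kernel (kernel_prod K L)) z)"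
    unfolding zeq by (subst nn_integral_exp_kernel[OF KL zs]) (simp_all add: ms_map_def[of _ "Ms _"])
  also have "\<dots> = (\<integral>\<^sup>+ y. f y \<partial>app (kernel_comp (monoidal_map Y Y') (exp_kernel (kernel_prod K L))) z)"
    unfolding monoidal_map_eq by (subst nn_integral_dirac_comp[OF E _ _ z f]) simp_all
  finally show "(\<integral>\<^sup>+ y. f y \<partial>app (kernel_comp (kernel_prod (exp_kernel K) (exp_kernel L)) (monoidal_map X X')) z)
    = (\<integral>\<^sup>+ y. f y \<partial>app (kernel_comp (monoidal_map Y Y') (exp_kernel (kernel_prod K L))) z)" .
qed

section \<open>The opposite category\<close>

lemma TsKer_simps [simp]:
  "Obj TsKer = measurable_spaces" "Idn TsKer = idn" "Comp TsKer = kernel_comp"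
  "TenO TsKer = prod_space" "TenA TsKer = kernel_prod" "Unit TsKer = one_space"
  by (simp_all add: TsKer_def)

lemma opposite_simps [simp]:
  "Obj (opposite C) = Obj C" "Hom (opposite C) X Y = Hom C Y X" "Idn (opposite C) = Idn C"
  "Comp (opposite C) g f = Comp C f g" "TenO (opposite C) = TenO C" "TenA (opposite C) = TenA C"
  "Unit (opposite C) = Unit C"
  by (simp_all add: opposite_def)

lemma idn_hom: "X \<in> measurable_spaces \<Longrightarrow> idn X \<in> hom X X"
  by (rule dirac_kernel_hom) simp_all

lemma category_TsKer: "category TsKer"
proof
  show "\<And>X. X \<in> Obj TsKer \<Longrightarrow> Idn TsKer X \<in> hom X X" by (simp add: idn_hom)
  show "\<And>f X Y g Z. f \<in> hom X Y \<Longrightarrow> g \<in> hom Y Z \<Longrightarrow> g \<odot>\<^bsub>TsKer\<^esub> f \<in> hom X Z" by auto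
  show "\<And>f X Y. f \<in> hom X Y \<Longrightarrow> Idn TsKer Y \<odot>\<^bsub>TsKer\<^esub> f = f" by (simp add: kernel_comp_idn_left)
  show "\<And>f X Y. f \<in> hom X Y \<Longrightarrow> f \<odot>\<^bsub>TsKer\<^esub> Idn TsKer X = f" by (simp add: kernel_comp_idn_right)
  show "\<And>f X Y g Z h W. f \<in> hom X Y \<Longrightarrow> g \<in> hom Y Z \<Longrightarrow> h \<in> hom Z W \<Longrightarrow>
      (h \<odot>\<^bsub>TsKer\<^esub> g) \<odot>\<^bsub>TsKer\<^esub> f = h \<odot>\<^bsub>TsKer\<^esub> (g \<odot>\<^bsub>TsKer\<^esub> f)" by (simp add: kernel_comp_assoc)
qed (auto simp: hom_iff)

lemma category_opposite:
  assumes "category C"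
  shows "category (opposite C)"
proof -
  interpret category C by fact
  show ?thesis
    by unfold_locales
      (unfold opposite_simps, (metis Hom_Obj Hom_disjoint Idn_Hom Comp_Hom Comp_Idn_left Comp_Idn_right Comp_assoc)+)
qed

text \<open>Inverses are unique in a category, so the definite description returns any inverse that
  is exhibited.\<close>

lemma (in category) inverse_arrow_eqI:
  assumes "is_inverse C X Y f g"
  shows "inverse_arrow C X Y f = g"
  unfolding inverse_arrow_def
proof (rule the_equality)
  fix g' assume "is_inverse C X Y f g'"
  then have g': "g' \<in> Hom C Y X" "g' \<odot> f = Idn C X" by (auto simp: is_inverse_def)
  have f: "f \<in> Hom C X Y" "g \<in> Hom C Y X" "f \<odot> g = Idn C Y" using assms by (auto simp: is_inverse_def)
  have "g' = g' \<odot> (f \<odot> g)" unfolding f(3) by (rule Comp_Idn_right[OF g'(1), symmetric])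
  also have "\<dots> = (g' \<odot> f) \<odot> g" by (rule Comp_assoc[OF f(2,1) g'(1), symmetric])
  also have "\<dots> = g" unfolding g'(2) by (rule Comp_Idn_left[OF f(2)])
  finally show "g' = g" .
qed fact

lemma is_inverse_dirac:
  fixes X Y :: "'u univ measure"
  assumes "X \<in> measurable_spaces" "Y \<in> measurable_spaces" "f \<in> X \<rightarrow>\<^sub>M Y" "g \<in> Y \<rightarrow>\<^sub>M X"
    and "\<And>x. x \<in> space X \<Longrightarrow> g (f x) = x" "\<And>y. y \<in> space Y \<Longrightarrow> f (g y) = y"
  shows "is_inverse TsKer X Y (dirac_kernel X Y f) (dirac_kernel Y X g)"
    "is_inverse (opposite TsKer) Y X (dirac_kernel X Y f) (dirac_kernel Y X g)"
  using assms unfolding is_inverse_def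
  by (auto simp: kernel_comp_dirac_dirac intro: dirac_kernel_cong)

lemmas inverse_arrow_dirac = category.inverse_arrow_eqI[OF category_TsKer is_inverse_dirac(1)]
  and inverse_arrow_dirac_op = category.inverse_arrow_eqI[OF category_opposite[OF category_TsKer] is_inverse_dirac(2)]

abbreviation opT :: "('u univ measure, ('u univ, 'u univ) kernel) smc" where
  "opT \<equiv> opposite TsKer"

abbreviation middle_map :: "'u univ \<Rightarrow> 'u univ" where
  "middle_map z \<equiv> Pr (Pr (pfst (pfst z)) (pfst (psnd z))) (Pr (psnd (pfst z)) (psnd (psnd z)))"

lemma opposite_structure:
  "Assoc (opposite C) X Y Z = inverse_arrow C (TenO C (TenO C X Y) Z) (TenO C X (TenO C Y Z)) (Assoc C X Y Z)"
  "Lunit (opposite C) X = inverse_arrow C (TenO C (Unit C) X) X (Lunit C X)"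
  "Runit (opposite C) X = inverse_arrow C (TenO C X (Unit C)) X (Runit C X)"
  "Symm (opposite C) X Y = inverse_arrow C (TenO C X Y) (TenO C Y X) (Symm C X Y)"
  by (simp_all add: opposite_def)

lemma TsKer_structure:
  "Assoc TsKer X Y Z = dirac_kernel (prod_space (prod_space X Y) Z) (prod_space X (prod_space Y Z)) assoc_map"
  "Lunit TsKer X = dirac_kernel (prod_space one_space X) X psnd"
  "Runit TsKer X = dirac_kernel (prod_space X one_space) X pfst"
  "Symm TsKer X Y = dirac_kernel (prod_space X Y) (prod_space Y X) swap_map"
  by (simp_all add: TsKer_def)

lemmas dirac_simps = kernel_comp_dirac_dirac kernel_prod_dirac exp_kernel_dirac_kernel

lemma Assoc_opT:
  assumes "X \<in> measurable_spaces" "Y \<in> measurable_spaces" "Z \<in> measurable_spaces"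
  shows "Assoc opT X Y Z = dirac_kernel (prod_space X (prod_space Y Z)) (prod_space (prod_space X Y) Z) unassoc_map"
  unfolding opposite_structure TsKer_structure TsKer_simps
  by (rule inverse_arrow_dirac) (auto elim!: prod_spaceE simp del: Pr_in_prod_space)

lemma Lunit_opT:
  assumes "X \<in> measurable_spaces"
  shows "Lunit opT X = dirac_kernel X (prod_space one_space X) (Pr Star)"
  unfolding opposite_structure TsKer_structure TsKer_simps
  by (rule inverse_arrow_dirac) (auto elim!: prod_spaceE simp: assms)

lemma Runit_opT:
  assumes "X \<in> measurable_spaces"
  shows "Runit opT X = dirac_kernel X (prod_space X one_space) (\<lambda>x. Pr x Star)"
  unfolding opposite_structure TsKer_structure TsKer_simps
  by (rule inverse_arrow_dirac) (auto elim!: prod_spaceE simp: assms)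

lemma Symm_opT:
  "Symm opT X Y = dirac_kernel (prod_space Y X) (prod_space X Y) swap_map"
  unfolding opposite_structure TsKer_structure TsKer_simps
  by (rule inverse_arrow_dirac) (auto elim!: prod_spaceE)

text \<open>Inverting in the opposite category undoes the inversion built into
  \<open>opposite\<close>. Such doubly inverted arrows occur in \<open>middle_swap\<close>, and for
  the unitor in \<open>ten_functor\<close>.\<close>

lemma inverse_Assoc_opT:
  "inverse_arrow opT (prod_space (prod_space X Y) Z) (prod_space X (prod_space Y Z))
      (dirac_kernel (prod_space X (prod_space Y Z)) (prod_space (prod_space X Y) Z) unassoc_map)
    = dirac_kernel (prod_space (prod_space X Y) Z) (prod_space X (prod_space Y Z)) assoc_map"
  by (rule inverse_arrow_dirac_op) (auto elim!: prod_spaceE)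

lemma inverse_Lunit_opT:
  assumes "X \<in> measurable_spaces"
  shows "inverse_arrow opT (prod_space one_space X) X (dirac_kernel X (prod_space one_space X) (Pr Star)) = dirac_kernel (prod_space one_space X) X psnd"
  by (rule inverse_arrow_dirac_op) (auto elim!: prod_spaceE simp: assms)

lemma middle_swap_opT:
  assumes [simp]: "X \<in> measurable_spaces" "Y \<in> measurable_spaces" "Z \<in> measurable_spaces" "W \<in> measurable_spaces"
  shows "middle_swap opT X Y Z W = dirac_kernel (prod_space (prod_space X Z) (prod_space Y W))
    (prod_space (prod_space X Y) (prod_space Z W)) middle_map"
  unfolding middle_swap_def
  by (simp add: inverse_Assoc_opT Assoc_opT Symm_opT dirac_simps)

lemma iso_dirac_opT:
  fixes X Y :: "'u univ measure"
  assumes "X \<in> measurable_spaces" "Y \<in> measurable_spaces" "f \<in> X \<rightarrow>\<^sub>M Y" "g \<in> Y \<rightarrow>\<^sub>M X"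
    and "\<And>x. x \<in> space X \<Longrightarrow> g (f x) = x" "\<And>y. y \<in> space Y \<Longrightarrow> f (g y) = y"
  shows "iso opT Y X (dirac_kernel X Y f)"
  using is_inverse_dirac(2)[OF assms] unfolding iso_def by blast

lemmas opT_structure = Assoc_opT Lunit_opT Runit_opT Symm_opT

lemma symmetric_monoidal_category_opT: "symmetric_monoidal_category (opT :: ('u univ measure, ('u univ, 'u univ) kernel) smc)"
proof -
  interpret category opT by (rule category_opposite[OF category_TsKer])
  show ?thesis
  \<comment> \<open>Unfolding \<open>opposite\<close> reverses every composite, so each axiom
    appears below as an equation of kernels read backwards.\<close>
  proof (unfold_locales, unfold opposite_simps TsKer_simps)
    fix X Y :: "'u univ measure"
    assume X[simp]: "X \<in> measurable_spaces"
    show "iso opT (prod_space one_space X) X (Lunit opT X)"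
      unfolding Lunit_opT[OF X] by (rule iso_dirac_opT[where g=psnd]) (auto elim!: prod_spaceE)
    show "iso opT (prod_space X one_space) X (Runit opT X)"
      unfolding Runit_opT[OF X] by (rule iso_dirac_opT[where g=pfst]) (auto elim!: prod_spaceE)
    assume Y[simp]: "Y \<in> measurable_spaces"
    show "Symm opT X Y \<in> hom (prod_space Y X) (prod_space X Y)"
      unfolding Symm_opT by (rule dirac_kernel_hom) simp_all
    show "kernel_comp (Symm opT X Y) (Symm opT Y X) = idn (prod_space X Y)"
      unfolding Symm_opT by (simp add: dirac_simps, rule dirac_kernel_cong) (auto elim!: prod_spaceE)
    show "kernel_prod (idn X) (idn Y) = idn (prod_space X Y)"
      by (simp add: dirac_simps, rule dirac_kernel_cong) (auto elim!: prod_spaceE)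
    show "kernel_comp (Assoc opT X one_space Y) (kernel_prod (idn X) (Lunit opT Y)) = kernel_prod (Runit opT X) (idn Y)"
      by (simp add: opT_structure dirac_simps)
    fix Z :: "'u univ measure"
    assume Z[simp]: "Z \<in> measurable_spaces"
    show "iso opT (prod_space (prod_space X Y) Z) (prod_space X (prod_space Y Z)) (Assoc opT X Y Z)"
      unfolding Assoc_opT[OF X Y Z] by (rule iso_dirac_opT[where g=assoc_map]) (auto elim!: prod_spaceE)
    show "kernel_comp (Assoc opT X Y Z) (kernel_comp (Symm opT X (prod_space Y Z)) (Assoc opT Y Z X))
      = kernel_comp (kernel_prod (Symm opT X Y) (idn Z)) (kernel_comp (Assoc opT Y X Z) (kernel_prod (idn Y) (Symm opT X Z)))"
      by (simp add: opT_structure dirac_simps)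
    fix W :: "'u univ measure"
    assume W[simp]: "W \<in> measurable_spaces"
    show "kernel_comp (kernel_prod (Assoc opT X Y Z) (idn W))
        (kernel_comp (Assoc opT X (prod_space Y Z) W) (kernel_prod (idn X) (Assoc opT Y Z W)))
      = kernel_comp (Assoc opT (prod_space X Y) Z W) (Assoc opT X Y (prod_space Z W))"
      by (simp add: opT_structure dirac_simps)
  next
    fix K L :: "('u univ, 'u univ) kernel" and X X' Y Y' assume K: "K \<in> hom X' X" and L: "L \<in> hom Y' Y"
    show "kernel_prod K L \<in> hom (prod_space X' Y') (prod_space X Y)" by (rule kernel_prod_hom[OF K L])
    show "kernel_comp (kernel_prod K L) (Symm opT X' Y') = kernel_comp (Symm opT X Y) (kernel_prod L K)"
      unfolding Symm_opT by (rule swap_natural[OF K L])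
    fix M :: "('u univ, 'u univ) kernel" and Z Z' assume M: "M \<in> hom Z' Z"
    show "kernel_comp (kernel_prod (kernel_prod K L) M) (Assoc opT X' Y' Z') = kernel_comp (Assoc opT X Y Z) (kernel_prod K (kernel_prod L M))"
      using unassoc_natural[OF K L M] homD(3,4)[OF K] homD(3,4)[OF L] homD(3,4)[OF M] by (simp add: Assoc_opT)
  next
    fix K L K' L' :: "('u univ, 'u univ) kernel" and X X' X'' Y Y' Y''
    assume "K \<in> hom X' X" "K' \<in> hom X'' X'" "L \<in> hom Y' Y" "L' \<in> hom Y'' Y'"
    then show "kernel_prod (kernel_comp K K') (kernel_comp L L') = kernel_comp (kernel_prod K L) (kernel_prod K' L')"
      by (intro kernel_prod_comp)
  next
    fix K :: "('u univ, 'u univ) kernel" and X X' assume K: "K \<in> hom X' X"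
    show "kernel_comp (kernel_prod (idn one_space) K) (Lunit opT X') = kernel_comp (Lunit opT X) K"
      using lunit_natural[OF K] homD(3,4)[OF K] by (simp add: Lunit_opT)
    show "kernel_comp (kernel_prod K (idn one_space)) (Runit opT X') = kernel_comp (Runit opT X) K"
      using runit_natural[OF K] homD(3,4)[OF K] by (simp add: Runit_opT)
  qed simp_all
qed

section \<open>The linear exponential comonad\<close>

lemma exp_functor_simps [simp]:
  "FO exp_functor = exp_space" "FA exp_functor = exp_kernel" "FM exp_functor = monoidal_map"
  "FI exp_functor = monoidal_unit_map"
  by (simp_all add: exp_functor_def)

lemma derived_functor_simps [simp]:
  "FO (id_functor C) X = X" "FA (id_functor C) f = f" "FM (id_functor C) X Y = Idn C (TenO C X Y)"
  "FI (id_functor C) = Idn C (Unit C)"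
  "FO (comp_functor C G F) X = FO G (FO F X)" "FA (comp_functor C G F) f = FA G (FA F f)"
  "FM (comp_functor C G F) X Y = Comp C (FA G (FM F X Y)) (FM G (FO F X) (FO F Y))"
  "FI (comp_functor C G F) = Comp C (FA G (FI F)) (FI G)"
  "FO (unit_functor C) X = Unit C" "FA (unit_functor C) f = Idn C (Unit C)"
  "FM (unit_functor C) X Y = Lunit C (Unit C)" "FI (unit_functor C) = Idn C (Unit C)"
  "FO (ten_functor C F G) X = TenO C (FO F X) (FO G X)" "FA (ten_functor C F G) f = TenA C (FA F f) (FA G f)"
  "FM (ten_functor C F G) X Y = Comp C (TenA C (FM F X Y) (FM G X Y)) (middle_swap C (FO F X) (FO G X) (FO F Y) (FO G Y))"
  "FI (ten_functor C F G) = Comp C (TenA C (FI F) (FI G)) (inverse_arrow C (TenO C (Unit C) (Unit C)) (Unit C) (Lunit C (Unit C)))"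
  by (simp_all add: id_functor_def comp_functor_def unit_functor_def ten_functor_def)

section \<open>Multiset identities behind the axioms\<close>

lemma bag_ms: "bag (ms_map f z) = image_mset f (bag z)" "bag (ms_flat z) = sum_mset (image_mset bag (bag z))"
  by (simp_all add: ms_map_def ms_flat_def)

lemma ms_map_comp: "ms_map g (ms_map f z) = ms_map (\<lambda>x. g (f x)) z"
  by (simp add: ms_map_def image_mset.compositionality comp_def)

text \<open>Membership guarantees that z has the form \<open>Ms M\<close>; for the other
  constructors of the universe \<open>Ms (bag z)\<close> differs from z.\<close>

lemma ms_map_ident: "z \<in> space (exp_space X) \<Longrightarrow> ms_map (\<lambda>x. x) z = z"
  by (auto simp: ms_map_def space_exp_space)

lemma ms_flat_single: "z \<in> space (exp_space X) \<Longrightarrow> ms_flat (ms_single z) = z"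
  by (auto simp: ms_defs space_exp_space)

lemma ms_flat_map_single: "z \<in> space (exp_space X) \<Longrightarrow> ms_flat (ms_map ms_single z) = z"
  by (auto simp: ms_defs space_exp_space image_mset.compositionality comp_def)

text \<open>Associativity of the multiset monad, which becomes coassociativity of the
  storage.\<close>

lemma ms_flat_flat: "ms_flat (ms_flat z) = ms_flat (ms_map ms_flat z)"
proof -
  have "sum_mset (image_mset bag (sum_mset (image_mset bag M))) = sum_mset (image_mset bag (image_mset ms_flat M))" for M
    by (induction M) (simp_all add: ms_flat_def)
  then show ?thesis
    unfolding ms_flat_def[of "ms_flat z"] ms_flat_def[of "ms_map ms_flat z"] bag_ms by simp
qed

text \<open>Naturality of flattening for point maps; applied to the two projections it makes the
  storage monoidal.\<close>

lemma ms_map_flat: "ms_map f (ms_flat z) = ms_flat (ms_map (ms_map f) z)"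
proof -
  have "image_mset f (sum_mset (image_mset bag M)) = sum_mset (image_mset bag (image_mset (ms_map f) M))" for M
    by (induction M) (simp_all add: ms_map_def)
  then show ?thesis by (simp add: ms_flat_def ms_map_def[of _ "Ms _"] ms_map_def[of _ z])
qed

lemma ms_map_single: "ms_map f (ms_single x) = ms_single (f x)"
  by (simp add: ms_defs)

lemma ms_map_plus: "ms_map f (ms_plus z w) = ms_plus (ms_map f z) (ms_map f w)"
  by (simp add: ms_defs)

lemma ms_flat_plus: "ms_flat (ms_plus z w) = ms_plus (ms_flat z) (ms_flat w)"
  by (simp add: ms_defs)

text \<open>With the two projections as f and g, this is the equation making the contraction a
  coalgebra morphism.\<close>

lemma ms_flat_map_plus:
  "ms_flat (ms_map (\<lambda>z. ms_plus (f z) (g z)) z) = ms_plus (ms_flat (ms_map f z)) (ms_flat (ms_map g z))"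
proof -
  have "sum_mset (image_mset bag (image_mset (\<lambda>z. ms_plus (f z) (g z)) M))
    = sum_mset (image_mset bag (image_mset f M)) + sum_mset (image_mset bag (image_mset g M))" for M
    by (induction M) (simp_all add: ms_plus_def)
  then show ?thesis by (simp add: ms_flat_def ms_map_def ms_plus_def)
qed

text \<open>The nullary companion of \<open>ms_flat_map_plus\<close>, responsible for the weakening
  being a coalgebra morphism.\<close>

lemma ms_flat_map_empty: "ms_flat (ms_map (\<lambda>_. Ms {#}) z) = Ms {#}"
proof -
  have "sum_mset (image_mset bag (image_mset (\<lambda>_. Ms {#}) M)) = {#}" for M :: "'a univ multiset"
    by (induction M) simp_all
  then show ?thesis by (simp add: ms_flat_def ms_map_def)
qed

lemma ms_empty: "ms_map f (Ms {#}) = Ms {#}" "ms_flat (Ms {#}) = Ms {#}"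
  by (simp_all add: ms_defs)

lemma ms_plus_empty:
  "z \<in> space (exp_space X) \<Longrightarrow> ms_plus z (Ms {#}) = z" "z \<in> space (exp_space X) \<Longrightarrow> ms_plus (Ms {#}) z = z"
  by (auto simp: ms_defs space_exp_space)

lemma ms_plus_assoc: "ms_plus (ms_plus a b) c = ms_plus a (ms_plus b c)"
  by (simp add: ms_plus_def add.assoc)

lemma ms_plus_commute: "ms_plus a b = ms_plus b a"
  by (simp add: ms_plus_def add.commute)

lemma ms_plus_left_commute: "ms_plus a (ms_plus b c) = ms_plus b (ms_plus a c)"
  by (simp add: ms_plus_def add.left_commute)

text \<open>Commutativity and left commutativity act as ordered rewriting, bringing sums into a
  normal form.\<close>

lemmas ms_simps = ms_map_comp ms_flat_single ms_flat_map_single ms_flat_flat ms_map_flat ms_map_single ms_map_plus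
  ms_flat_plus ms_flat_map_plus ms_flat_map_empty ms_empty ms_plus_empty ms_plus_assoc
  ms_plus_commute ms_plus_left_commute ms_map_ident

text \<open>Bundles the form of the kernel with the side conditions on objects and measurability.
  The rules in \<open>dirac_on_intros\<close> follow the syntax of a composite and compute its point
  map by unification.\<close>

definition dirac_on :: "('u univ, 'u univ) kernel \<Rightarrow> 'u univ measure \<Rightarrow> 'u univ measure \<Rightarrow> ('u univ \<Rightarrow> 'u univ) \<Rightarrow> bool" where
  "dirac_on K X Y f \<longleftrightarrow> K = dirac_kernel X Y f \<and> X \<in> measurable_spaces \<and> Y \<in> measurable_spaces \<and> f \<in> X \<rightarrow>\<^sub>M Y"

text \<open>Equality of the point maps is needed on the source space only; there the elements have
  the shape of pairs and multisets.\<close>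

lemma dirac_on_eqI:
  "dirac_on K X Y f \<Longrightarrow> dirac_on L X Y g \<Longrightarrow> (\<And>x. x \<in> space X \<Longrightarrow> f x = g x) \<Longrightarrow> K = L"
  unfolding dirac_on_def by (auto intro: dirac_kernel_cong)

lemma dirac_on_comp: "dirac_on L Y Z g \<Longrightarrow> dirac_on K X Y f \<Longrightarrow> dirac_on (kernel_comp L K) X Z (\<lambda>x. g (f x))"
  unfolding dirac_on_def by (auto simp: kernel_comp_dirac_dirac)

lemma dirac_on_prod:
  "dirac_on K X Y f \<Longrightarrow> dirac_on L X' Y' g \<Longrightarrow>
    dirac_on (kernel_prod K L) (prod_space X X') (prod_space Y Y') (\<lambda>z. Pr (f (pfst z)) (g (psnd z)))"
  unfolding dirac_on_def by (auto simp: kernel_prod_dirac)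

lemma dirac_on_exp: "dirac_on K X Y f \<Longrightarrow> dirac_on (exp_kernel K) (exp_space X) (exp_space Y) (ms_map f)"
  unfolding dirac_on_def by (auto simp: exp_kernel_dirac_kernel)

lemma dirac_on_idn: "X \<in> measurable_spaces \<Longrightarrow> dirac_on (idn X) X X (\<lambda>x. x)"
  unfolding dirac_on_def by simp

lemma dirac_on_structure:
  "X \<in> measurable_spaces \<Longrightarrow> dirac_on (storage X) (exp_space (exp_space X)) (exp_space X) ms_flat"
  "X \<in> measurable_spaces \<Longrightarrow> dirac_on (dereliction X) X (exp_space X) ms_single"
  "X \<in> measurable_spaces \<Longrightarrow> dirac_on (contraction X) (prod_space (exp_space X) (exp_space X)) (exp_space X) (\<lambda>z. ms_plus (pfst z) (psnd z))"
  "X \<in> measurable_spaces \<Longrightarrow> dirac_on (weakening X) one_space (exp_space X) (\<lambda>_. Ms {#})"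
  "dirac_on (monoidal_map X Y) (exp_space (prod_space X Y)) (prod_space (exp_space X) (exp_space Y)) (\<lambda>z. Pr (ms_map pfst z) (ms_map psnd z))"
  "dirac_on monoidal_unit_map (exp_space one_space) one_space (\<lambda>_. Star)"
  "X \<in> measurable_spaces \<Longrightarrow> Y \<in> measurable_spaces \<Longrightarrow> Z \<in> measurable_spaces \<Longrightarrow>
    dirac_on (Assoc opT X Y Z) (prod_space X (prod_space Y Z)) (prod_space (prod_space X Y) Z) unassoc_map"
  "X \<in> measurable_spaces \<Longrightarrow> dirac_on (Lunit opT X) X (prod_space one_space X) (Pr Star)"
  "X \<in> measurable_spaces \<Longrightarrow> dirac_on (Runit opT X) X (prod_space X one_space) (\<lambda>x. Pr x Star)"
  "dirac_on (Symm opT X Y) (prod_space Y X) (prod_space X Y) swap_map"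
  "X \<in> measurable_spaces \<Longrightarrow> Y \<in> measurable_spaces \<Longrightarrow> Z \<in> measurable_spaces \<Longrightarrow> W \<in> measurable_spaces \<Longrightarrow>
    dirac_on (middle_swap opT X Y Z W) (prod_space (prod_space X Z) (prod_space Y W)) (prod_space (prod_space X Y) (prod_space Z W)) middle_map"
  "dirac_on (inverse_arrow opT (prod_space one_space one_space) one_space (Lunit opT one_space)) (prod_space one_space one_space) one_space psnd"
  unfolding dirac_on_def structure_maps
  by (simp_all add: opT_structure middle_swap_opT inverse_Lunit_opT)

lemmas dirac_on_intros = dirac_on_comp dirac_on_prod dirac_on_exp dirac_on_idn dirac_on_structure
  prod_space_Obj exp_space_Obj one_space_Obj

section \<open>Verification of the comonad axioms\<close>

lemma monoidal_endofunctor_exp: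
  "monoidal_endofunctor (opT :: ('u univ measure, ('u univ, 'u univ) kernel) smc) exp_functor"
proof -
  interpret symmetric_monoidal_category "opT :: ('u univ measure, ('u univ, 'u univ) kernel) smc"
    by (rule symmetric_monoidal_category_opT)
  show ?thesis
  proof (unfold_locales, unfold opposite_simps TsKer_simps exp_functor_simps)
    fix X Y :: "'u univ measure"
    show "monoidal_unit_map \<in> hom (exp_space one_space) one_space"
      by (rule monoidal_unit_map_hom)
    assume X: "X \<in> measurable_spaces" note objs = this
    show "exp_kernel (idn X) = idn (exp_space X)"
      by (rule dirac_on_eqI, (rule dirac_on_intros objs)+) (auto simp: ms_simps elim!: prod_spaceE)
    \<comment> \<open>At the empty multiset the required value is \<open>Pr Star (Ms {#})\<close>;
      this relies on \<open>monoidal_unit_map\<close> having mass 1 there.\<close>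
    show "kernel_comp (kernel_prod monoidal_unit_map (idn (exp_space X)))
        (kernel_comp (monoidal_map one_space X) (exp_kernel (Lunit opT X))) = Lunit opT (exp_space X)"
      by (rule dirac_on_eqI, (rule dirac_on_intros objs)+) (auto simp: ms_simps elim!: prod_spaceE)
    show "kernel_comp (kernel_prod (idn (exp_space X)) monoidal_unit_map)
        (kernel_comp (monoidal_map X one_space) (exp_kernel (Runit opT X))) = Runit opT (exp_space X)"
      by (rule dirac_on_eqI, (rule dirac_on_intros objs)+) (auto simp: ms_simps elim!: prod_spaceE)
    assume "Y \<in> measurable_spaces" note objs = objs this
    show "monoidal_map X Y \<in> hom (exp_space (prod_space X Y)) (prod_space (exp_space X) (exp_space Y))"
      by (rule structure_homs[OF X])
    show "kernel_comp (monoidal_map X Y) (exp_kernel (Symm opT X Y)) = kernel_comp (Symm opT (exp_space X) (exp_space Y)) (monoidal_map Y X)"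
      by (rule dirac_on_eqI, (rule dirac_on_intros objs)+) (auto simp: ms_simps elim!: prod_spaceE)
    fix Z :: "'u univ measure"
    assume "Z \<in> measurable_spaces" note objs = objs this
    show "kernel_comp (kernel_prod (monoidal_map X Y) (idn (exp_space Z)))
        (kernel_comp (monoidal_map (prod_space X Y) Z) (exp_kernel (Assoc opT X Y Z)))
      = kernel_comp (Assoc opT (exp_space X) (exp_space Y) (exp_space Z))
          (kernel_comp (kernel_prod (idn (exp_space X)) (monoidal_map Y Z)) (monoidal_map X (prod_space Y Z)))"
      by (rule dirac_on_eqI, (rule dirac_on_intros objs)+) (auto simp: ms_simps elim!: prod_spaceE)
  next
    fix K :: "('u univ, 'u univ) kernel" and X Y assume K: "K \<in> hom Y X"
    show "exp_kernel K \<in> hom (exp_space Y) (exp_space X)" by (rule exp_kernel_hom[OF K])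
    fix L :: "('u univ, 'u univ) kernel" and Z assume L: "L \<in> hom Z Y"
    show "exp_kernel (kernel_comp K L) = kernel_comp (exp_kernel K) (exp_kernel L)"
      by (rule exp_kernel_comp[OF L K])
  next
    fix K L :: "('u univ, 'u univ) kernel" and X X' Y Y' assume K: "K \<in> hom X' X" and L: "L \<in> hom Y' Y"
    show "kernel_comp (kernel_prod (exp_kernel K) (exp_kernel L)) (monoidal_map X' Y') = kernel_comp (monoidal_map X Y) (exp_kernel (kernel_prod K L))"
      by (rule monoidal_map_natural[OF K L])
  qed simp_all
qed

lemma storage_monoidal:
  "monoidal_transformation (opT :: ('u univ measure, ('u univ, 'u univ) kernel) smc)
    exp_functor (comp_functor opT exp_functor exp_functor) storage"
proof (unfold_locales, unfold opposite_simps TsKer_simps exp_functor_simps derived_functor_simps)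
  show "kernel_comp monoidal_unit_map (storage one_space) = kernel_comp monoidal_unit_map (exp_kernel monoidal_unit_map)"
    by (rule dirac_on_eqI, (rule dirac_on_intros)+) (auto simp: ms_simps elim!: prod_spaceE)
next
  fix X Y :: "'u univ measure" assume X: "X \<in> measurable_spaces" note objs = this
  show "storage X \<in> hom (exp_space (exp_space X)) (exp_space X)" by (rule structure_homs[OF X])
  assume "Y \<in> measurable_spaces" note objs = objs this
  show "kernel_comp (monoidal_map X Y) (storage (prod_space X Y)) = kernel_comp (kernel_prod (storage X) (storage Y))
      (kernel_comp (monoidal_map (exp_space X) (exp_space Y)) (exp_kernel (monoidal_map X Y)))"
    by (rule dirac_on_eqI, (rule dirac_on_intros objs)+) (auto simp: ms_simps elim!: prod_spaceE)
qed (rule storage_natural)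

lemma dereliction_monoidal:
  "monoidal_transformation (opT :: ('u univ measure, ('u univ, 'u univ) kernel) smc)
    exp_functor (id_functor opT) dereliction"
proof (unfold_locales, unfold opposite_simps TsKer_simps exp_functor_simps derived_functor_simps)
  show "kernel_comp monoidal_unit_map (dereliction one_space) = idn one_space"
    by (rule dirac_on_eqI, (rule dirac_on_intros)+) (auto simp: ms_simps elim!: prod_spaceE)
next
  fix X Y :: "'u univ measure" assume X: "X \<in> measurable_spaces" note objs = this
  show "dereliction X \<in> hom X (exp_space X)" by (rule structure_homs[OF X])
  assume "Y \<in> measurable_spaces" note objs = objs this
  show "kernel_comp (monoidal_map X Y) (dereliction (prod_space X Y))
    = kernel_comp (kernel_prod (dereliction X) (dereliction Y)) (idn (prod_space X Y))"
    by (rule dirac_on_eqI, (rule dirac_on_intros objs)+) (auto simp: ms_simps elim!: prod_spaceE)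
qed (rule dereliction_natural)

text \<open>Projections of pairs are additive on multisets, and \<open>middle_map\<close> regroups
  the resulting two pairs of summands.\<close>

lemma contraction_monoidal:
  "monoidal_transformation (opT :: ('u univ measure, ('u univ, 'u univ) kernel) smc)
    exp_functor (ten_functor opT exp_functor exp_functor) contraction"
proof (unfold_locales, unfold opposite_simps TsKer_simps exp_functor_simps derived_functor_simps)
  show "kernel_comp monoidal_unit_map (contraction one_space)
    = kernel_comp (inverse_arrow opT (prod_space one_space one_space) one_space (Lunit opT one_space))
        (kernel_prod monoidal_unit_map monoidal_unit_map)"
    by (rule dirac_on_eqI, (rule dirac_on_intros)+) (auto simp: ms_simps elim!: prod_spaceE)
next
  fix X Y :: "'u univ measure" assume X: "X \<in> measurable_spaces" note objs = this
  show "contraction X \<in> hom (prod_space (exp_space X) (exp_space X)) (exp_space X)" by (rule structure_homs[OF X])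
  assume "Y \<in> measurable_spaces" note objs = objs this
  show "kernel_comp (monoidal_map X Y) (contraction (prod_space X Y))
    = kernel_comp (kernel_prod (contraction X) (contraction Y))
        (kernel_comp (middle_swap opT (exp_space X) (exp_space X) (exp_space Y) (exp_space Y))
          (kernel_prod (monoidal_map X Y) (monoidal_map X Y)))"
    by (rule dirac_on_eqI, (rule dirac_on_intros objs)+) (auto simp: ms_simps elim!: prod_spaceE)
qed (rule contraction_natural)

lemma weakening_monoidal:
  "monoidal_transformation (opT :: ('u univ measure, ('u univ, 'u univ) kernel) smc)
    exp_functor (unit_functor opT) weakening"
proof (unfold_locales, unfold opposite_simps TsKer_simps exp_functor_simps derived_functor_simps)
  show "kernel_comp monoidal_unit_map (weakening one_space) = idn one_space"
    by (rule dirac_on_eqI, (rule dirac_on_intros)+) (auto simp: ms_simps elim!: prod_spaceE)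
next
  fix X Y :: "'u univ measure" assume X: "X \<in> measurable_spaces" note objs = this
  show "weakening X \<in> hom one_space (exp_space X)" by (rule structure_homs[OF X])
next
  fix K :: "('u univ, 'u univ) kernel" and X Y assume K: "K \<in> hom Y X"
  \<comment> \<open>The unit functor sends every arrow to an identity, which is cancelled before
    naturality applies.\<close>
  show "kernel_comp (exp_kernel K) (weakening Y) = kernel_comp (weakening X) (idn one_space)"
    using weakening_natural[OF K] kernel_comp_idn_right[OF structure_homs(4)[OF homD(4)[OF K]]] by simp
next
  fix X Y :: "'u univ measure" assume objs: "X \<in> measurable_spaces" "Y \<in> measurable_spaces"
  show "kernel_comp (monoidal_map X Y) (weakening (prod_space X Y)) = kernel_comp (kernel_prod (weakening X) (weakening Y)) (Lunit opT one_space)"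
    by (rule dirac_on_eqI, (rule dirac_on_intros objs)+) (auto simp: ms_simps elim!: prod_spaceE)
qed

lemma monoidal_comonad_exp:
  "monoidal_comonad (opT :: ('u univ measure, ('u univ, 'u univ) kernel) smc) exp_functor storage dereliction"
proof -
  show ?thesis
  proof (rule monoidal_comonad.intro[OF monoidal_endofunctor_exp monoidal_comonad_axioms.intro],
      unfold opposite_simps TsKer_simps exp_functor_simps)
    fix X :: "'u univ measure" assume objs: "X \<in> measurable_spaces"
    show "kernel_comp (storage X) (storage (exp_space X)) = kernel_comp (storage X) (exp_kernel (storage X))"
      by (rule dirac_on_eqI, (rule dirac_on_intros objs)+) (auto simp: ms_simps elim!: prod_spaceE)
    show "kernel_comp (storage X) (dereliction (exp_space X)) = idn (exp_space X)"
      by (rule dirac_on_eqI, (rule dirac_on_intros objs)+) (auto simp: ms_simps elim!: prod_spaceE)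
    show "kernel_comp (storage X) (exp_kernel (dereliction X)) = idn (exp_space X)"
      by (rule dirac_on_eqI, (rule dirac_on_intros objs)+) (auto simp: ms_simps elim!: prod_spaceE)
  qed (rule storage_monoidal dereliction_monoidal)+
qed

lemma commutative_comonoid_exp:
  fixes X :: "'u univ measure"
  assumes X: "X \<in> measurable_spaces"
  shows "commutative_comonoid opT (exp_space X) (contraction X) (weakening X)"
proof (unfold_locales, unfold opposite_simps TsKer_simps exp_functor_simps)
  show "contraction X \<in> hom (prod_space (exp_space X) (exp_space X)) (exp_space X)"
    "weakening X \<in> hom one_space (exp_space X)" by (rule structure_homs[OF X])+
  let ?E = "exp_space X"
  show "kernel_comp (contraction X) (kernel_comp (kernel_prod (contraction X) (idn ?E)) (Assoc opT ?E ?E ?E))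
    = kernel_comp (contraction X) (kernel_prod (idn ?E) (contraction X))"
    by (rule dirac_on_eqI, (rule dirac_on_intros X)+) (auto simp: ms_simps elim!: prod_spaceE)
  show "kernel_comp (contraction X) (kernel_comp (kernel_prod (weakening X) (idn ?E)) (Lunit opT ?E)) = idn ?E"
    by (rule dirac_on_eqI, (rule dirac_on_intros X)+) (auto simp: ms_simps elim!: prod_spaceE)
  show "kernel_comp (contraction X) (kernel_comp (kernel_prod (idn ?E) (weakening X)) (Runit opT ?E)) = idn ?E"
    by (rule dirac_on_eqI, (rule dirac_on_intros X)+) (auto simp: ms_simps elim!: prod_spaceE)
  show "kernel_comp (contraction X) (Symm opT ?E ?E) = contraction X"
    by (rule dirac_on_eqI, (rule dirac_on_intros X)+) (auto simp: ms_simps elim!: prod_spaceE)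
qed

text \<open>The first part is the cofree coalgebra, given by the comonad laws. The second is the
  tensor of two cofree coalgebras, for which the laws are checked on point maps.\<close>

lemma coalgebra_exp:
  fixes X :: "'u univ measure"
  assumes X: "X \<in> measurable_spaces"
  shows "coalgebra opT exp_functor storage dereliction (exp_space X) (storage X)"
    and "coalgebra opT exp_functor storage dereliction (prod_space (exp_space X) (exp_space X))
      (kernel_comp (kernel_prod (storage X) (storage X)) (monoidal_map (exp_space X) (exp_space X)))"
proof -
  let ?E = "exp_space X"
  interpret monoidal_comonad "opT :: ('u univ measure, ('u univ, 'u univ) kernel) smc" exp_functor storage dereliction
    by (rule monoidal_comonad_exp)
  show "coalgebra opT exp_functor storage dereliction (exp_space X) (storage X)"
    using comonad_assoc[of X] comonad_counit_left[of X] structure_homs(1)[OF X] X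
    by unfold_locales simp_all
  show "coalgebra opT exp_functor storage dereliction (prod_space ?E ?E)
      (kernel_comp (kernel_prod (storage X) (storage X)) (monoidal_map ?E ?E))"
  proof (unfold_locales, unfold opposite_simps TsKer_simps exp_functor_simps)
    let ?h = "kernel_comp (kernel_prod (storage X) (storage X)) (monoidal_map ?E ?E)"
    have S: "storage X \<in> hom (exp_space ?E) ?E" by (rule structure_homs[OF X])
    have "monoidal_map ?E ?E \<in> hom (exp_space (prod_space ?E ?E)) (prod_space (exp_space ?E) (exp_space ?E))"
      by (rule structure_homs(5)[OF exp_space_Obj])
    then show "?h \<in> hom (exp_space (prod_space ?E ?E)) (prod_space ?E ?E)"
      by (rule kernel_comp_hom[OF _ kernel_prod_hom[OF S S]])
    show "kernel_comp ?h (dereliction (prod_space ?E ?E)) = idn (prod_space ?E ?E)"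
      by (rule dirac_on_eqI, (rule dirac_on_intros X)+) (auto simp: ms_simps elim!: prod_spaceE)
    show "kernel_comp ?h (storage (prod_space ?E ?E)) = kernel_comp ?h (exp_kernel ?h)"
      by (rule dirac_on_eqI, (rule dirac_on_intros X)+) (auto simp: ms_simps elim!: prod_spaceE)
  qed
qed

lemma coalgebra_unit:
  "coalgebra (opT :: ('u univ measure, ('u univ, 'u univ) kernel) smc) exp_functor storage dereliction one_space monoidal_unit_map"
proof (unfold_locales, unfold opposite_simps TsKer_simps exp_functor_simps)
  show "monoidal_unit_map \<in> hom (exp_space one_space) (one_space :: 'u univ measure)" by (rule monoidal_unit_map_hom)
  show "kernel_comp monoidal_unit_map (dereliction one_space) = idn (one_space :: 'u univ measure)"
    by (rule dirac_on_eqI, (rule dirac_on_intros)+) (auto simp: ms_simps elim!: prod_spaceE)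
  show "kernel_comp monoidal_unit_map (storage one_space) = kernel_comp (monoidal_unit_map :: ('u univ, 'u univ) kernel) (exp_kernel monoidal_unit_map)"
    by (rule dirac_on_eqI, (rule dirac_on_intros)+) (auto simp: ms_simps elim!: prod_spaceE)
qed

theorem theorem3p25:
  shows "linear_exponential_comonad
    (opposite (TsKer :: ('u univ measure, ('u univ, 'u univ) kernel) smc))
    exp_functor storage dereliction contraction weakening"
proof -
  show ?thesis
  proof (rule linear_exponential_comonad.intro[OF monoidal_comonad_exp linear_exponential_comonad_axioms.intro],
      unfold opposite_simps TsKer_simps exp_functor_simps)
    fix X :: "'u univ measure" assume X: "X \<in> measurable_spaces" note objs = this
    let ?E = "exp_space X"
    have homs: "contraction X \<in> hom (prod_space ?E ?E) ?E" "weakening X \<in> hom one_space ?E" "storage X \<in> hom (exp_space ?E) ?E"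
      by (rule structure_homs[OF X])+
    show "commutative_comonoid opT ?E (contraction X) (weakening X)" by (rule commutative_comonoid_exp[OF X])
    show "coalgebra_morphism opT exp_functor storage dereliction ?E (storage X) (prod_space ?E ?E)
        (kernel_comp (kernel_prod (storage X) (storage X)) (monoidal_map ?E ?E)) (contraction X)"
    proof (rule coalgebra_morphism.intro[OF coalgebra_exp[OF X] coalgebra_morphism_axioms.intro],
        unfold opposite_simps TsKer_simps exp_functor_simps)
      \<comment> \<open>In terms of points: flattening after adding the components equals adding the
        flattened components.\<close>
      show "kernel_comp (contraction X) (kernel_comp (kernel_prod (storage X) (storage X)) (monoidal_map ?E ?E))
        = kernel_comp (storage X) (exp_kernel (contraction X))"
        by (rule dirac_on_eqI, (rule dirac_on_intros objs)+) (auto simp: ms_simps elim!: prod_spaceE)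
    qed (rule homs)
    show "coalgebra_morphism opT exp_functor storage dereliction ?E (storage X) one_space monoidal_unit_map (weakening X)"
    proof (rule coalgebra_morphism.intro[OF coalgebra_exp(1)[OF X] coalgebra_unit coalgebra_morphism_axioms.intro],
        unfold opposite_simps TsKer_simps exp_functor_simps)
      \<comment> \<open>A multiset of empty multisets flattens to the empty multiset, whatever its
        size.\<close>
      show "kernel_comp (weakening X) monoidal_unit_map = kernel_comp (storage X) (exp_kernel (weakening X))"
        by (rule dirac_on_eqI, (rule dirac_on_intros objs)+) (auto simp: ms_simps elim!: prod_spaceE)
    qed (rule homs)
    show "comonoid_morphism opT ?E (contraction X) (weakening X) (exp_space ?E) (contraction ?E) (weakening ?E) (storage X)"
    proof (rule comonoid_morphism.intro[OF commutative_comonoid_exp[OF X] commutative_comonoid_exp comonoid_morphism_axioms.intro],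
        unfold opposite_simps TsKer_simps exp_functor_simps)
      \<comment> \<open>Flattening is a homomorphism of commutative monoids; this line is its
        additivity and the next equation its value at the empty multiset.\<close>
      show "kernel_comp (storage X) (contraction ?E) = kernel_comp (contraction X) (kernel_prod (storage X) (storage X))"
        by (rule dirac_on_eqI, (rule dirac_on_intros objs)+) (auto simp: ms_simps elim!: prod_spaceE)
      show "kernel_comp (storage X) (weakening ?E) = weakening X"
        by (rule dirac_on_eqI, (rule dirac_on_intros objs)+) (auto simp: ms_simps elim!: prod_spaceE)
    qed (simp_all add: homs)
  qed (rule contraction_monoidal weakening_monoidal)+
qed

end
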